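(* Let $M$ be a finite monoid of Lie type with Weyl group $(W,S)$, Renner monoid $R$ and cross-section lattice $\Lambda$, and let $e\in\Lambda$. For all $\theta,\sigma\in WeW$, $$\mu_{\theta,\sigma}=R_{\theta,\sigma}(0),$$ where $\mu$ is the Möbius function of the poset $(WeW,\le)$ under the Bruhat-Chevalley order and $R_{\theta,\sigma}\in\mathbb{Z}[q]$ is the $R$-polynomial of the orbit Hecke algebra of $e$.
   Context: Monoid setting. A finite monoid of Lie type (Putcha) is a finite regular monoid $M$ whose unit group $G$ is a finite group of Lie type, generated by $G$ and its idempotent set $E(M)$, such that for every $e\in E(M)$ the sets $P(e)=\{x\in G: xe=exe\}$ and $P^-(e)=\{x\in G: ex=exe\}$ are opposite parabolic subgroups with $R_u(P(e))e=\{e\}=eR_u(P^-(e))$ ($R_u$ = unipotent radical), and any two $\mathcal J$-equivalent idempotents are $G$-conjugate. Fix a Borel subgroup $B\subseteq G$ with opposite $B^-$ and maximal torus $T=B\cap B^-$; let $W$ be the (finite) Weyl group of $T$, $S$ its set of simple reflections determined by $B$, and $\ell$, $\le$ the length function and Bruhat order of $(W,S)$. The cross-section lattice is $\Lambda=\{e\in E(M): B\subseteq P(e),\ B^-\subseteq P^-(e)\}$. The Renner monoid $R$ is the finite inverse monoid with unit group $W$, consisting of the classes modulo $T$ of the products of representatives of elements of $W$ with $W$-conjugates of elements of $\Lambda$; one has $R=\bigsqcup_{e\in\Lambda}WeW$. Orbit combinatorics. For $e\in\Lambda$ put $W(e)=\{x\in W: xe=ex\}$ and $W_e=\{x\in W: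 xe=e\}$; these are standard parabolic subgroups of $W$ and $W_e$ is normal in $W(e)$. In $WeW$, $aeb^{-1}=a'eb'^{-1}$ iff there is $w\in W(e)$ with $a'\in awW_e$ and $b'\in bwW_e$. Let $D(e)$ (resp. $D_e$) be the set of minimal length representatives of the cosets $xW(e)$ (resp. $xW_e$). Every $\sigma\in WeW$ has a unique standard form $\sigma=xey^{-1}$ with $x\in D_e$, $y\in D(e)$. Set $\ell(e)=\ell(w_0)-\ell(v_0)$, with $w_0,v_0$ the longest elements of $W$, $W(e)$, and $\ell(\sigma)=\ell(x)+\ell(e)-\ell(y)$. The Bruhat-Chevalley order on $WeW$ is: for standard forms $\theta=uev^{-1}$, $\sigma=xey^{-1}$, $\theta\le\sigma$ iff there is $w\in W(e)$ with $u\le xw$ and $yw\le v$ in $W$. $R$-polynomials. Let $q$ be an indeterminate. $\mathcal H(W)$ is the $\mathbb{Z}[q^{\pm1/2}]$-algebra with basis $\{A_w\}_{w\in W}$ and, for $s\in S$, $A_sA_w=A_{sw}$ if $\ell(sw)>\ell(w)$ and $A_sA_w=q^{-1}A_{sw}+(1-q^{-1})A_w$ if $\ell(sw)<\ell(w)$ (so $A_w=q^{-\ell(w)}T_w$ for the usual Hecke basis). Its bar involution is the ring involution with $\overline{q^{1/2}}=q^{-1/2}$, $\overline{A_w}=(A_{w^{-1}})^{-1}$. The Kazhdan-Lusztig $R$-polynomials $R_{x,w}\in\mathbb{Z}[q]$ of $W$ are given by $\overline{A_w}=q^{\ell(w)}\sum_{x\in W}\overline{R_{x,w}}A_x$. The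 orbit Hecke algebra $\mathcal H(e)$ has $\mathbb{Z}[q^{\pm1/2}]$-basis $\{A_\sigma\}_{\sigma\in WeW}$, on which $\mathcal H(W)$ acts on the left by, for $s\in S$: $A_sA_\sigma=A_\sigma$ if $\ell(s\sigma)=\ell(\sigma)$; $A_sA_\sigma=A_{s\sigma}$ if $\ell(s\sigma)=\ell(\sigma)+1$; $A_sA_\sigma=q^{-1}A_{s\sigma}+(1-q^{-1})A_\sigma$ if $\ell(s\sigma)=\ell(\sigma)-1$ (similarly on the right). The involution extends to $\mathcal H(e)$ (Putcha) by: for $\sigma=xet^{-1}$ in standard form, $\overline{A_\sigma}=q^{-\ell(t)}\,\overline{A_x}\sum_{z\in W(e),\,y\in D(e)}\overline{R_{tz,y}}\,A_{zey^{-1}}$. The $R$-polynomials $R_{\theta,\sigma}\in\mathbb{Z}[q]$ ($\theta,\sigma\in WeW$) are defined by $\overline{A_\sigma}=q^{\ell(\sigma)-\ell(e)}\sum_{\theta\in WeW}\overline{R_{\theta,\sigma}}\,A_\theta$; by Putcha, $R_{\theta,\sigma}\ne0$ only if $\theta\le\sigma$, and $R_{\theta,\theta}=1$. Möbius function. $\mu_{\theta,\sigma}=0$ if $\theta\not\le\sigma$, $\mu_{\theta,\theta}=1$, and $\mu_{\theta,\sigma}=-\sum_{\theta\le\tau<\sigma}\mu_{\theta,\tau}$ if $\theta<\sigma$. *)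

theory Defs
  imports
    "HOL-Algebra.Coset"
    "HOL-Algebra.Generated_Groups"
    "HOL-Computational_Algebra.Polynomial"
    "HOL-Computational_Algebra.Primes"
    "HOL-Library.Poly_Mapping"
begin

section \<open>Length and Bruhat order of a group with a generating set of involutions\<close>

definition word_prod :: "('w, 'b) monoid_scheme \<Rightarrow> 'w list \<Rightarrow> 'w" where
  "word_prod W ss = foldr (\<lambda>s x. s \<otimes>\<^bsub>W\<^esub> x) ss \<one>\<^bsub>W\<^esub>"

definition len :: "('w, 'b) monoid_scheme \<Rightarrow> 'w set \<Rightarrow> 'w \<Rightarrow> nat" where
  "len W S w = (LEAST k. \<exists>ss. set ss \<subseteq> S \<and> word_prod W ss = w \<and> length ss = k)"

definition reduced_word :: "('w, 'b) monoid_scheme \<Rightarrow> 'w set \<Rightarrow> 'w \<Rightarrow> 'w list" where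
  "reduced_word W S w =
     (SOME ss. set ss \<subseteq> S \<and> word_prod W ss = w \<and> length ss = len W S w)"

definition reflections :: "('w, 'b) monoid_scheme \<Rightarrow> 'w set \<Rightarrow> 'w set" where
  "reflections W S = {w \<otimes>\<^bsub>W\<^esub> s \<otimes>\<^bsub>W\<^esub> inv\<^bsub>W\<^esub> w | w s. w \<in> carrier W \<and> s \<in> S}"

definition bruhat_le :: "('w, 'b) monoid_scheme \<Rightarrow> 'w set \<Rightarrow> 'w \<Rightarrow> 'w \<Rightarrow> bool" where
  "bruhat_le W S x y \<longleftrightarrow>
     (x, y) \<in> {(u, u \<otimes>\<^bsub>W\<^esub> t) | u t. u \<in> carrier W \<and> t \<in> reflections W S \<and>
                 len W S u < len W S (u \<otimes>\<^bsub>W\<^esub> t)}\<^sup>*"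

definition longest :: "('w, 'b) monoid_scheme \<Rightarrow> 'w set \<Rightarrow> 'w set \<Rightarrow> 'w" where
  "longest W S X = (THE w. w \<in> X \<and> (\<forall>u\<in>X. len W S u \<le> len W S w))"

text \<open>Minimal length representatives of the left cosets \<open>x H\<close>.\<close>

definition min_reps :: "('w, 'b) monoid_scheme \<Rightarrow> 'w set \<Rightarrow> 'w set \<Rightarrow> 'w set" where
  "min_reps W S H = {x \<in> carrier W. \<forall>u\<in>H. len W S x \<le> len W S (x \<otimes>\<^bsub>W\<^esub> u)}"

definition standard_parabolic :: "('w, 'b) monoid_scheme \<Rightarrow> 'w set \<Rightarrow> 'w set \<Rightarrow> bool" where
  "standard_parabolic W S H \<longleftrightarrow> (\<exists>I\<subseteq>S. H = generate W I)"


section \<open>The Moebius function of a finite poset\<close>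

text \<open>For a finite set \<open>X\<close> partially ordered by \<open>leq\<close>, recursion over the (then well-founded)
  strict order on \<open>X\<close> in the second argument.\<close>

definition moebius :: "'b set \<Rightarrow> ('b \<Rightarrow> 'b \<Rightarrow> bool) \<Rightarrow> 'b \<Rightarrow> 'b \<Rightarrow> int" where
  "moebius X leq a =
     wfrec {(t, s). t \<in> X \<and> s \<in> X \<and> leq t s \<and> t \<noteq> s}
       (\<lambda>\<mu> s. if s = a then 1
              else if leq a s then - (\<Sum>t\<in>{t \<in> X. leq a t \<and> leq t s \<and> t \<noteq> s}. \<mu> t)
              else 0)"


section \<open>Laurent polynomials in \<open>q\<^sup>1\<^sup>/\<^sup>2\<close>\<close>

text \<open>The group ring of the additive group of integers: \<open>Poly_Mapping.single k c\<close>
  is \<open>c q\<^bsup>k/2\<^esup>\<close>.\<close>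

type_synonym laurent = "int \<Rightarrow>\<^sub>0 int"

definition qpow :: "int \<Rightarrow> laurent" where
  "qpow k = Poly_Mapping.single (2 * k) 1"

definition lbar :: "laurent \<Rightarrow> laurent" where
  "lbar f = Poly_Mapping.map_key uminus f"

definition at_q :: "int poly \<Rightarrow> laurent" where
  "at_q p = poly (map_poly of_int p) (qpow 1)"


section \<open>The Hecke algebra of \<open>(W, S)\<close>\<close>

text \<open>The free module on a finite set \<open>X\<close> is the set of functions into \<open>laurent\<close> vanishing
  outside \<open>X\<close>.\<close>

definition basis :: "'b \<Rightarrow> 'b \<Rightarrow> laurent" where
  "basis b = (\<lambda>x. if x = b then 1 else 0)"

definition lin_ext :: "'b set \<Rightarrow> ('b \<Rightarrow> 'b \<Rightarrow> laurent) \<Rightarrow> ('b \<Rightarrow> laurent) \<Rightarrow> 'b \<Rightarrow> laurent" where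
  "lin_ext X \<phi> f = (\<lambda>x. \<Sum>b\<in>X. f b * \<phi> b x)"

text \<open>Given \<open>gen s b\<close>, the value of \<open>A\<^sub>s\<close> on the basis vector \<open>b\<close>, every \<open>A\<^sub>w\<close> acts as
  \<open>A\<^bsub>s1\<^esub> \<dots> A\<^bsub>sk\<^esub>\<close> for a reduced expression \<open>w = s1 \<dots> sk\<close> (in \<open>\<H>(W)\<close> the relations force
  \<open>A\<^sub>w = A\<^bsub>s1\<^esub> \<dots> A\<^bsub>sk\<^esub>\<close>, so that the chosen reduced expression is irrelevant).\<close>

definition hecke_act ::
  "('w, 'c) monoid_scheme \<Rightarrow> 'w set \<Rightarrow> 'b set \<Rightarrow> ('w \<Rightarrow> 'b \<Rightarrow> 'b \<Rightarrow> laurent) \<Rightarrow>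
   ('w \<Rightarrow> laurent) \<Rightarrow> ('b \<Rightarrow> laurent) \<Rightarrow> 'b \<Rightarrow> laurent" where
  "hecke_act W S X gen f g =
     (\<lambda>x. \<Sum>w\<in>carrier W. f w * foldr (\<lambda>s. lin_ext X (gen s)) (reduced_word W S w) g x)"

definition hecke_gen :: "('w, 'c) monoid_scheme \<Rightarrow> 'w set \<Rightarrow> 'w \<Rightarrow> 'w \<Rightarrow> 'w \<Rightarrow> laurent" where
  "hecke_gen W S s w =
     (if len W S (s \<otimes>\<^bsub>W\<^esub> w) > len W S w then basis (s \<otimes>\<^bsub>W\<^esub> w)
      else (\<lambda>x. qpow (-1) * basis (s \<otimes>\<^bsub>W\<^esub> w) x + (1 - qpow (-1)) * basis w x))"

definition hecke_mult ::
  "('w, 'c) monoid_scheme \<Rightarrow> 'w set \<Rightarrow> ('w \<Rightarrow> laurent) \<Rightarrow> ('w \<Rightarrow> laurent) \<Rightarrow> 'w \<Rightarrow> laurent" where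
  "hecke_mult W S = hecke_act W S (carrier W) (hecke_gen W S)"

definition hecke_inv ::
  "('w, 'c) monoid_scheme \<Rightarrow> 'w set \<Rightarrow> ('w \<Rightarrow> laurent) \<Rightarrow> 'w \<Rightarrow> laurent" where
  "hecke_inv W S f =
     (THE g. (\<forall>x. x \<notin> carrier W \<longrightarrow> g x = 0) \<and>
             hecke_mult W S f g = basis \<one>\<^bsub>W\<^esub> \<and> hecke_mult W S g f = basis \<one>\<^bsub>W\<^esub>)"

definition hecke_bar ::
  "('w, 'c) monoid_scheme \<Rightarrow> 'w set \<Rightarrow> ('w \<Rightarrow> laurent) \<Rightarrow> 'w \<Rightarrow> laurent" where
  "hecke_bar W S f =
     (\<lambda>x. \<Sum>w\<in>carrier W. lbar (f w) * hecke_inv W S (basis (inv\<^bsub>W\<^esub> w)) x)"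

text \<open>The Kazhdan-Lusztig \<open>R\<close>-polynomial \<open>R\<^bsub>x,w\<^esub>\<close>.\<close>

definition KL_R :: "('w, 'c) monoid_scheme \<Rightarrow> 'w set \<Rightarrow> 'w \<Rightarrow> 'w \<Rightarrow> int poly" where
  "KL_R W S x w =
     (THE p. hecke_bar W S (basis w) x = qpow (int (len W S w)) * lbar (at_q p))"


section \<open>Finite groups of Lie type\<close>

definition torus :: "'a set \<Rightarrow> 'a set \<Rightarrow> 'a set" where
  "torus B N = B \<inter> N"

text \<open>The elements of \<open>W = N / T\<close> are cosets of \<open>T\<close>, i.e. subsets of \<open>G\<close>; products such as
  \<open>B <#> w <#> B\<close> are therefore products of sets.\<close>

definition weyl :: "('a, 'b) monoid_scheme \<Rightarrow> 'a set \<Rightarrow> 'a set \<Rightarrow> 'a set monoid" where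
  "weyl G B N = (G\<lparr>carrier := N\<rparr>) Mod (torus B N)"

locale BN_pair = group G for G :: "('a, 'b) monoid_scheme" (structure) +
  fixes B N :: "'a set" and S :: "'a set set"
  assumes subgroup_B: "subgroup B G"
    and subgroup_N: "subgroup N G"
    and generate_BN: "generate G (B \<union> N) = carrier G"
    and torus_normal: "torus B N \<lhd> G\<lparr>carrier := N\<rparr>"
    and S_subset: "S \<subseteq> carrier (weyl G B N)"
    and generate_S: "generate (weyl G B N) S = carrier (weyl G B N)"
    and S_involution:
      "\<And>s. s \<in> S \<Longrightarrow> s \<noteq> \<one>\<^bsub>weyl G B N\<^esub> \<and> s \<otimes>\<^bsub>weyl G B N\<^esub> s = \<one>\<^bsub>weyl G B N\<^esub>"
    and BN_product:
      "\<And>s w. s \<in> S \<Longrightarrow> w \<in> carrier (weyl G B N) \<Longrightarrow>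
         s <#> B <#> w \<subseteq> (B <#> w <#> B) \<union> (B <#> (s \<otimes>\<^bsub>weyl G B N\<^esub> w) <#> B)"
    and BN_not_normalize: "\<And>s. s \<in> S \<Longrightarrow> \<not> (s <#> B <#> s \<subseteq> B)"

text \<open>The opposite Borel subgroup \<open>w\<^sub>0 B w\<^sub>0\<^sup>-\<^sup>1\<close>.\<close>

definition opp_borel :: "('a, 'b) monoid_scheme \<Rightarrow> 'a set \<Rightarrow> 'a set \<Rightarrow> 'a set set \<Rightarrow> 'a set" where
  "opp_borel G B N S =
     (let W = weyl G B N; w0 = longest W S (carrier W)
      in w0 <#>\<^bsub>G\<^esub> B <#>\<^bsub>G\<^esub> inv\<^bsub>W\<^esub> w0)"

definition P_plus ::
  "('a, 'b) monoid_scheme \<Rightarrow> 'a set \<Rightarrow> 'a set \<Rightarrow> 'a set set \<Rightarrow> 'a set" where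
  "P_plus G B N I = (\<Union>w\<in>generate (weyl G B N) I. B <#>\<^bsub>G\<^esub> w <#>\<^bsub>G\<^esub> B)"

definition P_minus ::
  "('a, 'b) monoid_scheme \<Rightarrow> 'a set \<Rightarrow> 'a set \<Rightarrow> 'a set set \<Rightarrow> 'a set set \<Rightarrow> 'a set" where
  "P_minus G B N S I =
     (\<Union>w\<in>generate (weyl G B N) I. opp_borel G B N S <#>\<^bsub>G\<^esub> w <#>\<^bsub>G\<^esub> opp_borel G B N S)"

definition opposite_parabolics ::
  "('a, 'b) monoid_scheme \<Rightarrow> 'a set \<Rightarrow> 'a set \<Rightarrow> 'a set set \<Rightarrow> 'a set \<Rightarrow> 'a set \<Rightarrow> bool" where
  "opposite_parabolics G B N S P Q \<longleftrightarrow>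
     (\<exists>g\<in>carrier G. \<exists>I\<subseteq>S. P = g <#\<^bsub>G\<^esub> P_plus G B N I #>\<^bsub>G\<^esub> inv\<^bsub>G\<^esub> g \<and>
                       Q = g <#\<^bsub>G\<^esub> P_minus G B N S I #>\<^bsub>G\<^esub> inv\<^bsub>G\<^esub> g)"

text \<open>In a finite group of Lie type of characteristic \<open>p\<close> the unipotent radical of a parabolic
  subgroup \<open>P\<close> is its largest normal \<open>p\<close>-subgroup. The union below is that subgroup, as the
  product of two normal \<open>p\<close>-subgroups is again one.\<close>

definition unip_radical :: "nat \<Rightarrow> ('a, 'b) monoid_scheme \<Rightarrow> 'a set \<Rightarrow> 'a set" where
  "unip_radical p G P = \<Union>{H. H \<lhd> G\<lparr>carrier := P\<rparr> \<and> (\<exists>k. card H = p ^ k)}"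

text \<open>A finite group of Lie type is taken to be a finite group with a split BN-pair of
  characteristic \<open>p\<close> whose standard parabolic subgroups have Levi decompositions
  \<open>P\<^sub>I = R\<^sub>u(P\<^sub>I) (P\<^sub>I \<inter> P\<^sub>I\<^sup>-)\<close>. For \<open>G = \<^bold>G\<^sup>F\<close> with \<open>\<^bold>G\<close> connected reductive and \<open>F\<close> a
  Frobenius map these hold for the \<open>F\<close>-fixed points of an \<open>F\<close>-stable Borel subgroup and of the
  normalizer of an \<open>F\<close>-stable maximal torus in it.\<close>

locale finite_group_of_Lie_type = BN_pair G B N S
  for G :: "('a, 'b) monoid_scheme" (structure) and B N S +
  fixes p :: nat
  assumes finite_carrier: "finite (carrier G)"
    and prime_p: "prime p"
    and saturated: "(\<Inter>n\<in>N. n <# B #> inv n) = torus B N"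
    and torus_comm: "\<And>x y. x \<in> torus B N \<Longrightarrow> y \<in> torus B N \<Longrightarrow> x \<otimes> y = y \<otimes> x"
    and torus_coprime: "coprime p (card (torus B N))"
    and borel_split: "B = unip_radical p G B <#> torus B N"
      "unip_radical p G B \<inter> torus B N = {\<one>}"
    and levi: "\<And>I. I \<subseteq> S \<Longrightarrow>
        P_plus G B N I =
          unip_radical p G (P_plus G B N I) <#> (P_plus G B N I \<inter> P_minus G B N S I)"
      "\<And>I. I \<subseteq> S \<Longrightarrow>
        unip_radical p G (P_plus G B N I) \<inter> (P_plus G B N I \<inter> P_minus G B N S I) = {\<one>}"


section \<open>Finite monoids of Lie type\<close>

definition idempotents :: "('a, 'b) monoid_scheme \<Rightarrow> 'a set" where
  "idempotents M = {e \<in> carrier M. e \<otimes>\<^bsub>M\<^esub> e = e}"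

definition P_right :: "('a, 'b) monoid_scheme \<Rightarrow> 'a \<Rightarrow> 'a set" where
  "P_right M e = {x \<in> Units M. x \<otimes>\<^bsub>M\<^esub> e = e \<otimes>\<^bsub>M\<^esub> x \<otimes>\<^bsub>M\<^esub> e}"

definition P_left :: "('a, 'b) monoid_scheme \<Rightarrow> 'a \<Rightarrow> 'a set" where
  "P_left M e = {x \<in> Units M. e \<otimes>\<^bsub>M\<^esub> x = e \<otimes>\<^bsub>M\<^esub> x \<otimes>\<^bsub>M\<^esub> e}"

definition J_equiv :: "('a, 'b) monoid_scheme \<Rightarrow> 'a \<Rightarrow> 'a \<Rightarrow> bool" where
  "J_equiv M a b \<longleftrightarrow>
     carrier M <#>\<^bsub>M\<^esub> {a} <#>\<^bsub>M\<^esub> carrier M = carrier M <#>\<^bsub>M\<^esub> {b} <#>\<^bsub>M\<^esub> carrier M"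

locale finite_monoid_of_Lie_type = monoid M
  for M :: "('a, 'b) monoid_scheme" (structure) +
  fixes B N :: "'a set" and S :: "'a set set" and p :: nat
  assumes finite_monoid: "finite (carrier M)"
    and regular: "\<And>a. a \<in> carrier M \<Longrightarrow> \<exists>x\<in>carrier M. a = a \<otimes> x \<otimes> a"
    and unit_group: "finite_group_of_Lie_type (units_of M) B N S p"
    and generated:
      "\<And>H. submonoid H M \<Longrightarrow> Units M \<union> idempotents M \<subseteq> H \<Longrightarrow> H = carrier M"
    and opposite:
      "\<And>e. e \<in> idempotents M \<Longrightarrow>
         opposite_parabolics (units_of M) B N S (P_right M e) (P_left M e)"
    and radical_right:
      "\<And>e. e \<in> idempotents M \<Longrightarrow> unip_radical p (units_of M) (P_right M e) <#> {e} = {e}"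
    and radical_left:
      "\<And>e. e \<in> idempotents M \<Longrightarrow> {e} <#> unip_radical p (units_of M) (P_left M e) = {e}"
    and J_conj:
      "\<And>e f. e \<in> idempotents M \<Longrightarrow> f \<in> idempotents M \<Longrightarrow> J_equiv M e f \<Longrightarrow>
         \<exists>g\<in>Units M. f = g \<otimes> e \<otimes> inv g"

definition cross_section ::
  "('a, 'b) monoid_scheme \<Rightarrow> 'a set \<Rightarrow> 'a set \<Rightarrow> 'a set set \<Rightarrow> 'a set" where
  "cross_section M B N S =
     {e \<in> idempotents M. B \<subseteq> P_right M e \<and> opp_borel (units_of M) B N S \<subseteq> P_left M e}"

text \<open>The torus commutes with every \<open>e \<in> \<Lambda>\<close>, so that the class of \<open>x\<close> modulo \<open>T\<close> is
  \<open>T x = x T\<close> for all \<open>x\<close> representing an element of the Renner monoid.\<close>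

definition renner ::
  "('a, 'b) monoid_scheme \<Rightarrow> 'a set \<Rightarrow> 'a set \<Rightarrow> 'a set set \<Rightarrow> 'a set monoid" where
  "renner M B N S =
     (let W = weyl (units_of M) B N in
      \<lparr>carrier = {w <#>\<^bsub>M\<^esub> (x <#>\<^bsub>M\<^esub> (torus B N #>\<^bsub>M\<^esub> e) <#>\<^bsub>M\<^esub> inv\<^bsub>W\<^esub> x) | w x e.
                    w \<in> carrier W \<and> x \<in> carrier W \<and> e \<in> cross_section M B N S},
       monoid.mult = set_mult M, one = torus B N\<rparr>)"


section \<open>The orbit \<open>W e W\<close> and its Hecke algebra\<close>

locale orbit_data =
  fixes M :: "('a, 'b) monoid_scheme" and B N :: "'a set" and S :: "'a set set" and e :: 'a
begin

abbreviation "W \<equiv> weyl (units_of M) B N"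
abbreviation "R \<equiv> renner M B N S"
abbreviation "\<l> \<equiv> len W S"

definition e_class :: "'a set" where
  "e_class = torus B N #>\<^bsub>M\<^esub> e"

definition orbit :: "'a set set" where
  "orbit = {x \<otimes>\<^bsub>R\<^esub> e_class \<otimes>\<^bsub>R\<^esub> y | x y. x \<in> carrier W \<and> y \<in> carrier W}"

text \<open>\<open>W(e)\<close> and \<open>W\<^sub>e\<close>, with their minimal coset representatives \<open>D(e)\<close> and \<open>D\<^sub>e\<close>.
  Over very small fields the axioms of \<open>finite_monoid_of_Lie_type\<close> do not force \<open>W\<^sub>e\<close> to be a
  standard parabolic subgroup: \<open>Sym(3) \<times> Sym(3)\<close> with \<open>p = 2\<close>, extended by the quotient of order \<open>2\<close> via
  the product of the signs, has \<open>W\<^sub>e = {1, s t}\<close>. Standard forms are then not unique.\<close>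

definition W_comm :: "'a set set" where
  "W_comm = {x \<in> carrier W. x \<otimes>\<^bsub>R\<^esub> e_class = e_class \<otimes>\<^bsub>R\<^esub> x}"

definition W_fix :: "'a set set" where
  "W_fix = {x \<in> carrier W. x \<otimes>\<^bsub>R\<^esub> e_class = e_class}"

definition D_comm :: "'a set set" where
  "D_comm = min_reps W S W_comm"

definition D_fix :: "'a set set" where
  "D_fix = min_reps W S W_fix"

definition elt :: "'a set \<Rightarrow> 'a set \<Rightarrow> 'a set" where
  "elt x y = x \<otimes>\<^bsub>R\<^esub> e_class \<otimes>\<^bsub>R\<^esub> inv\<^bsub>W\<^esub> y"

definition std_form :: "'a set \<Rightarrow> 'a set \<times> 'a set" where
  "std_form \<sigma> = (THE (x, y). x \<in> D_fix \<and> y \<in> D_comm \<and> \<sigma> = elt x y)"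

definition e_len :: int where
  "e_len = int (\<l> (longest W S (carrier W))) - int (\<l> (longest W S W_comm))"

definition orbit_len :: "'a set \<Rightarrow> int" where
  "orbit_len \<sigma> = (case std_form \<sigma> of (x, y) \<Rightarrow> int (\<l> x) + e_len - int (\<l> y))"

definition orbit_le :: "'a set \<Rightarrow> 'a set \<Rightarrow> bool" where
  "orbit_le \<theta> \<sigma> \<longleftrightarrow>
     (case std_form \<theta> of (u, v) \<Rightarrow> case std_form \<sigma> of (x, y) \<Rightarrow>
        \<exists>w\<in>W_comm. bruhat_le W S u (x \<otimes>\<^bsub>W\<^esub> w) \<and> bruhat_le W S (y \<otimes>\<^bsub>W\<^esub> w) v)"

definition orbit_moebius :: "'a set \<Rightarrow> 'a set \<Rightarrow> int" where
  "orbit_moebius = moebius orbit orbit_le"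

text \<open>The left action of \<open>A\<^sub>s\<close> on the basis of \<open>\<H>(e)\<close>; the lengths of \<open>s \<sigma>\<close> and \<open>\<sigma>\<close> differ
  by at most \<open>1\<close>.\<close>

definition orbit_gen :: "'a set \<Rightarrow> 'a set \<Rightarrow> 'a set \<Rightarrow> laurent" where
  "orbit_gen s \<sigma> =
     (if orbit_len (s \<otimes>\<^bsub>R\<^esub> \<sigma>) = orbit_len \<sigma> then basis \<sigma>
      else if orbit_len (s \<otimes>\<^bsub>R\<^esub> \<sigma>) = orbit_len \<sigma> + 1 then basis (s \<otimes>\<^bsub>R\<^esub> \<sigma>)
      else (\<lambda>\<tau>. qpow (-1) * basis (s \<otimes>\<^bsub>R\<^esub> \<sigma>) \<tau> + (1 - qpow (-1)) * basis \<sigma> \<tau>))"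

definition orbit_act ::
  "('a set \<Rightarrow> laurent) \<Rightarrow> ('a set \<Rightarrow> laurent) \<Rightarrow> 'a set \<Rightarrow> laurent" where
  "orbit_act = hecke_act W S orbit orbit_gen"

definition orbit_bar_basis :: "'a set \<Rightarrow> 'a set \<Rightarrow> laurent" where
  "orbit_bar_basis \<sigma> =
     (case std_form \<sigma> of (x, t) \<Rightarrow>
        (\<lambda>\<tau>. qpow (- int (\<l> t)) *
          orbit_act (hecke_bar W S (basis x))
            (\<lambda>\<rho>. \<Sum>z\<in>W_comm. \<Sum>y\<in>D_comm.
               lbar (at_q (KL_R W S (t \<otimes>\<^bsub>W\<^esub> z) y)) * basis (elt z y) \<rho>) \<tau>))"

definition orbit_bar :: "('a set \<Rightarrow> laurent) \<Rightarrow> 'a set \<Rightarrow> laurent" where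
  "orbit_bar f = (\<lambda>\<tau>. \<Sum>\<sigma>\<in>orbit. lbar (f \<sigma>) * orbit_bar_basis \<sigma> \<tau>)"

definition orbit_R :: "'a set \<Rightarrow> 'a set \<Rightarrow> int poly" where
  "orbit_R \<theta> \<sigma> =
     (THE p. orbit_bar (basis \<sigma>) \<theta> = qpow (orbit_len \<sigma> - e_len) * lbar (at_q p))"

end

end

(* Divided by q^(l(sigma) - l(e)), the bar involution of the orbit Hecke algebra is polynomial in
   q^-1, and at q^-1 = 0 the algebra H(W) becomes the 0-Hecke algebra, with idempotent generators
   A_s. There the normalised inverse of A_s is C_s = A_s - 1, and A_w is the sum of the C_u over
   u <= w in Bruhat order. For a standard form sigma = x e t^-1 the values R_{theta,sigma}(0) are
   the coordinates of C_x Y_t, where Y_t is a combination of the A_{z e d^-1} with coefficients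
   R_{tz,d}(0), z in W(e), d in D(e). Expanding C_d, d in D(e), first in the A_y A_z and then in the
   C_v C_w with v, y in D(e) and w, z in W(e) gives two mutually inverse matrices over the 0-Hecke
   algebra of W(e), hence A_{e y^-1} is the sum of the C_w Y_v over v in D(e) and w in W(e) with
   y w <= v. Applying A_x yields A_sigma as the sum over theta <= sigma of the vectors belonging to
   theta, so the matrix R_{theta,sigma}(0) is inverse to the zeta matrix of the poset.

   That W is a Coxeter group is derived from the BN-pair through the exchange condition. *)
theory Submission
  imports Defs
begin

text \<open>At parameter 0, (1 + C_s) C_u is C_u + C_{su} if s u is longer than u, and 0 otherwise.
  So sums of C_u stay multiplicity free under A_s, and A_x turns the sum over a lower set K of W(e)
  into the sum over all u below some x w with w in K. This union of Bruhat ideals is the existential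
  quantifier in the order of the orbit. Indices u outside D_e drop out: such a u has a reduced word
  ending in a simple reflection s of W_e, and by normality of W_e in W(e) the factor C_s annihilates
  every A_{z e d^-1} with z in W(e). The obstacle is that the Hecke operators are defined along
  arbitrarily chosen reduced words, over Laurent polynomials. Independence of the word is obtained
  without braid relations: left operators commute with right multiplications and are therefore
  determined by their value at the identity. The operators exist over every commutative ring, so a
  computation over \<open>int poly\<close> can be carried by evaluation at q^-1 to the given
  definitions and by evaluation at 0 to the 0-Hecke algebra.\<close>

lemma (in group) inv_cancel [simp]:
  assumes "x \<in> carrier G" "y \<in> carrier G"
  shows "inv x \<otimes> (x \<otimes> y) = y" "x \<otimes> (inv x \<otimes> y) = y"
    "y \<otimes> x \<otimes> inv x = y" "y \<otimes> inv x \<otimes> x = y"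
  using assms by (simp_all add: m_assoc[symmetric]) (simp_all add: m_assoc)

text \<open>A discrete intermediate value principle on the prefixes of a word. Applied to the
  property of lying on one side of a wall, it finds the letter at which the path spelled by the word
  crosses that wall; the exchange arguments rest on it.\<close>

lemma chain_break:
  assumes "P [] \<noteq> P ss"
  obtains us r vs where "ss = us @ r # vs" "P us \<noteq> P (us @ [r])"
proof -
  have "\<exists>us r vs. ss = us @ r # vs \<and> P us \<noteq> P (us @ [r])"
    using assms
  proof (induction ss rule: rev_induct)
    case (snoc x xs)
    show ?case
    proof (cases "P xs = P (xs @ [x])")
      case True
      then obtain us r vs where "xs = us @ r # vs \<and> P us \<noteq> P (us @ [r])" using snoc by auto
      then show ?thesis by (intro exI[of _ us] exI[of _ r] exI[of _ "vs @ [x]"]) auto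
    qed (auto intro!: exI[of _ xs])
  qed simp
  then show ?thesis using that by blast
qed

section \<open>Words and length in a group generated by involutions\<close>

locale involution_group = group W for W :: "('w, 'c) monoid_scheme" (structure) +
  fixes S :: "'w set"
  assumes finite_carrier: "finite (carrier W)"
    and S_subset: "S \<subseteq> carrier W"
    and generate_S: "generate W S = carrier W"
    and S_square: "\<And>s. s \<in> S \<Longrightarrow> s \<otimes> s = \<one>"
begin

abbreviation "wp \<equiv> word_prod W"
abbreviation "rw \<equiv> reduced_word W S"
abbreviation "l \<equiv> len W S"

lemma S_closed [simp, intro]: "s \<in> S \<Longrightarrow> s \<in> carrier W"
  using S_subset by blast

lemma S_inv [simp]: "s \<in> S \<Longrightarrow> inv s = s"
  using S_square inv_equality by blast

lemma S_cancel [simp]: "s \<in> S \<Longrightarrow> w \<in> carrier W \<Longrightarrow> s \<otimes> (s \<otimes> w) = w"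
  using S_square m_assoc by (metis S_closed l_one)

lemma S_cancel_right [simp]: "s \<in> S \<Longrightarrow> w \<in> carrier W \<Longrightarrow> w \<otimes> s \<otimes> s = w"
  using S_square m_assoc by (metis S_closed r_one)

lemma wp_simps [simp]: "wp [] = \<one>" "wp (s # ss) = s \<otimes> wp ss"
  by (simp_all add: word_prod_def)

lemma wp_closed [simp, intro]: "set ss \<subseteq> S \<Longrightarrow> wp ss \<in> carrier W"
  by (induction ss) auto

lemma wp_append: "set ss \<subseteq> S \<Longrightarrow> set ts \<subseteq> S \<Longrightarrow> wp (ss @ ts) = wp ss \<otimes> wp ts"
  by (induction ss) (auto simp: m_assoc)

lemma wp_rev: "set ss \<subseteq> S \<Longrightarrow> wp (rev ss) = inv (wp ss)"
  by (induction ss) (auto simp: wp_append inv_mult_group)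

lemma ex_word_generate:
  assumes "w \<in> generate W J" "J \<subseteq> S"
  shows "\<exists>ss. set ss \<subseteq> J \<and> wp ss = w"
  using assms(1)
proof induction
  case one
  then show ?case by (intro exI[of _ "[]"]) auto
next
  case (incl h)
  then show ?case using assms(2) by (intro exI[of _ "[h]"]) auto
next
  case (inv h)
  then show ?case using assms(2) by (intro exI[of _ "[h]"]) auto
next
  case (eng h1 h2)
  then obtain ss ts where "set ss \<subseteq> J" "wp ss = h1" "set ts \<subseteq> J" "wp ts = h2" by blast
  then show ?case using assms(2) by (intro exI[of _ "ss @ ts"]) (auto intro!: wp_append)
qed

lemma wp_generate: "set ss \<subseteq> J \<Longrightarrow> wp ss \<in> generate W J"
  by (induction ss) (auto intro: generate.intros)

lemma reduced_word:
  assumes "w \<in> carrier W"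
  shows "set (rw w) \<subseteq> S" "wp (rw w) = w" "length (rw w) = l w"
proof -
  have "\<exists>ss. set ss \<subseteq> S \<and> wp ss = w"
    using ex_word_generate[of w S] generate_S assms by auto
  then have "\<exists>k ss. set ss \<subseteq> S \<and> wp ss = w \<and> length ss = k" by auto
  then have "\<exists>ss. set ss \<subseteq> S \<and> wp ss = w \<and> length ss = l w"
    unfolding len_def by (rule LeastI_ex)
  then have "set (rw w) \<subseteq> S \<and> wp (rw w) = w \<and> length (rw w) = l w"
    unfolding reduced_word_def by (rule someI_ex)
  then show "set (rw w) \<subseteq> S" "wp (rw w) = w" "length (rw w) = l w" by auto
qed

lemma len_wp_le: "set ss \<subseteq> S \<Longrightarrow> l (wp ss) \<le> length ss"
  unfolding len_def by (rule Least_le) auto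

lemma len_one [simp]: "l \<one> = 0"
  using len_wp_le[of "[]"] by simp

lemma len_eq_0: "w \<in> carrier W \<Longrightarrow> l w = 0 \<longleftrightarrow> w = \<one>"
  using reduced_word[of w] by fastforce

lemma len_mult_le: "x \<in> carrier W \<Longrightarrow> y \<in> carrier W \<Longrightarrow> l (x \<otimes> y) \<le> l x + l y"
  using len_wp_le[of "rw x @ rw y"] reduced_word[of x] reduced_word[of y] by (simp add: wp_append)

lemma len_S_le: "s \<in> S \<Longrightarrow> l s \<le> 1"
  using len_wp_le[of "[s]"] by simp

lemma len_inv [simp]:
  assumes "w \<in> carrier W" shows "l (inv w) = l w"
proof -
  have le: "l (inv x) \<le> l x" if "x \<in> carrier W" for x
    using len_wp_le[of "rev (rw x)"] reduced_word[of x] that by (simp add: wp_rev)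
  show ?thesis using le[of w] le[of "inv w"] assms by simp
qed

lemma len_mult_S_le:
  assumes "s \<in> S" "w \<in> carrier W"
  shows "l (s \<otimes> w) \<le> Suc (l w)" "l w \<le> Suc (l (s \<otimes> w))"
    "l (w \<otimes> s) \<le> Suc (l w)" "l w \<le> Suc (l (w \<otimes> s))"
  using len_mult_le[of s w] len_mult_le[of s "s \<otimes> w"] len_mult_le[of w s] len_mult_le[of "w \<otimes> s" s]
    len_S_le[of s] assms by auto

lemma len_step:
  assumes "w \<in> carrier W" "l w = Suc n"
  obtains s u where "s \<in> S" "u \<in> carrier W" "w = s \<otimes> u" "l u = n"
proof -
  obtain s ss where ss: "rw w = s # ss" using reduced_word[OF assms(1)] assms(2) by (cases "rw w") auto
  have "l (wp ss) \<le> n" using len_wp_le[of ss] ss reduced_word[OF assms(1)] assms(2) by auto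
  moreover have "w = s \<otimes> wp ss" "s \<in> S" "set ss \<subseteq> S"
    using ss reduced_word[OF assms(1)] by auto
  ultimately show ?thesis using that[of s "wp ss"] len_mult_S_le[of s "wp ss"] assms(2) by auto
qed

lemma len_induct [consumes 1, case_names one mult]:
  assumes "w \<in> carrier W" "P \<one>"
    "\<And>s u. s \<in> S \<Longrightarrow> u \<in> carrier W \<Longrightarrow> l (s \<otimes> u) = Suc (l u) \<Longrightarrow> P u \<Longrightarrow> P (s \<otimes> u)"
  shows "P w"
  using assms(1)
proof (induction "l w" arbitrary: w)
  case 0
  then show ?case using len_eq_0 assms(2) by auto
next
  case (Suc n)
  then show ?case using len_step[of w n] assms(3) by metis
qed

lemma len_induct_right [consumes 1, case_names one mult]:
  assumes "w \<in> carrier W" "P \<one>"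
    "\<And>s u. s \<in> S \<Longrightarrow> u \<in> carrier W \<Longrightarrow> l (u \<otimes> s) = Suc (l u) \<Longrightarrow> P u \<Longrightarrow> P (u \<otimes> s)"
  shows "P w"
proof -
  have "P (inv x)" if "x \<in> carrier W" for x
    using that
  proof (induction x rule: len_induct)
    case one
    then show ?case using assms(2) by simp
  next
    case (mult s u)
    have "l (inv u \<otimes> s) = l (inv (s \<otimes> u))" using mult by (simp add: inv_mult_group)
    then have "P (inv u \<otimes> s)" using assms(3)[of s "inv u"] mult by simp
    then show ?case using mult by (simp add: inv_mult_group)
  qed
  from this[of "inv w"] assms(1) show ?thesis by simp
qed

end

text \<open>A folding form of the exchange condition is used instead of a presentation, because it
  is what the double cosets of a BN-pair deliver. By the first axiom every s splits the group into
  two half-spaces; by the second, an edge (w, w r) that leaves the half-space l w < l (s w) is an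
  edge flipped by s.\<close>

locale coxeter_group = involution_group +
  assumes len_neq: "\<And>s w. s \<in> S \<Longrightarrow> w \<in> carrier W \<Longrightarrow> l (s \<otimes> w) \<noteq> l w"
    and folding: "\<And>s r w. s \<in> S \<Longrightarrow> r \<in> S \<Longrightarrow> w \<in> carrier W \<Longrightarrow> l w < l (s \<otimes> w) \<Longrightarrow>
       l (s \<otimes> w \<otimes> r) < l (w \<otimes> r) \<Longrightarrow> s \<otimes> w = w \<otimes> r"
begin

lemma len_up_iff: "s \<in> S \<Longrightarrow> w \<in> carrier W \<Longrightarrow> l w < l (s \<otimes> w) \<longleftrightarrow> l (s \<otimes> w) = Suc (l w)"
  using len_mult_S_le[of s w] by auto

lemma len_down_iff: "s \<in> S \<Longrightarrow> w \<in> carrier W \<Longrightarrow> l (s \<otimes> w) < l w \<longleftrightarrow> l w = Suc (l (s \<otimes> w))"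
  using len_mult_S_le[of s w] by auto

lemma not_down_iff: "s \<in> S \<Longrightarrow> w \<in> carrier W \<Longrightarrow> \<not> l (s \<otimes> w) < l w \<longleftrightarrow> l w < l (s \<otimes> w)"
  using len_neq[of s w] by auto

lemma len_S [simp]: "s \<in> S \<Longrightarrow> l s = 1"
  using len_S_le[of s] len_neq[of s \<one>] by simp

lemma len_neq_right: "s \<in> S \<Longrightarrow> w \<in> carrier W \<Longrightarrow> l (w \<otimes> s) \<noteq> l w"
  using len_neq[of s "inv w"] len_inv[of "w \<otimes> s"] by (simp add: inv_mult_group)

text \<open>\<open>folding\<close> treats the edges that leave the half-space; entering it is the
  same statement read from \<open>w r\<close>. Conversely s exchanges the two half-spaces, so an
  edge flipped by s always crosses.\<close>

lemma fold_iff: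
  assumes "s \<in> S" "r \<in> S" "w \<in> carrier W"
  shows "(l w < l (s \<otimes> w)) \<noteq> (l (w \<otimes> r) < l (s \<otimes> (w \<otimes> r))) \<longleftrightarrow> s \<otimes> w = w \<otimes> r"
proof -
  have c: "w \<in> carrier W" "w \<otimes> r \<in> carrier W" using assms by auto
  have eq: "s \<otimes> w = w \<otimes> r" if "s \<otimes> (w \<otimes> r) = w"
    using that assms c by (metis S_cancel)
  have *: "s \<otimes> w = w \<otimes> r" if "l w < l (s \<otimes> w)" "\<not> l (w \<otimes> r) < l (s \<otimes> (w \<otimes> r))"
    using folding[of s r w] not_down_iff[of s "w \<otimes> r"] that assms c by (auto simp: m_assoc)
  have **: "s \<otimes> w = w \<otimes> r" if "\<not> l w < l (s \<otimes> w)" "l (w \<otimes> r) < l (s \<otimes> (w \<otimes> r))"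
  proof -
    have "s \<otimes> (w \<otimes> r) = w \<otimes> r \<otimes> r"
      using folding[of s r "w \<otimes> r"] not_down_iff[of s w] that assms c by (auto simp: m_assoc[symmetric])
    then show ?thesis using eq assms by simp
  qed
  have "(l w < l (s \<otimes> w)) \<noteq> (l (w \<otimes> r) < l (s \<otimes> (w \<otimes> r)))" if "s \<otimes> w = w \<otimes> r"
    using that len_neq[of s w] S_cancel[of s w] assms by (metis linorder_neqE_nat order_less_asym)
  then show ?thesis using * ** by blast
qed

lemma crossing:
  assumes "s \<in> S" "a \<in> carrier W" "set ss \<subseteq> S"
    "(l a < l (s \<otimes> a)) \<noteq> (l (a \<otimes> wp ss) < l (s \<otimes> (a \<otimes> wp ss)))"
  obtains us r vs where "ss = us @ r # vs" "s \<otimes> (a \<otimes> wp us) = a \<otimes> wp us \<otimes> r"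
proof -
  obtain us r vs where ss: "ss = us @ r # vs"
    and ch: "(l (a \<otimes> wp us) < l (s \<otimes> (a \<otimes> wp us))) \<noteq> (l (a \<otimes> wp (us @ [r])) < l (s \<otimes> (a \<otimes> wp (us @ [r]))))"
    using chain_break[of "\<lambda>us. l (a \<otimes> wp us) < l (s \<otimes> (a \<otimes> wp us))" ss] assms by auto
  have "set us \<subseteq> S" "r \<in> S" using ss assms by auto
  then have "s \<otimes> (a \<otimes> wp us) = a \<otimes> wp us \<otimes> r"
    using fold_iff[of s r "a \<otimes> wp us"] ch assms by (simp add: wp_append m_assoc)
  then show ?thesis using that ss by blast
qed

lemma reflectionsE:
  assumes "t \<in> reflections W S"
  obtains x s where "x \<in> carrier W" "s \<in> S" "t = x \<otimes> s \<otimes> inv x"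
  using assms by (auto simp: reflections_def)

lemma reflection_closed [simp, intro]: "t \<in> reflections W S \<Longrightarrow> t \<in> carrier W"
  by (erule reflectionsE) simp

lemma reflection_square [simp]: "t \<in> reflections W S \<Longrightarrow> w \<in> carrier W \<Longrightarrow> t \<otimes> (t \<otimes> w) = w"
  by (erule reflectionsE) (simp add: m_assoc)

lemma reflection_inv [simp]: "t \<in> reflections W S \<Longrightarrow> inv t = t"
  by (erule reflectionsE) (simp add: m_assoc inv_mult_group)

lemma S_reflection: "s \<in> S \<Longrightarrow> s \<in> reflections W S"
  unfolding reflections_def by (force intro!: exI[of _ \<one>] exI[of _ s])

lemma reflection_conj:
  assumes "t \<in> reflections W S" "y \<in> carrier W"
  shows "y \<otimes> t \<otimes> inv y \<in> reflections W S"
proof -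
  obtain x s where "x \<in> carrier W" "s \<in> S" "t = x \<otimes> s \<otimes> inv x" using assms reflectionsE by blast
  then have "y \<otimes> t \<otimes> inv y = (y \<otimes> x) \<otimes> s \<otimes> inv (y \<otimes> x)" "y \<otimes> x \<in> carrier W"
    using assms by (simp_all add: m_assoc inv_mult_group)
  then show ?thesis using \<open>s \<in> S\<close> unfolding reflections_def by blast
qed

text \<open>Translating the two half-spaces \<open>{w. l w < l (s w)}\<close> and its complement by \<open>x\<close> gives
  half-spaces whose boundary is crossed exactly at the edges \<open>(w, w r)\<close> with \<open>t w = w r\<close>, where
  \<open>t = x s x\<^sup>-\<^sup>1\<close>; this yields the sign cocycle of \<open>t\<close> without the reflection representation.\<close>

lemma reflection_cocycle_aux:
  assumes "x \<in> carrier W" "s \<in> S" "t = x \<otimes> s \<otimes> inv x"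
  defines "h w \<equiv> (l (inv x \<otimes> w) < l (s \<otimes> (inv x \<otimes> w))) \<noteq> (l (inv x) < l (s \<otimes> inv x))"
  shows "r \<in> S \<Longrightarrow> w \<in> carrier W \<Longrightarrow> h w \<noteq> h (w \<otimes> r) \<longleftrightarrow> t \<otimes> w = w \<otimes> r"
    and "set ss \<subseteq> S \<Longrightarrow> h (wp ss) \<Longrightarrow>
      \<exists>us r vs. ss = us @ r # vs \<and> t \<otimes> wp us = wp us \<otimes> r"
    and "w \<in> carrier W \<Longrightarrow> h w \<longleftrightarrow> l (t \<otimes> w) < l w"
proof -
  show edge: "h w \<noteq> h (w \<otimes> r) \<longleftrightarrow> t \<otimes> w = w \<otimes> r" if "r \<in> S" "w \<in> carrier W" for r w
  proof -
    have "h w \<noteq> h (w \<otimes> r) \<longleftrightarrow> s \<otimes> (inv x \<otimes> w) = inv x \<otimes> w \<otimes> r"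
      using fold_iff[of s r "inv x \<otimes> w"] that assms(1-3) unfolding h_def by (simp add: m_assoc) blast
    also have "\<dots> \<longleftrightarrow> x \<otimes> (s \<otimes> (inv x \<otimes> w)) = x \<otimes> (inv x \<otimes> w \<otimes> r)"
      using that assms(1-3) by simp
    also have "\<dots> \<longleftrightarrow> t \<otimes> w = w \<otimes> r" using that assms(1-3) by (simp add: m_assoc)
    finally show ?thesis .
  qed
  have h1: "\<not> h \<one>" using assms(1) unfolding h_def by simp
  show word: "\<exists>us r vs. ss = us @ r # vs \<and> t \<otimes> wp us = wp us \<otimes> r"
    if "set ss \<subseteq> S" "h (wp ss)" for ss
  proof -
    have "h (wp []) \<noteq> h (wp ss)" using that h1 by simp
    from chain_break[of "\<lambda>us. h (wp us)", OF this]
    obtain us r vs where ss: "ss = us @ r # vs" "h (wp us) \<noteq> h (wp (us @ [r]))" by metis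
    then have "t \<otimes> wp us = wp us \<otimes> r"
      using edge[of r "wp us"] that by (auto simp: wp_append)
    then show ?thesis using ss by blast
  qed
  have t: "t \<in> reflections W S" using assms(1-3) unfolding reflections_def by blast
  have less: "l (t \<otimes> w) < l w" if w: "w \<in> carrier W" "h w" for w
  proof -
    obtain us r vs where ss: "rw w = us @ r # vs" "t \<otimes> wp us = wp us \<otimes> r"
      using word[of "rw w"] reduced_word[OF w(1)] w(2) by auto
    have sub: "set us \<subseteq> S" "r \<in> S" "set vs \<subseteq> S" using ss reduced_word[OF w(1)] by auto
    have "w = wp us \<otimes> r \<otimes> wp vs"
      using reduced_word[OF w(1)] ss sub by (metis m_assoc wp_append wp_closed wp_simps(2) S_closed insert_subset list.simps(15))
    then have "t \<otimes> w = (t \<otimes> wp us) \<otimes> r \<otimes> wp vs" using sub t by (simp add: m_assoc)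
    also have "\<dots> = wp (us @ vs)" using sub by (simp add: ss wp_append)
    finally have "l (t \<otimes> w) \<le> length (us @ vs)" using len_wp_le[of "us @ vs"] sub by simp
    then show ?thesis using ss reduced_word[OF w(1)] by simp
  qed
  show "h w \<longleftrightarrow> l (t \<otimes> w) < l w" if w: "w \<in> carrier W" for w
  proof -
    \<comment> \<open>Multiplication by t exchanges the two sides, so exactly one of w and
      \<open>t w\<close> satisfies \<open>h\<close>; applying \<open>less\<close> to that one
      settles both directions.\<close>
    have "inv x \<otimes> (t \<otimes> w) = s \<otimes> (inv x \<otimes> w)" using w assms(1-3) by (simp add: m_assoc)
    then have "h (t \<otimes> w) \<noteq> h w"
      using w assms(1-3) len_neq[of s "inv x \<otimes> w"] unfolding h_def by auto
    then show ?thesis using less[of w] less[of "t \<otimes> w"] w t by fastforce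
  qed
qed

text \<open>In terms of the inversion set N(w) of the reflections t that make w shorter from the
  left, this is the rule that N(w r) and N(w) differ exactly in the reflection w r w^-1.\<close>

lemma reflection_cocycle:
  assumes "t \<in> reflections W S" "r \<in> S" "w \<in> carrier W"
  shows "(l (t \<otimes> w) < l w) \<noteq> (l (t \<otimes> (w \<otimes> r)) < l (w \<otimes> r)) \<longleftrightarrow> t \<otimes> w = w \<otimes> r"
proof -
  obtain x s where xs: "x \<in> carrier W" "s \<in> S" "t = x \<otimes> s \<otimes> inv x" using assms reflectionsE by blast
  show ?thesis
    using reflection_cocycle_aux(1)[OF xs, of r w] reflection_cocycle_aux(3)[OF xs, of w]
      reflection_cocycle_aux(3)[OF xs, of "w \<otimes> r"] assms
    by auto
qed

text \<open>The deleted letter is the one at which the path spelled by the word crosses the wall of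
  t.\<close>

lemma strong_exchange:
  assumes "t \<in> reflections W S" "set ss \<subseteq> S" "l (t \<otimes> wp ss) < l (wp ss)"
  obtains us r vs where "ss = us @ r # vs" "t \<otimes> wp ss = wp us \<otimes> wp vs"
proof -
  obtain x s where xs: "x \<in> carrier W" "s \<in> S" "t = x \<otimes> s \<otimes> inv x" using assms reflectionsE by blast
  obtain us r vs where ss: "ss = us @ r # vs" "t \<otimes> wp us = wp us \<otimes> r"
    using reflection_cocycle_aux(2)[OF xs assms(2)] reflection_cocycle_aux(3)[OF xs, of "wp ss"] assms by auto
  then have "t \<otimes> wp ss = wp us \<otimes> wp vs"
    using assms by (simp add: wp_append m_assoc[symmetric])
  then show ?thesis using that ss by blast
qed

lemma len_reflection_neq:
  assumes "t \<in> reflections W S" "w \<in> carrier W"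
  shows "l (t \<otimes> w) \<noteq> l w"
proof -
  obtain x s where xs: "x \<in> carrier W" "s \<in> S" "t = x \<otimes> s \<otimes> inv x" using assms reflectionsE by blast
  have "inv x \<otimes> (t \<otimes> w) = s \<otimes> (inv x \<otimes> w)" using xs assms by (simp add: m_assoc)
  then show ?thesis
    using reflection_cocycle_aux(3)[OF xs, of w] reflection_cocycle_aux(3)[OF xs, of "t \<otimes> w"]
      len_neq[of s "inv x \<otimes> w"] xs assms by auto
qed

section \<open>Bruhat order\<close>

abbreviation bruhat (infix \<open>\<preceq>\<close> 50) where "x \<preceq> y \<equiv> bruhat_le W S x y"

lemma bruhat_refl [simp]: "x \<preceq> x"
  by (simp add: bruhat_le_def)

lemma bruhat_trans [trans]: "x \<preceq> y \<Longrightarrow> y \<preceq> z \<Longrightarrow> x \<preceq> z"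
  unfolding bruhat_le_def by (rule rtrancl_trans)

text \<open>The order is generated by right multiplication with reflections, while the cocycle
  speaks of left multiplication; conjugation by w converts one into the other.\<close>

lemma bruhat_step:
  assumes "t \<in> reflections W S" "w \<in> carrier W" "l w < l (t \<otimes> w)"
  shows "w \<preceq> t \<otimes> w"
proof -
  have "t \<otimes> w = w \<otimes> (inv w \<otimes> t \<otimes> inv (inv w))" using assms by (simp add: m_assoc)
  moreover have "inv w \<otimes> t \<otimes> inv (inv w) \<in> reflections W S" using reflection_conj assms by blast
  ultimately have "(w, t \<otimes> w) \<in> {(u, u \<otimes> t) | u t. u \<in> carrier W \<and> t \<in> reflections W S \<and> l u < l (u \<otimes> t)}"
    using assms by force
  then show ?thesis unfolding bruhat_le_def by (rule r_into_rtrancl)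
qed

lemma bruhat_pairD:
  assumes "(u, w) \<in> {(u, u \<otimes> t) | u t. u \<in> carrier W \<and> t \<in> reflections W S \<and> l u < l (u \<otimes> t)}"
  obtains t where "t \<in> reflections W S" "u \<in> carrier W" "w = t \<otimes> u" "l u < l (t \<otimes> u)"
proof -
  obtain t where t: "t \<in> reflections W S" "u \<in> carrier W" "w = u \<otimes> t" "l u < l w" using assms by auto
  then have "w = (u \<otimes> t \<otimes> inv u) \<otimes> u" by (simp add: m_assoc)
  then show ?thesis using that[of "u \<otimes> t \<otimes> inv u"] reflection_conj[of t u] t by metis
qed

lemma bruhat_induct [consumes 2, case_names refl step]:
  assumes "x \<preceq> y" "x \<in> carrier W" "P x"
    "\<And>t w. x \<preceq> w \<Longrightarrow> t \<in> reflections W S \<Longrightarrow> w \<in> carrier W \<Longrightarrow> l w < l (t \<otimes> w) \<Longrightarrow> P w \<Longrightarrow> P (t \<otimes> w)"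
  shows "P y"
  using assms(1) unfolding bruhat_le_def
proof (induction rule: rtrancl_induct)
  case base
  then show ?case using assms(3) .
next
  case (step w z)
  then show ?case using assms(4)[of w] by (elim bruhat_pairD) (auto simp: bruhat_le_def)
qed

lemma bruhat_converse_induct [consumes 1, case_names refl step]:
  assumes "x \<preceq> y" "P y"
    "\<And>t w. t \<otimes> w \<preceq> y \<Longrightarrow> t \<in> reflections W S \<Longrightarrow> w \<in> carrier W \<Longrightarrow> l w < l (t \<otimes> w) \<Longrightarrow> P (t \<otimes> w) \<Longrightarrow> P w"
  shows "P x"
  using assms(1) unfolding bruhat_le_def
proof (induction rule: converse_rtrancl_induct)
  case base
  then show ?case using assms(2) .
next
  case (step w z)
  then show ?case using assms(3)[of _ w] by (elim bruhat_pairD) (auto simp: bruhat_le_def)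
qed

lemma bruhat_closed: "x \<preceq> y \<Longrightarrow> x \<in> carrier W \<longleftrightarrow> y \<in> carrier W"
proof -
  assume "x \<preceq> y"
  then have "(x \<in> carrier W \<longrightarrow> y \<in> carrier W) \<and> (y \<in> carrier W \<longrightarrow> x \<in> carrier W)"
    using bruhat_induct[of x y "\<lambda>z. z \<in> carrier W"] bruhat_converse_induct[of x y "\<lambda>z. y \<in> carrier W \<longrightarrow> z \<in> carrier W"]
    by auto
  then show ?thesis by blast
qed

lemma bruhat_len:
  assumes "x \<preceq> y" "x \<in> carrier W" shows "x = y \<or> l x < l y"
  using assms by (induction rule: bruhat_induct) auto

lemma bruhat_len_le: "x \<preceq> y \<Longrightarrow> x \<in> carrier W \<Longrightarrow> l x \<le> l y"
  using bruhat_len by fastforce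

lemma bruhat_antisym: "x \<preceq> y \<Longrightarrow> y \<preceq> x \<Longrightarrow> x \<in> carrier W \<Longrightarrow> x = y"
  using bruhat_len bruhat_closed by (metis less_asym)

lemma bruhat_inv:
  assumes "x \<preceq> y" "x \<in> carrier W" shows "inv x \<preceq> inv y"
  using assms
proof (induction rule: bruhat_induct)
  case (step t w)
  have "inv w \<otimes> t \<otimes> inv (inv w) \<in> reflections W S" using reflection_conj step by blast
  moreover have "inv (t \<otimes> w) = (inv w \<otimes> t \<otimes> inv (inv w)) \<otimes> inv w"
    using step by (simp add: m_assoc inv_mult_group)
  moreover have "l (inv (t \<otimes> w)) > l (inv w)" using step by simp
  ultimately show ?case using step bruhat_step[of "inv w \<otimes> t \<otimes> inv (inv w)" "inv w"] bruhat_trans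
    by (metis inv_closed)
qed simp

lemma bruhat_inv_iff: "x \<in> carrier W \<Longrightarrow> y \<in> carrier W \<Longrightarrow> inv x \<preceq> inv y \<longleftrightarrow> x \<preceq> y"
  using bruhat_inv[of x y] bruhat_inv[of "inv x" "inv y"] by auto

text \<open>By the cocycle, passing from w to \<open>w r\<close> changes whether t goes up or down
  only on the edge that t flips; otherwise the upward step survives multiplication by r.\<close>

lemma reflection_up_mult:
  assumes "t \<in> reflections W S" "r \<in> S" "w \<in> carrier W" "l w < l (t \<otimes> w)"
  shows "t \<otimes> w = w \<otimes> r \<or> w \<otimes> r \<preceq> t \<otimes> w \<otimes> r"
proof (cases "t \<otimes> w = w \<otimes> r")
  case False
  then have "\<not> l (t \<otimes> (w \<otimes> r)) < l (w \<otimes> r)" using reflection_cocycle[of t r w] assms by auto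
  then have "l (w \<otimes> r) < l (t \<otimes> (w \<otimes> r))" using len_reflection_neq[of t "w \<otimes> r"] assms by auto
  then show ?thesis using bruhat_step[of t "w \<otimes> r"] assms by (simp add: m_assoc)
qed simp

text \<open>The lifting property in a form free of case distinctions on descents. A chain of
  reflections from u to w is multiplied by r step by step until one of its steps is an edge flipped
  by its reflection; from there on the factor r is absorbed.\<close>

lemma lift_right1:
  assumes "u \<preceq> w" "u \<in> carrier W" "r \<in> S"
  shows "u \<otimes> r \<preceq> w \<or> u \<otimes> r \<preceq> w \<otimes> r"
  using assms(1,2)
proof (induction rule: bruhat_induct)
  case (step t w)
  then show ?case
    using reflection_up_mult[of t r w] bruhat_step[of t w] bruhat_trans assms(3) by metis
qed simp

lemma lift_right2:
  assumes "u \<preceq> w" "r \<in> S" "w \<in> carrier W"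
  shows "u \<preceq> w \<otimes> r \<or> u \<otimes> r \<preceq> w \<otimes> r"
  using assms(1)
proof (induction rule: bruhat_converse_induct)
  case (step t u)
  then show ?case
    using reflection_up_mult[of t r u] bruhat_step[of t u] bruhat_trans assms(2) S_cancel_right by metis
qed simp

lemma lift_left1:
  assumes "u \<preceq> w" "u \<in> carrier W" "r \<in> S"
  shows "r \<otimes> u \<preceq> w \<or> r \<otimes> u \<preceq> r \<otimes> w"
proof -
  have c: "w \<in> carrier W" using assms bruhat_closed by blast
  show ?thesis using lift_right1[of "inv u" "inv w" r] assms c
    bruhat_inv_iff[of "r \<otimes> u" w] bruhat_inv_iff[of "r \<otimes> u" "r \<otimes> w"] bruhat_inv[of u w]
    by (simp add: inv_mult_group)
qed

lemma lift_left2: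
  assumes "u \<preceq> w" "u \<in> carrier W" "r \<in> S"
  shows "u \<preceq> r \<otimes> w \<or> r \<otimes> u \<preceq> r \<otimes> w"
proof -
  have c: "w \<in> carrier W" using assms bruhat_closed by blast
  show ?thesis using lift_right2[of "inv u" "inv w" r] assms c
    bruhat_inv_iff[of "r \<otimes> u" "r \<otimes> w"] bruhat_inv_iff[of "u" "r \<otimes> w"] bruhat_inv[of u w]
    by (simp add: inv_mult_group)
qed

lemma up_left: "s \<in> S \<Longrightarrow> w \<in> carrier W \<Longrightarrow> l w < l (s \<otimes> w) \<Longrightarrow> w \<preceq> s \<otimes> w"
  using bruhat_step S_reflection by blast

lemma up_right: "s \<in> S \<Longrightarrow> w \<in> carrier W \<Longrightarrow> l w < l (w \<otimes> s) \<Longrightarrow> w \<preceq> w \<otimes> s"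
  using up_left[of s "inv w"] bruhat_inv_iff[of w "w \<otimes> s"] len_inv[of "w \<otimes> s"] by (simp add: inv_mult_group)

lemma down_left: "s \<in> S \<Longrightarrow> w \<in> carrier W \<Longrightarrow> l (s \<otimes> w) < l w \<Longrightarrow> s \<otimes> w \<preceq> w"
  using up_left[of s "s \<otimes> w"] by simp

text \<open>The interval below \<open>s w > w\<close> is obtained from the one below \<open>w\<close> by adjoining left
  multiples by \<open>s\<close>.\<close>

lemma bruhat_le_up_iff:
  assumes "s \<in> S" "w \<in> carrier W" "l w < l (s \<otimes> w)" "u \<in> carrier W"
  shows "u \<preceq> s \<otimes> w \<longleftrightarrow> u \<preceq> w \<or> s \<otimes> u \<preceq> w"
    and "l u < l (s \<otimes> u) \<Longrightarrow> u \<preceq> s \<otimes> w \<longleftrightarrow> u \<preceq> w"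
    and "l (s \<otimes> u) < l u \<Longrightarrow> u \<preceq> s \<otimes> w \<longleftrightarrow> s \<otimes> u \<preceq> w"
proof -
  note up = up_left[OF assms(1-3)]
  have 1: "u \<preceq> w \<or> s \<otimes> u \<preceq> w" if "u \<preceq> s \<otimes> w" "u \<in> carrier W" for u
    using lift_left2[of u "s \<otimes> w" s] that assms by simp
  have 2: "u \<preceq> s \<otimes> w" if "s \<otimes> u \<preceq> w" "u \<in> carrier W" for u
    using lift_left1[of "s \<otimes> u" w s] that assms up bruhat_trans by (metis S_cancel S_closed m_closed)
  show "u \<preceq> s \<otimes> w \<longleftrightarrow> u \<preceq> w \<or> s \<otimes> u \<preceq> w" using 1 2 up bruhat_trans assms by blast
  then show "l u < l (s \<otimes> u) \<Longrightarrow> u \<preceq> s \<otimes> w \<longleftrightarrow> u \<preceq> w"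
    and "l (s \<otimes> u) < l u \<Longrightarrow> u \<preceq> s \<otimes> w \<longleftrightarrow> s \<otimes> u \<preceq> w"
    using up_left[of s u] down_left[of s u] bruhat_trans assms by blast+
qed

section \<open>Parabolic subgroups\<close>

lemma exchange:
  assumes "s \<in> S" "set ss \<subseteq> S" "l (s \<otimes> wp ss) < l (wp ss)"
  obtains us r vs where "ss = us @ r # vs" "s \<otimes> wp ss = wp (us @ vs)"
proof -
  obtain us r vs where *: "ss = us @ r # vs" "s \<otimes> wp ss = wp us \<otimes> wp vs"
    using strong_exchange[of s ss] S_reflection assms by metis
  then have "set us \<subseteq> S" "set vs \<subseteq> S" using assms by auto
  then show ?thesis using that[of us r vs] * by (simp add: wp_append)
qed

lemma exchange_right:
  assumes "s \<in> S" "set ss \<subseteq> S" "l (wp ss \<otimes> s) < l (wp ss)"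
  obtains us r vs where "ss = us @ r # vs" "wp ss \<otimes> s = wp (us @ vs)"
proof -
  have "s \<otimes> wp (rev ss) = inv (wp ss \<otimes> s)" using assms by (simp add: wp_rev inv_mult_group)
  then have "l (s \<otimes> wp (rev ss)) < l (wp (rev ss))" using assms by (simp add: wp_rev)
  then obtain us r vs where *: "rev ss = us @ r # vs" "s \<otimes> wp (rev ss) = wp (us @ vs)"
    using exchange[of s "rev ss"] assms by auto
  then have ss: "ss = rev vs @ r # rev us" by (metis append.assoc append_Cons append_Nil rev.simps(2) rev_append rev_rev_ident)
  then have "set (us @ vs) \<subseteq> S" using assms by auto
  moreover have "wp ss \<otimes> s = inv (s \<otimes> wp (rev ss))"
    using \<open>s \<otimes> wp (rev ss) = inv (wp ss \<otimes> s)\<close> assms by simp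
  ultimately have "wp ss \<otimes> s = wp (rev (us @ vs))" using * by (simp only: wp_rev)
  then show ?thesis using that[of "rev vs" r "rev us"] ss by simp
qed

context
  fixes J H assumes J: "J \<subseteq> S" and H: "H = generate W J"
begin

lemma parabolic_closed [simp]: "h \<in> H \<Longrightarrow> h \<in> carrier W"
  using generate_in_carrier[of J h] J H S_subset by blast

lemma parabolic_mult: "h \<in> H \<Longrightarrow> k \<in> H \<Longrightarrow> h \<otimes> k \<in> H"
  and parabolic_one: "\<one> \<in> H"
  and parabolic_gen: "s \<in> J \<Longrightarrow> s \<in> H"
  by (auto simp: H intro: generate.intros)

lemma parabolic_inv: "h \<in> H \<Longrightarrow> inv h \<in> H"
  using generate_m_inv_closed[of J h] J H S_subset by blast

text \<open>Exchange shortens a word by deleting letters, hence without leaving J. So the length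
  function of W also serves as the one of H.\<close>

lemma parabolic_reduced_aux:
  "set ss \<subseteq> J \<Longrightarrow> \<exists>ts. set ts \<subseteq> J \<and> wp ts = wp ss \<and> length ts = l (wp ss)"
proof (induction ss)
  case Nil
  then show ?case by (intro exI[of _ "[]"]) auto
next
  case (Cons s ss)
  then obtain ts where ts: "set ts \<subseteq> J" "wp ts = wp ss" "length ts = l (wp ss)" by auto
  have s: "s \<in> S" "s \<in> J" "set ts \<subseteq> S" "wp ss \<in> carrier W" using Cons J ts by auto
  show ?case
  proof (cases "l (s \<otimes> wp ss) < l (wp ss)")
    case True
    then obtain us r vs where uv: "ts = us @ r # vs" "s \<otimes> wp ts = wp (us @ vs)"
      using exchange[of s ts] s ts by metis
    moreover have "l (wp ss) = Suc (l (s \<otimes> wp ss))" using True s len_down_iff by blast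
    ultimately show ?thesis using ts by (intro exI[of _ "us @ vs"]) auto
  next
    case False
    then have "l (s \<otimes> wp ss) = Suc (l (wp ss))" using s not_down_iff len_up_iff by blast
    then show ?thesis using ts s by (intro exI[of _ "s # ts"]) auto
  qed
qed

lemma parabolic_reduced:
  assumes "h \<in> H"
  obtains ss where "set ss \<subseteq> J" "wp ss = h" "length ss = l h"
  using ex_word_generate[of h J] parabolic_reduced_aux assms J H by metis

lemma parabolic_induct [consumes 1, case_names one mult]:
  assumes "h \<in> H" "P \<one>"
    "\<And>s u. s \<in> J \<Longrightarrow> u \<in> H \<Longrightarrow> l (u \<otimes> s) = Suc (l u) \<Longrightarrow> P u \<Longrightarrow> P (u \<otimes> s)"
  shows "P h"
proof -
  obtain ss where "set ss \<subseteq> J" "wp ss = h" "length ss = l h" using assms(1) parabolic_reduced by blast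
  then show ?thesis
  proof (induction ss arbitrary: h rule: rev_induct)
    case Nil
    then show ?case using assms(2) by simp
  next
    case (snoc s ss)
    have c: "s \<in> S" "set ss \<subseteq> S" "s \<in> J" "wp ss \<in> H" using snoc J wp_generate[of ss J] H by auto
    have h: "h = wp ss \<otimes> s" using snoc c by (auto simp: wp_append)
    have "l (wp ss) = length ss" 
      using len_wp_le[of ss] len_mult_S_le[of s "wp ss"] h snoc c by auto
    then show ?case using assms(3)[of s "wp ss"] snoc c h by auto
  qed
qed

lemma parabolic_lower_reflection:
  assumes "h \<in> H" "t \<in> reflections W S" "l (t \<otimes> h) < l h"
  shows "t \<otimes> h \<in> H"
proof -
  obtain ss where ss: "set ss \<subseteq> J" "wp ss = h" using parabolic_reduced assms by blast
  then obtain us r vs where "ss = us @ r # vs" "t \<otimes> h = wp us \<otimes> wp vs"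
    using strong_exchange[of t ss] assms J by blast
  then show ?thesis using ss wp_generate[of us J] wp_generate[of vs J] H parabolic_mult by auto
qed

lemma parabolic_lower:
  assumes "u \<preceq> h" "h \<in> H" shows "u \<in> H"
  using assms(1)
proof (induction rule: bruhat_converse_induct)
  case (step t w)
  then show ?case using parabolic_lower_reflection[of "t \<otimes> w" t] by simp
qed (rule assms)

lemma min_reps_closed: "x \<in> min_reps W S H \<Longrightarrow> x \<in> carrier W"
  by (simp add: min_reps_def)

text \<open>A letter deleted by exchange from a word for \<open>x h\<close> either belongs to x,
  against the minimality of x in its coset, or to h, against \<open>h s\<close> being longer than
  h.\<close>

lemma min_reps_len:
  assumes x: "x \<in> min_reps W S H" and "h \<in> H"
  shows "l (x \<otimes> h) = l x + l h"
  using assms(2)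
proof (induction rule: parabolic_induct)
  case one
  then show ?case using x min_reps_closed by simp
next
  case (mult s h)
  have xc: "x \<in> carrier W" and s: "s \<in> S" using x min_reps_closed mult J by auto
  obtain hs where hs: "set hs \<subseteq> J" "wp hs = h" "length hs = l h" using parabolic_reduced mult by blast
  have "\<not> l (x \<otimes> h \<otimes> s) < l (x \<otimes> h)"
  proof
    assume less: "l (x \<otimes> h \<otimes> s) < l (x \<otimes> h)"
    have sub: "set (rw x @ hs) \<subseteq> S" and w: "wp (rw x @ hs) = x \<otimes> h"
      using reduced_word[OF xc] hs J by (auto simp: wp_append)
    obtain us r vs where uv: "rw x @ hs = us @ r # vs" "x \<otimes> h \<otimes> s = wp (us @ vs)"
      using exchange_right[OF s sub, unfolded w, OF less] by blast
    then consider zs where "rw x = us @ r # zs" "vs = zs @ hs" | zs where "us = rw x @ zs" "hs = zs @ r # vs"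
      by (auto simp: append_eq_append_conv2 Cons_eq_append_conv append_eq_Cons_conv)
    then show False
    proof cases
      case 1
      have zs: "set (us @ zs) \<subseteq> S" using 1 reduced_word[OF xc] by auto
      define z where "z = wp (us @ zs)"
      have z: "z \<in> carrier W" "l z < l x"
        using zs len_wp_le[OF zs] 1 reduced_word[OF xc] by (auto simp: z_def)
      have "x \<otimes> h \<otimes> s = z \<otimes> h" using uv 1 zs hs J by (auto simp: z_def wp_append m_assoc)
      then have "x \<otimes> h \<otimes> s \<otimes> inv h = z" using z mult by simp
      then have "z = x \<otimes> (h \<otimes> s \<otimes> inv h)" using xc mult s by (simp add: m_assoc)
      moreover have "h \<otimes> s \<otimes> inv h \<in> H"
        using mult parabolic_mult parabolic_inv parabolic_gen by blast
      ultimately show False using x z unfolding min_reps_def by fastforce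
    next
      case 2
      have zs: "set (zs @ vs) \<subseteq> S" using 2 hs J by auto
      have "x \<otimes> h \<otimes> s = x \<otimes> wp (zs @ vs)"
        using uv 2 zs reduced_word[OF xc] by (simp add: wp_append m_assoc)
      then have "h \<otimes> s = wp (zs @ vs)" using zs xc mult s by (simp add: m_assoc)
      then show False using len_wp_le[OF zs] 2 hs mult by simp
    qed
  qed
  then have "l (x \<otimes> h \<otimes> s) = Suc (l (x \<otimes> h))"
    using len_mult_S_le[of s "x \<otimes> h"] len_neq_right[of s "x \<otimes> h"] s xc mult by auto
  then show ?case using mult xc s by (simp add: m_assoc)
qed

lemma min_reps_exists:
  assumes "w \<in> carrier W"
  obtains x h where "x \<in> min_reps W S H" "h \<in> H" "w = x \<otimes> h"
proof -
  define Q where "Q n \<longleftrightarrow> (\<exists>h\<in>H. l (w \<otimes> h) = n)" for n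
  have "Q (l (w \<otimes> \<one>))" unfolding Q_def using parabolic_one by blast
  then have L: "Q (Least Q)" by (rule LeastI)
  then obtain h where h: "h \<in> H" "l (w \<otimes> h) = Least Q" unfolding Q_def by blast
  have "l (w \<otimes> h) \<le> l (w \<otimes> h \<otimes> k)" if "k \<in> H" for k
  proof -
    have "Q (l (w \<otimes> h \<otimes> k))" unfolding Q_def
      using that h parabolic_mult assms by (metis m_assoc parabolic_closed)
    then show ?thesis using h Least_le by metis
  qed
  then have "w \<otimes> h \<in> min_reps W S H" using assms h by (simp add: min_reps_def)
  moreover have "w = w \<otimes> h \<otimes> inv h" using assms h by simp
  ultimately show ?thesis using that h parabolic_inv by blast
qed

lemma min_reps_unique:
  assumes "x \<in> min_reps W S H" "x' \<in> min_reps W S H" "h \<in> H" "h' \<in> H" "x \<otimes> h = x' \<otimes> h'"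
  shows "x = x'" "h = h'"
proof -
  have c: "x \<in> carrier W" "x' \<in> carrier W" using assms min_reps_closed by auto
  have k: "h \<otimes> inv h' \<in> H" using assms parabolic_mult parabolic_inv by blast
  have "x' = x' \<otimes> h' \<otimes> inv h'" using c assms by simp
  also have "\<dots> = x \<otimes> (h \<otimes> inv h')" using c assms by (simp add: m_assoc flip: assms(5))
  finally have x': "x' = x \<otimes> (h \<otimes> inv h')" .
  then have "x = x' \<otimes> inv (h \<otimes> inv h')" using c k by simp
  then have "l x = l x' + l (inv (h \<otimes> inv h'))" using min_reps_len assms k parabolic_inv by metis
  moreover have "l x' = l x + l (h \<otimes> inv h')" using min_reps_len assms k x' by metis
  ultimately have "h \<otimes> inv h' = \<one>" using k len_eq_0 by simp
  then show "x = x'" using x' c by simp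
  then show "h = h'" using assms(5) c assms by simp
qed

text \<open>Deodhar's lemma. If \<open>s x\<close> is not minimal, s is an ascent at x but not at
  some \<open>x h\<close>, so the path from x along a word of h in J crosses the wall of s. At the
  crossing \<open>s x k = x k r\<close>, whence \<open>s x = x (k r k^-1)\<close>.\<close>

lemma min_reps_left:
  assumes x: "x \<in> min_reps W S H" and s: "s \<in> S"
  shows "s \<otimes> x \<in> min_reps W S H \<or> (\<exists>k\<in>H. s \<otimes> x = x \<otimes> k)"
proof (rule ccontr)
  assume contra: "\<not> ?thesis"
  have xc: "x \<in> carrier W" using x min_reps_closed by auto
  obtain h where h: "h \<in> H" "l (s \<otimes> x \<otimes> h) < l (s \<otimes> x)"
    using contra xc s unfolding min_reps_def by (auto simp: not_le)
  obtain ss where ss: "set ss \<subseteq> J" "wp ss = h" using parabolic_reduced h by blast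
  have len: "l (x \<otimes> h) = l x + l h" using min_reps_len x h by blast
  have hc: "h \<in> carrier W" using h by simp
  have up: "l x < l (s \<otimes> x)"
    using len h len_mult_S_le[of s "x \<otimes> h"] not_down_iff[of s x] len_down_iff[of s x] s xc hc
    by (auto simp: m_assoc)
  have "\<not> l (x \<otimes> h) < l (s \<otimes> (x \<otimes> h))"
    using len h len_up_iff[OF s xc] up s xc hc by (simp add: m_assoc)
  then obtain us r vs where uv: "ss = us @ r # vs" "s \<otimes> (x \<otimes> wp us) = x \<otimes> wp us \<otimes> r"
    using crossing[of s x ss] up ss J s xc by blast
  define k where "k = wp us"
  have k: "k \<in> H" "r \<in> H" "s \<otimes> (x \<otimes> k) = x \<otimes> k \<otimes> r"
    using uv ss wp_generate[of us J] H parabolic_gen by (auto simp: k_def)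
  have "s \<otimes> x = s \<otimes> (x \<otimes> k) \<otimes> inv k" using xc s k(1) by (simp add: m_assoc[symmetric])
  also have "\<dots> = x \<otimes> (k \<otimes> r \<otimes> inv k)" unfolding k(3) using xc s k(1,2) by (simp add: m_assoc)
  finally have "s \<otimes> x = x \<otimes> (k \<otimes> r \<otimes> inv k)" .
  then show False using contra k parabolic_mult parabolic_inv by metis
qed

end

section \<open>The longest element\<close>

text \<open>When s is applied to a word of w that starts with a reduced word of x, the letter
  deleted by exchange cannot come from x, as \<open>s x\<close> is longer than x. It shortens the
  rest, so the reduced prefix x extends to \<open>s x\<close>.\<close>

lemma full_descent_len:
  assumes w: "w \<in> carrier W" "\<And>s. s \<in> S \<Longrightarrow> l (s \<otimes> w) < l w" and "x \<in> carrier W"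
  shows "l w = l x + l (inv x \<otimes> w)"
  using assms(3)
proof (induction rule: len_induct)
  case one
  then show ?case using w by simp
next
  case (mult s x)
  define v where "v = inv x \<otimes> w"
  have v: "v \<in> carrier W" "x \<otimes> v = w" "l w = l x + l v" using mult w by (simp_all add: v_def)
  have sub: "set (rw x @ rw v) \<subseteq> S" "wp (rw x @ rw v) = w"
    using reduced_word[of x] reduced_word[of v] v mult by (auto simp: wp_append)
  then obtain us r vs where uv: "rw x @ rw v = us @ r # vs" "s \<otimes> w = wp (us @ vs)"
    using exchange[OF mult(1) sub(1), unfolded sub(2), OF w(2)[OF mult(1)]] by blast
  then consider zs where "rw x = us @ r # zs" "vs = zs @ rw v" | zs where "us = rw x @ zs" "rw v = zs @ r # vs"
    by (auto simp: append_eq_append_conv2 Cons_eq_append_conv append_eq_Cons_conv)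
  then show ?case
  proof cases
    case 1
    have zs: "set (us @ zs) \<subseteq> S" using 1 reduced_word[OF mult(2)] by auto
    have "s \<otimes> x \<otimes> v = wp (us @ zs) \<otimes> v"
      using uv 1 zs v mult reduced_word[OF v(1)] by (simp add: wp_append m_assoc)
    then have "s \<otimes> x = wp (us @ zs)" using zs v mult by simp
    then have "l (s \<otimes> x) < l x" using len_wp_le[OF zs] 1 reduced_word[OF mult(2)] by simp
    then show ?thesis using mult by simp
  next
    case 2
    have zs: "set (zs @ vs) \<subseteq> S" using 2 reduced_word[OF v(1)] by auto
    have "s \<otimes> w = x \<otimes> wp (zs @ vs)"
      using uv 2 zs reduced_word[OF mult(2)] by (simp add: wp_append m_assoc)
    then have "inv (s \<otimes> x) \<otimes> w = wp (zs @ vs)" using mult w zs by (simp add: inv_mult_group m_assoc)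
    then have "Suc (l (inv (s \<otimes> x) \<otimes> w)) \<le> l v"
      using len_wp_le[OF zs] 2 reduced_word[OF v(1)] by simp
    moreover have "l w \<le> l (s \<otimes> x) + l (inv (s \<otimes> x) \<otimes> w)"
      using len_mult_le[of "s \<otimes> x" "inv (s \<otimes> x) \<otimes> w"] mult w by simp
    ultimately show ?thesis using mult v by simp
  qed
qed

text \<open>\<open>longest\<close> is a definite description, so even membership requires
  uniqueness: two elements of maximal length have all left descents, and
  \<open>full_descent_len\<close> forces their quotient to have length 0.\<close>

lemma longest_closed [simp]: "longest W S (carrier W) \<in> carrier W"
proof -
  have *: "l w = l x + l (inv x \<otimes> w)"
    if "w \<in> carrier W" "\<forall>u\<in>carrier W. l u \<le> l w" "x \<in> carrier W" for w x
  proof (rule full_descent_len)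
    show "l (s \<otimes> w) < l w" if "s \<in> S" for s
      using \<open>\<forall>u\<in>carrier W. l u \<le> l w\<close> \<open>w \<in> carrier W\<close> len_neq[of s w] that
      by (metis S_closed le_neq_implies_less m_closed)
  qed (use that in auto)
  have "\<exists>w. w \<in> carrier W \<and> (\<forall>u\<in>carrier W. l u \<le> l w)"
  proof -
    have "Max (l ` carrier W) \<in> l ` carrier W"
      using finite_carrier one_closed by (intro Max_in) auto
    then obtain w where "w \<in> carrier W" "l w = Max (l ` carrier W)" by auto
    then show ?thesis using finite_carrier by (auto intro!: exI[of _ w])
  qed
  moreover have "w = w'"
    if "w \<in> carrier W \<and> (\<forall>u\<in>carrier W. l u \<le> l w)" "w' \<in> carrier W \<and> (\<forall>u\<in>carrier W. l u \<le> l w')" for w w'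
  proof -
    have "l w = l w'" using that by (meson le_antisym)
    then have "inv w \<otimes> w' = \<one>" using *[of w' w] that len_eq_0 by simp
    then have "w \<otimes> (inv w \<otimes> w') = w" using that by simp
    then show ?thesis using that by simp
  qed
  ultimately have "\<exists>!w. w \<in> carrier W \<and> (\<forall>u\<in>carrier W. l u \<le> l w)" by (metis (no_types, lifting))
  from theI'[OF this] show ?thesis unfolding longest_def by blast
qed

end

section \<open>Linear operators on function spaces\<close>

text \<open>\<open>unit_vec\<close> and \<open>lext\<close> repeat \<open>basis\<close> and
  \<open>lin_ext\<close> over an arbitrary commutative ring, so that the same operators can be used
  over \<open>laurent\<close>, \<open>int poly\<close> and \<open>int\<close> and compared along a
  \<open>ring_map\<close>.\<close>

definition unit_vec :: "'b \<Rightarrow> 'b \<Rightarrow> 'k::comm_ring_1" where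
  "unit_vec b = (\<lambda>x. if x = b then 1 else 0)"

definition lext :: "'b set \<Rightarrow> ('b \<Rightarrow> 'd \<Rightarrow> 'k) \<Rightarrow> ('b \<Rightarrow> 'k) \<Rightarrow> 'd \<Rightarrow> 'k::comm_ring_1" where
  "lext X \<phi> f = (\<lambda>x. \<Sum>b\<in>X. f b * \<phi> b x)"

definition supported :: "'b set \<Rightarrow> ('b \<Rightarrow> 'k::comm_ring_1) \<Rightarrow> bool" where
  "supported X f \<longleftrightarrow> (\<forall>x. x \<notin> X \<longrightarrow> f x = 0)"

definition linop :: "(('b \<Rightarrow> 'k::comm_ring_1) \<Rightarrow> 'd \<Rightarrow> 'k) \<Rightarrow> bool" where
  "linop F \<longleftrightarrow> (\<forall>f g. F (\<lambda>x. f x + g x) = (\<lambda>x. F f x + F g x)) \<and>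
     (\<forall>c f. F (\<lambda>x. c * f x) = (\<lambda>x. c * F f x))"

definition ring_map :: "('k::comm_ring_1 \<Rightarrow> 'k'::comm_ring_1) \<Rightarrow> bool" where
  "ring_map h \<longleftrightarrow> h 1 = 1 \<and> (\<forall>a b. h (a + b) = h a + h b) \<and> (\<forall>a b. h (a * b) = h a * h b)"

lemma linop_add: "linop F \<Longrightarrow> F (\<lambda>x. f x + g x) = (\<lambda>x. F f x + F g x)"
  and linop_scale: "linop F \<Longrightarrow> F (\<lambda>x. c * f x) = (\<lambda>x. c * F f x)"
  by (simp_all add: linop_def)

lemma linop_zero: "linop F \<Longrightarrow> F (\<lambda>x. 0) = (\<lambda>x. 0)"
  using linop_scale[of F 0] by simp

lemma linop_uminus: "linop F \<Longrightarrow> F (\<lambda>x. - f x) = (\<lambda>x. - F f x)"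
  using linop_scale[of F "-1"] by simp

lemma linop_diff: "linop F \<Longrightarrow> F (\<lambda>x. f x - g x) = (\<lambda>x. F f x - F g x)"
  using linop_add[of F f "\<lambda>x. - g x"] linop_uminus[of F g] by simp

lemma linop_sum: "linop F \<Longrightarrow> F (\<lambda>x. \<Sum>i\<in>I. f i x) = (\<lambda>x. \<Sum>i\<in>I. F (f i) x)"
proof (induction I rule: infinite_finite_induct)
  case (insert i I)
  then show ?case using linop_add[of F "f i" "\<lambda>x. \<Sum>i\<in>I. f i x"] by simp
qed (simp_all add: linop_zero)

lemma linop_comp: "linop F \<Longrightarrow> linop G \<Longrightarrow> linop (\<lambda>f. F (G f))"
  by (simp add: linop_def)

lemma linop_lext: "linop (lext X \<phi>)"
  by (simp add: linop_def lext_def distrib_right sum.distrib sum_distrib_left mult.assoc)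

lemma linop_foldr: "(\<And>s. linop (F s)) \<Longrightarrow> linop (foldr F ss)"
proof (induction ss)
  case (Cons s ss)
  then show ?case using linop_comp[of "F s" "foldr F ss"] by (simp add: comp_def)
qed (simp add: linop_def)

lemma ring_map_simps:
  assumes "ring_map h"
  shows "h 1 = 1" "h 0 = 0" "h (a + b) = h a + h b" "h (a * b) = h a * h b"
    "h (- a) = - h a" "h (a - b) = h a - h b"
proof -
  show *: "h 1 = 1" "h (a + b) = h a + h b" "h (a * b) = h a * h b" for a b
    using assms by (simp_all add: ring_map_def)
  show 0: "h 0 = 0" using *(2)[of 0 0] by simp
  show m: "h (- a) = - h a" for a using *(2)[of a "- a"] 0 by (simp add: eq_neg_iff_add_eq_0 add.commute)
  show "h (a - b) = h a - h b" using *(2)[of a "- b"] m by simp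
qed

lemma ring_map_sum: "ring_map h \<Longrightarrow> h (sum f I) = (\<Sum>i\<in>I. h (f i))"
  by (induction I rule: infinite_finite_induct) (simp_all add: ring_map_simps)

lemma ring_map_unit_vec: "ring_map h \<Longrightarrow> h (unit_vec b x) = unit_vec b x"
  by (simp add: unit_vec_def ring_map_simps)

lemma unit_vec_supported: "b \<in> X \<Longrightarrow> supported X (unit_vec b)"
  by (auto simp: supported_def unit_vec_def)

lemma supported_expand:
  assumes "supported X f" "finite X"
  shows "f = (\<lambda>x. \<Sum>b\<in>X. f b * unit_vec b x)"
proof
  fix x
  have "(\<Sum>b\<in>X. f b * unit_vec b x) = (\<Sum>b\<in>X. if x = b then f b else 0)"
    by (intro sum.cong) (auto simp: unit_vec_def)
  also have "\<dots> = f x" using assms by (auto simp: supported_def)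
  finally show "f x = (\<Sum>b\<in>X. f b * unit_vec b x)" by simp
qed

lemma lext_unit_vec: "finite X \<Longrightarrow> b \<in> X \<Longrightarrow> lext X \<phi> (unit_vec b) = \<phi> b"
proof
  fix x assume "finite X" "b \<in> X"
  have "lext X \<phi> (unit_vec b) x = (\<Sum>c\<in>X. if b = c then \<phi> c x else 0)"
    unfolding lext_def by (intro sum.cong) (auto simp: unit_vec_def)
  then show "lext X \<phi> (unit_vec b) x = \<phi> b x" using \<open>finite X\<close> \<open>b \<in> X\<close> by simp
qed

lemma linop_eqI:
  assumes "linop F" "linop G" "supported X f" "finite X" "\<And>b. b \<in> X \<Longrightarrow> F (unit_vec b) = G (unit_vec b)"
  shows "F f = G f"
proof -
  note e = supported_expand[OF assms(3,4)]
  have "F f = (\<lambda>x. \<Sum>b\<in>X. f b * F (unit_vec b) x)"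
    by (subst e, subst linop_sum[OF assms(1)]) (simp add: linop_scale[OF assms(1)])
  also have "\<dots> = (\<lambda>x. \<Sum>b\<in>X. f b * G (unit_vec b) x)" using assms(5) by simp
  also have "\<dots> = G f"
    by (subst (2) e, subst linop_sum[OF assms(2)]) (simp add: linop_scale[OF assms(2)])
  finally show ?thesis .
qed

section \<open>The Hecke algebra over a commutative ring\<close>

text \<open>The parameter \<open>q\<close> of the following operators plays the role of the paper's \<open>q\<^sup>-\<^sup>1\<close>:
  \<open>hop q s\<close> is \<open>A\<^sub>s\<close>, and \<open>hbar q s\<close> is \<open>q\<^sup>-\<^sup>1\<close> times the inverse of \<open>A\<^sub>s\<close>. Hence both are
  polynomial in \<open>q\<^sup>-\<^sup>1\<close> and can be specialised to \<open>q\<^sup>-\<^sup>1 = 0\<close>.\<close>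

context coxeter_group
begin

definition hgen :: "'k::comm_ring_1 \<Rightarrow> 'a \<Rightarrow> 'a \<Rightarrow> 'a \<Rightarrow> 'k" where
  "hgen q s w = (if l w < l (s \<otimes> w) then unit_vec (s \<otimes> w)
     else (\<lambda>x. q * unit_vec (s \<otimes> w) x + (1 - q) * unit_vec w x))"

definition hop :: "'k::comm_ring_1 \<Rightarrow> 'a \<Rightarrow> ('a \<Rightarrow> 'k) \<Rightarrow> 'a \<Rightarrow> 'k" where
  "hop q s = lext (carrier W) (hgen q s)"

text \<open>Right multiplication by A_r, given on coordinates instead of basis vectors: position x
  receives from \<open>x r\<close> and from itself. This makes commutation with the left operators a
  pointwise check.\<close>

definition hop_r :: "'k::comm_ring_1 \<Rightarrow> 'a \<Rightarrow> ('a \<Rightarrow> 'k) \<Rightarrow> 'a \<Rightarrow> 'k" where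
  "hop_r q r f = (\<lambda>x. if x \<in> carrier W then
     if l (x \<otimes> r) < l x then f (x \<otimes> r) + (1 - q) * f x else q * f (x \<otimes> r) else 0)"

definition hbar :: "'k::comm_ring_1 \<Rightarrow> 'a \<Rightarrow> ('a \<Rightarrow> 'k) \<Rightarrow> 'a \<Rightarrow> 'k" where
  "hbar q s f = (\<lambda>x. hop q s f x - (1 - q) * f x)"

abbreviation "hword q \<equiv> foldr (hop q)"
abbreviation "hbword q \<equiv> foldr (hbar q)"
abbreviation "supp \<equiv> supported (carrier W)"

lemma hop_apply:
  assumes "s \<in> S"
  shows "hop q s f x = (if x \<in> carrier W then
     if l (s \<otimes> x) < l x then f (s \<otimes> x) + (1 - q) * f x else q * f (s \<otimes> x) else 0)"
proof (cases "x \<in> carrier W")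
  case True
  have ne: "s \<otimes> x \<noteq> x" using len_neq[OF assms True] by metis
  have z: "hgen q s b x = 0" if "b \<in> carrier W - {s \<otimes> x, x}" for b
    using that assms by (auto simp: hgen_def unit_vec_def)
  have "hop q s f x = (\<Sum>b\<in>{s \<otimes> x, x}. f b * hgen q s b x)"
    unfolding hop_def lext_def
    using finite_carrier True assms z by (intro sum.mono_neutral_right) auto
  also have "\<dots> = f (s \<otimes> x) * hgen q s (s \<otimes> x) x + f x * hgen q s x x" using ne by simp
  finally show ?thesis
    using True assms ne len_neq[OF assms True]
    by (auto simp: hgen_def unit_vec_def not_down_iff mult.commute)
next
  case False
  then have "hgen q s b x = 0" if "b \<in> carrier W" for b
    using that assms by (auto simp: hgen_def unit_vec_def)
  then show ?thesis using False unfolding hop_def lext_def by simp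
qed

lemma hop_linop: "linop (hop q s)"
  unfolding hop_def by (rule linop_lext)

lemma hbar_linop: "linop (hbar q s)"
  using hop_linop[of q s] unfolding linop_def hbar_def by (simp add: algebra_simps)

lemma hword_linop: "linop (hword q ss)"
  by (rule linop_foldr, rule hop_linop)

lemma hbword_linop: "linop (hbword q ss)"
  by (rule linop_foldr, rule hbar_linop)

lemma hop_supp: "s \<in> S \<Longrightarrow> supp (hop q s f)"
  by (simp add: supported_def hop_apply)

lemma hbar_supp: "s \<in> S \<Longrightarrow> supp f \<Longrightarrow> supp (hbar q s f)"
  by (simp add: supported_def hop_apply hbar_def)

lemma hword_supp: "set ss \<subseteq> S \<Longrightarrow> supp f \<Longrightarrow> supp (hword q ss f)"
  by (induction ss) (auto intro: hop_supp)

lemma hbword_supp: "set ss \<subseteq> S \<Longrightarrow> supp f \<Longrightarrow> supp (hbword q ss f)"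
  by (induction ss) (auto intro: hbar_supp)

lemma hop_unit: "s \<in> S \<Longrightarrow> w \<in> carrier W \<Longrightarrow> hop q s (unit_vec w) = hgen q s w"
  unfolding hop_def using finite_carrier by (rule lext_unit_vec)

lemma hop_r_unit:
  assumes "r \<in> S" "w \<in> carrier W" "l w < l (w \<otimes> r)"
  shows "hop_r q r (unit_vec w) = unit_vec (w \<otimes> r)"
proof
  fix x
  consider "x = w" | "x = w \<otimes> r" | "x \<noteq> w" "x \<noteq> w \<otimes> r" by blast
  then show "hop_r q r (unit_vec w) x = unit_vec (w \<otimes> r) x"
  proof cases
    case 3
    then have "x \<otimes> r \<noteq> w" if "x \<in> carrier W" using that assms by auto
    then show ?thesis using 3 by (auto simp: hop_r_def unit_vec_def)
  qed (use assms in \<open>auto simp: hop_r_def unit_vec_def\<close>)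
qed

text \<open>Only x, s x, x r and s x r matter. The left descent by s agrees at x and x r, and the
  right descent by r agrees at x and s x, unless s x = x r, where both switch; in each case the two
  sides coincide.\<close>

lemma hop_commute:
  assumes "s \<in> S" "r \<in> S"
  shows "hop q s (hop_r q r f) = hop_r q r (hop q s f)"
proof
  fix x
  show "hop q s (hop_r q r f) x = hop_r q r (hop q s f) x"
  proof (cases "x \<in> carrier W")
    case x: True
    have c: "s \<otimes> x \<in> carrier W" "x \<otimes> r \<in> carrier W" "s \<otimes> x \<otimes> r = s \<otimes> (x \<otimes> r)"
      using x assms by (auto simp: m_assoc)
    have e1: "(l (s \<otimes> x) < l x) \<noteq> (l (s \<otimes> (x \<otimes> r)) < l (x \<otimes> r)) \<longleftrightarrow> s \<otimes> x = x \<otimes> r"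
      using reflection_cocycle[OF S_reflection] assms x by blast
    \<comment> \<open>Right descents are handled by applying the cocycle to r and the inverse of
      x.\<close>
    have i: "r \<otimes> inv x = inv (x \<otimes> r)" "inv x \<otimes> s = inv (s \<otimes> x)" "r \<otimes> inv (s \<otimes> x) = inv (s \<otimes> (x \<otimes> r))"
      using assms x by (simp_all add: inv_mult_group m_assoc)
    have "inv (x \<otimes> r) = inv (s \<otimes> x) \<longleftrightarrow> s \<otimes> x = x \<otimes> r"
      using c by (metis inv_inv)
    then have e2: "(l (x \<otimes> r) < l x) \<noteq> (l (s \<otimes> (x \<otimes> r)) < l (s \<otimes> x)) \<longleftrightarrow> s \<otimes> x = x \<otimes> r"
      using reflection_cocycle[OF S_reflection[OF assms(2)] assms(1), of "inv x", unfolded i] x c assms by simp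
    show ?thesis
    proof (cases "s \<otimes> x = x \<otimes> r")
      case True
      then have "s \<otimes> (x \<otimes> r) = x" using x assms by (metis S_cancel)
      then show ?thesis using True x c assms e1 e2
        by (simp add: hop_apply hop_r_def; auto simp: algebra_simps)
    next
      case False
      then show ?thesis using x c assms e1 e2
        by (simp add: hop_apply hop_r_def; auto simp: algebra_simps)
    qed
  qed (use assms in \<open>simp add: hop_apply hop_r_def\<close>)
qed

lemma hbar_commute:
  assumes "s \<in> S" "r \<in> S"
  shows "hbar q s (hop_r q r f) = hop_r q r (hbar q s f)"
proof
  fix x
  have "hop q s (hop_r q r f) x = hop_r q r (hop q s f) x" by (simp only: hop_commute[OF assms])
  then show "hbar q s (hop_r q r f) x = hop_r q r (hbar q s f) x"
    unfolding hbar_def by (simp add: hop_r_def algebra_simps)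
qed

lemma hword_commute: "set ss \<subseteq> S \<Longrightarrow> r \<in> S \<Longrightarrow> hword q ss (hop_r q r f) = hop_r q r (hword q ss f)"
  by (induction ss) (simp_all add: hop_commute)

lemma hbword_commute: "set ss \<subseteq> S \<Longrightarrow> r \<in> S \<Longrightarrow> hbword q ss (hop_r q r f) = hop_r q r (hbword q ss f)"
  by (induction ss) (simp_all add: hbar_commute)

text \<open>The basis vector of the identity generates the regular module under right multiplication,
  so an operator commuting with right multiplications is determined by its value there.\<close>

lemma cyclic_eqI:
  fixes F G :: "('a \<Rightarrow> 'k::comm_ring_1) \<Rightarrow> 'a \<Rightarrow> 'k" and q :: 'k
  assumes "linop F" "linop G"
    and F: "\<And>r f. r \<in> S \<Longrightarrow> supp f \<Longrightarrow> F (hop_r q r f) = hop_r q r (F f)"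
    and G: "\<And>r f. r \<in> S \<Longrightarrow> supp f \<Longrightarrow> G (hop_r q r f) = hop_r q r (G f)"
    and "F (unit_vec \<one>) = G (unit_vec \<one>)" "supp f"
  shows "F f = G f"
proof (rule linop_eqI[OF assms(1,2,6) finite_carrier])
  fix b assume "b \<in> carrier W"
  then show "F (unit_vec b) = G (unit_vec b)"
  proof (induction b rule: len_induct_right)
    case (mult s u)
    then have "unit_vec (u \<otimes> s) = (hop_r q s (unit_vec u) :: 'a \<Rightarrow> 'k)" by (simp add: hop_r_unit)
    then show ?case
      using F[OF mult(1) unit_vec_supported[OF mult(2)]] G[OF mult(1) unit_vec_supported[OF mult(2)]] mult
      by simp
  qed (rule assms)
qed

lemma hop_square:
  assumes "s \<in> S" "supp f"
  shows "hop q s (hop q s f) x = (1 - q) * hop q s f x + q * f x"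
proof (cases "x \<in> carrier W")
  case True
  then show ?thesis using assms len_neq[of s x]
    by (simp add: hop_apply not_less) (auto simp: algebra_simps)
next
  case False
  then show ?thesis using assms by (simp add: hop_apply supported_def)
qed

lemma hop_hbar:
  assumes "s \<in> S" "supp f"
  shows "hop q s (hbar q s f) = (\<lambda>x. q * f x)" "hbar q s (hop q s f) = (\<lambda>x. q * f x)"
proof -
  show "hop q s (hbar q s f) = (\<lambda>x. q * f x)"
    unfolding hbar_def linop_diff[OF hop_linop] linop_scale[OF hop_linop]
    using hop_square[OF assms] by simp
  show "hbar q s (hop q s f) = (\<lambda>x. q * f x)"
    unfolding hbar_def using hop_square[OF assms] by simp
qed

lemma hword_hbword:
  assumes "set ss \<subseteq> S" "supp f"
  shows "hword q (rev ss) (hbword q ss f) = (\<lambda>x. q ^ length ss * f x)"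
    and "hbword q ss (hword q (rev ss) f) = (\<lambda>x. q ^ length ss * f x)"
proof -
  show "hword q (rev ss) (hbword q ss f) = (\<lambda>x. q ^ length ss * f x)"
    using assms
  proof (induction ss)
    case (Cons s ss)
    then show ?case
      by (simp add: hop_hbar hbword_supp linop_scale[OF hword_linop] mult.assoc)
  qed simp
  show "hbword q ss (hword q (rev ss) f) = (\<lambda>x. q ^ length ss * f x)"
    using assms
  proof (induction ss arbitrary: f)
    case (Cons s ss)
    then show ?case
      by (simp add: hop_hbar hop_supp linop_scale[OF hbar_linop] mult.assoc mult.left_commute)
  qed simp
qed

lemma hword_unit:
  assumes "set ss \<subseteq> S" "x \<in> carrier W" "l (wp ss \<otimes> x) = length ss + l x"
  shows "hword q ss (unit_vec x) = unit_vec (wp ss \<otimes> x)"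
  using assms
proof (induction ss)
  case (Cons s ss)
  have c: "s \<in> S" "wp ss \<otimes> x \<in> carrier W" "set ss \<subseteq> S" using Cons by auto
  have "l (wp ss \<otimes> x) \<le> length ss + l x"
    using len_mult_le[of "wp ss" x] len_wp_le[of ss] c Cons.prems by auto
  moreover have "l (s \<otimes> (wp ss \<otimes> x)) \<le> Suc (l (wp ss \<otimes> x))" using len_mult_S_le c by blast
  ultimately have "l (wp ss \<otimes> x) = length ss + l x" "l (wp ss \<otimes> x) < l (s \<otimes> (wp ss \<otimes> x))"
    using Cons.prems c by (auto simp: m_assoc)
  then show ?case using Cons c by (simp add: hop_unit hgen_def m_assoc)
qed simp

lemma hword_unit_one:
  "set ss \<subseteq> S \<Longrightarrow> length ss = l (wp ss) \<Longrightarrow> hword q ss (unit_vec \<one>) = unit_vec (wp ss)"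
  using hword_unit[of ss \<one> q] by simp

text \<open>This takes the place of Matsumoto's theorem: both words send the basis vector of the
  identity to that of their common product.\<close>

lemma hword_well_defined:
  assumes "set ss \<subseteq> S" "length ss = l (wp ss)" "set ts \<subseteq> S" "length ts = l (wp ts)" "wp ss = wp ts"
    and "supp f"
  shows "hword q ss f = hword q ts f"
  by (rule cyclic_eqI[where q = q, OF hword_linop hword_linop])
    (use assms in \<open>simp_all add: hword_commute hword_unit_one\<close>)

section \<open>Multiplication and inverses in the Hecke algebra\<close>

definition hact :: "'k::comm_ring_1 \<Rightarrow> ('a \<Rightarrow> 'k) \<Rightarrow> ('a \<Rightarrow> 'k) \<Rightarrow> 'a \<Rightarrow> 'k" where
  "hact q g f = (\<lambda>x. \<Sum>w\<in>carrier W. g w * hword q (rw w) f x)"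

lemma hact_linop: "linop (hact q g)"
  unfolding hact_def linop_def
  by (simp add: linop_add[OF hword_linop] linop_scale[OF hword_linop] distrib_left sum.distrib
      sum_distrib_left mult.left_commute)

lemma hact_commute:
  assumes "r \<in> S" shows "hact q g (hop_r q r f) = hop_r q r (hact q g f)"
proof
  fix x
  have "hact q g (hop_r q r f) x = (\<Sum>w\<in>carrier W. g w * hop_r q r (hword q (rw w) f) x)"
    unfolding hact_def using assms reduced_word by (intro sum.cong) (simp_all add: hword_commute)
  then show "hact q g (hop_r q r f) x = hop_r q r (hact q g f) x"
    by (simp add: hact_def hop_r_def algebra_simps sum.distrib sum_distrib_left sum_subtractf)
qed

lemma hact_unit_one: "supp g \<Longrightarrow> hact q g (unit_vec \<one>) = g"
  using supported_expand[OF _ finite_carrier, of g] reduced_word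
  by (simp add: hact_def hword_unit_one)

lemma hact_unit: "w \<in> carrier W \<Longrightarrow> hact q (unit_vec w) f = hword q (rw w) f"
  using lext_unit_vec[OF finite_carrier, of w "\<lambda>w. hword q (rw w) f"]
  by (simp add: hact_def lext_def)

context
  fixes p q :: "'k::comm_ring_1"
  assumes pq: "p * q = 1"
begin

text \<open>The inverse of the basis element of \<open>inv w\<close>, that is, the bar of A_w. The
  power of p removes the factor q that each \<open>hbar\<close> carries.\<close>

definition hinv :: "'a \<Rightarrow> 'a \<Rightarrow> 'k" where
  "hinv w = (\<lambda>x. p ^ l w * hbword q (rw w) (unit_vec \<one>) x)"

lemma pq_power: "p ^ n * (q ^ n * x) = x"
  using pq by (simp add: mult.assoc[symmetric] power_mult_distrib[symmetric])

lemma hinv_supp: "w \<in> carrier W \<Longrightarrow> supp (hinv w)"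
  using hbword_supp[OF reduced_word(1) unit_vec_supported[OF one_closed], of w q]
  by (simp add: hinv_def supported_def)

text \<open>Multiplication by an element of the algebra and an operator given by a word both commute
  with right multiplications, so it is enough to compare them at the identity.\<close>

lemma hact_hinv:
  assumes "w \<in> carrier W" "supp f"
  shows "hact q (hinv w) f = (\<lambda>x. p ^ l w * hbword q (rw w) f x)"
proof -
  have lin: "linop (\<lambda>f x. p ^ l w * hbword q (rw w) f x)"
    using hbword_linop[of q "rw w"] by (simp add: linop_def algebra_simps)
  have comm: "(\<lambda>x. p ^ l w * hbword q (rw w) (hop_r q r f) x) = hop_r q r (\<lambda>x. p ^ l w * hbword q (rw w) f x)"
    if "r \<in> S" for r f
    unfolding hbword_commute[OF reduced_word(1)[OF assms(1)] that]
    by (auto simp: hop_r_def algebra_simps)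
  show ?thesis
    using cyclic_eqI[where q = q, OF hact_linop[of q "hinv w"] lin hact_commute comm _ assms(2)] hact_unit_one[of "hinv w"]
      hinv_supp[OF assms(1)] by (simp add: hinv_def)
qed

lemma hword_inv:
  assumes "w \<in> carrier W" "supp f"
  shows "hword q (rw (inv w)) f = hword q (rev (rw w)) f"
  by (rule hword_well_defined)
    (use assms reduced_word[of w] reduced_word[of "inv w"] in \<open>simp_all add: wp_rev\<close>)

text \<open>Evaluates the definite description in \<open>hecke_inv\<close>. The one-sided equation
  suffices, since \<open>hbword\<close> is a left inverse of the reversed \<open>hword\<close> up to
  a power of the invertible q.\<close>

lemma hact_inv_unique:
  assumes "w \<in> carrier W" "supp g" "hact q (unit_vec (inv w)) g = unit_vec \<one>"
  shows "g = hinv w"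
proof -
  have "hword q (rev (rw w)) g = unit_vec \<one>"
    using assms hword_inv by (simp add: hact_unit)
  then have "hbword q (rw w) (unit_vec \<one>) = (\<lambda>x. q ^ l w * g x)"
    using hword_hbword(2)[of "rw w" g q] reduced_word[OF assms(1)] assms(2) by simp
  then show ?thesis by (simp add: hinv_def pq_power)
qed

lemma hact_hinv_inverse:
  assumes "w \<in> carrier W"
  shows "hact q (unit_vec (inv w)) (hinv w) = unit_vec \<one>"
    and "hact q (hinv w) (unit_vec (inv w)) = unit_vec \<one>"
proof -
  note rw = reduced_word[OF assms]
  have one: "supp (unit_vec \<one> :: 'a \<Rightarrow> 'k)" by (simp add: unit_vec_supported)
  have "hact q (unit_vec (inv w)) (hinv w) = hword q (rev (rw w)) (hinv w)"
    using assms hword_inv hinv_supp by (simp add: hact_unit)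
  then show "hact q (unit_vec (inv w)) (hinv w) = unit_vec \<one>"
    using hword_hbword(1)[OF rw(1) one, of q] rw
    by (simp add: hinv_def linop_scale[OF hword_linop] pq_power)
  have *: "unit_vec (inv w) = hword q (rev (rw w)) (unit_vec \<one>)"
    using hword_unit_one[of "rev (rw w)" q] rw assms by (simp add: wp_rev)
  have "hact q (hinv w) (unit_vec (inv w)) = (\<lambda>x. p ^ l w * hbword q (rw w) (unit_vec (inv w)) x)"
    using assms by (intro hact_hinv) (simp_all add: unit_vec_supported)
  then show "hact q (hinv w) (unit_vec (inv w)) = unit_vec \<one>"
    unfolding * hword_hbword(2)[OF rw(1) one, of q] rw by (simp add: pq_power)
qed

end

lemma hgen_ring_map: "ring_map h \<Longrightarrow> h (hgen q s w x) = hgen (h q) s w x"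
  by (simp add: hgen_def ring_map_simps ring_map_unit_vec)

lemma hop_ring_map:
  assumes "ring_map h"
  shows "hop (h q) s (\<lambda>x. h (f x)) = (\<lambda>x. h (hop q s f x))"
    "hbar (h q) s (\<lambda>x. h (f x)) = (\<lambda>x. h (hbar q s f x))"
  by (simp_all add: hbar_def hop_def lext_def ring_map_sum[OF assms]
      ring_map_simps[OF assms] hgen_ring_map[OF assms])

lemma hbword_ring_map:
  assumes "ring_map h"
  shows "hbword (h q) ss (\<lambda>x. h (f x)) = (\<lambda>x. h (hbword q ss f x))"
  by (induction ss) (simp_all add: hop_ring_map[OF assms])

end

section \<open>Specialisation at zero\<close>

context coxeter_group
begin

text \<open>\<open>aw w\<close> and \<open>cw w\<close> are left multiplication by A_w and C_w in
  the 0-Hecke algebra; the elements themselves are the values at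
  \<open>unit_vec \<one>\<close>.\<close>

definition aw :: "'a \<Rightarrow> ('a \<Rightarrow> int) \<Rightarrow> 'a \<Rightarrow> int" where "aw w = hword 0 (rw w)"

definition cw :: "'a \<Rightarrow> ('a \<Rightarrow> int) \<Rightarrow> 'a \<Rightarrow> int" where "cw w = hbword 0 (rw w)"

lemma aw_linop: "linop (aw w)" and cw_linop: "linop (cw w)"
  by (simp_all add: aw_def cw_def hword_linop hbword_linop)

lemma cw_supp: "w \<in> carrier W \<Longrightarrow> supp f \<Longrightarrow> supp (cw w f)"
  and aw_supp: "w \<in> carrier W \<Longrightarrow> supp f \<Longrightarrow> supp (aw w f)"
  by (simp_all add: aw_def cw_def hbword_supp hword_supp reduced_word)

lemma hbar_zero_apply:
  "s \<in> S \<Longrightarrow> x \<in> carrier W \<Longrightarrow> hbar (0::int) s f x = (if l (s \<otimes> x) < l x then f (s \<otimes> x) else - f x)"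
  by (simp add: hbar_def hop_apply)

lemma bruhat_one_iff: "x \<preceq> \<one> \<longleftrightarrow> x = \<one>"
  using bruhat_closed[of x \<one>] bruhat_len_le[of x \<one>] len_eq_0[of x] by auto

text \<open>The coordinates are the values of the Moebius function of Bruhat order found by Verma.
  Prepending s replaces f by f (s x) where s is a descent of x and by - f x elsewhere, which is the
  recursion of \<open>bruhat_le_up_iff\<close> for the ideal below \<open>s w\<close>.\<close>

lemma hbword_zero_unit:
  assumes "set ss \<subseteq> S" "length ss = l (wp ss)"
  shows "hbword 0 ss (unit_vec \<one>) = (\<lambda>x. if x \<preceq> wp ss then (-1::int) ^ (l x + l (wp ss)) else 0)"
  using assms
proof (induction ss)
  case Nil
  then show ?case by (auto simp: unit_vec_def bruhat_one_iff)
next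
  case (Cons s ss)
  define w where "w = wp ss"
  have c: "s \<in> S" "w \<in> carrier W" "set ss \<subseteq> S" using Cons.prems by (auto simp: w_def)
  have "length ss = l w" and up: "l (s \<otimes> w) = Suc (l w)"
    using Cons.prems len_wp_le[of ss] len_mult_S_le[of s w] c by (auto simp: w_def)
  then have IH: "hbword 0 ss (unit_vec \<one>) = (\<lambda>x. if x \<preceq> w then (-1::int) ^ (l x + l w) else 0)"
    using Cons.IH c by (simp add: w_def cong: if_cong)
  show ?case
  proof
    fix x
    show "hbword 0 (s # ss) (unit_vec \<one>) x = (if x \<preceq> wp (s # ss) then (-1::int) ^ (l x + l (wp (s # ss))) else 0)"
    proof (cases "x \<in> carrier W")
      case False
      have "supp (hbword (0::int) (s # ss) (unit_vec \<one>))"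
        by (rule hbword_supp) (use Cons.prems in \<open>auto simp: unit_vec_supported\<close>)
      moreover have "\<not> x \<preceq> wp (s # ss)" using False bruhat_closed[of x "wp (s # ss)"] c by (auto simp: w_def)
      ultimately show ?thesis using False by (simp add: supported_def)
    next
      case x: True
      show ?thesis
      proof (cases "l (s \<otimes> x) < l x")
        case True
        then have "l x = Suc (l (s \<otimes> x))" using c x len_down_iff by blast
        then show ?thesis
          using bruhat_le_up_iff(3)[OF c(1,2) _ x True] up True x c
          by (simp add: IH hbar_zero_apply flip: w_def)
      next
        case False
        then have "l x < l (s \<otimes> x)" using c x not_down_iff by blast
        then show ?thesis
          using bruhat_le_up_iff(2)[OF c(1,2) _ x] up False x c
          by (simp add: IH hbar_zero_apply flip: w_def)
      qed
    qed
  qed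
qed

lemma cw_unit:
  "w \<in> carrier W \<Longrightarrow> cw w (unit_vec \<one>) = (\<lambda>x. if x \<preceq> w then (-1) ^ (l x + l w) else 0)"
  unfolding cw_def using hbword_zero_unit[of "rw w"] reduced_word[of w] by (simp cong: if_cong)

text \<open>The closed formula at the identity depends only on the product of the word, and
  commutation with right multiplications does the rest.\<close>

lemma hbword_zero_well_defined:
  assumes "set ss \<subseteq> S" "length ss = l (wp ss)" "set ts \<subseteq> S" "length ts = l (wp ts)" "wp ss = wp ts"
    and "supp f"
  shows "hbword (0::int) ss f = hbword 0 ts f"
  by (rule cyclic_eqI[where q = 0, OF hbword_linop hbword_linop])
    (use assms in \<open>simp_all add: hbword_commute hbword_zero_unit cong: if_cong\<close>)

lemma cw_mult:
  assumes "x \<in> carrier W" "y \<in> carrier W" "l (x \<otimes> y) = l x + l y" "supp f"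
  shows "cw (x \<otimes> y) f = cw x (cw y f)"
proof -
  have "hbword (0::int) (rw (x \<otimes> y)) f = hbword 0 (rw x @ rw y) f"
    by (rule hbword_zero_well_defined)
      (use assms reduced_word[of x] reduced_word[of y] reduced_word[of "x \<otimes> y"] in \<open>simp_all add: wp_append\<close>)
  then show ?thesis by (simp add: cw_def)
qed

lemma aw_mult:
  assumes "x \<in> carrier W" "y \<in> carrier W" "l (x \<otimes> y) = l x + l y" "supp f"
  shows "aw (x \<otimes> y) f = aw x (aw y f)"
proof -
  have "hword (0::int) (rw (x \<otimes> y)) f = hword 0 (rw x @ rw y) f"
    by (rule hword_well_defined)
      (use assms reduced_word[of x] reduced_word[of y] reduced_word[of "x \<otimes> y"] in \<open>simp_all add: wp_append\<close>)
  then show ?thesis by (simp add: aw_def)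
qed

lemma cw_one [simp]: "cw \<one> f = f" and aw_one [simp]: "aw \<one> f = f"
  using reduced_word(3)[of \<one>] by (simp_all add: cw_def aw_def)

lemma cw_S: "s \<in> S \<Longrightarrow> supp f \<Longrightarrow> cw s f = hbar 0 s f"
  using hbword_zero_well_defined[of "rw s" "[s]" f] reduced_word[of s] by (simp add: cw_def)

lemma aw_S: "s \<in> S \<Longrightarrow> supp f \<Longrightarrow> aw s f = hop 0 s f"
  using hword_well_defined[of "rw s" "[s]" f] reduced_word[of s] by (simp add: aw_def)

lemma aw_unit: "w \<in> carrier W \<Longrightarrow> x \<in> carrier W \<Longrightarrow> l (w \<otimes> x) = l w + l x \<Longrightarrow>
    aw w (unit_vec x) = unit_vec (w \<otimes> x)"
  unfolding aw_def using hword_unit[of "rw w" x] reduced_word[of w] by simp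

text \<open>C_s squares to - C_s, and C_u begins with a factor C_s when s is a descent of u.\<close>

lemma hbar_cw:
  assumes "s \<in> S" "u \<in> carrier W" "supp f"
  shows "hbar 0 s (cw u f) = (if l u < l (s \<otimes> u) then cw (s \<otimes> u) f else (\<lambda>x. - cw u f x))"
proof -
  have up: "hbar 0 s (cw v f) = cw (s \<otimes> v) f" if "v \<in> carrier W" "l v < l (s \<otimes> v)" for v
    using cw_mult[of s v f] cw_S[of s "cw v f"] cw_supp[of v f] len_up_iff[of s v] that assms by simp
  have "hbar 0 s (cw u f) = (\<lambda>x. - cw u f x)" if "l (s \<otimes> u) < l u"
  proof
    fix x
    have "cw u f = hbar 0 s (cw (s \<otimes> u) f)" using up[of "s \<otimes> u"] that assms by simp
    moreover have "hbar 0 s (hbar 0 s g) x = - hbar (0::int) s g x" if "supp g" for g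
      using assms that len_neq[of s x]
      by (cases "x \<in> carrier W") (auto simp: hbar_zero_apply supported_def hbar_def hop_apply)
    ultimately show "hbar 0 s (cw u f) x = - cw u f x"
      using cw_supp[of "s \<otimes> u" f] assms by simp
  qed
  then show ?thesis using up[of u] assms not_down_iff[of s u] by auto
qed

text \<open>A_s = 1 + C_s maps C_u to C_u + C_{su} at ascents and to 0 at descents. By the closure
  hypothesis, K together with its translate consists of the ascents in K (the set \<open>U\<close>)
  and their translates, so every term arises exactly once.\<close>

lemma hop_sum_cw:
  assumes "s \<in> S" "K \<subseteq> carrier W" "supp f" "\<And>u. u \<in> K \<Longrightarrow> l (s \<otimes> u) < l u \<Longrightarrow> s \<otimes> u \<in> K"
  shows "hop 0 s (\<lambda>x. \<Sum>u\<in>K. cw u f x) = (\<lambda>x. \<Sum>u\<in>K \<union> (\<lambda>u. s \<otimes> u) ` K. cw u f x)"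
proof
  fix x
  define U where "U = {u \<in> K. l u < l (s \<otimes> u)}"
  have fin: "finite K" using assms(2) finite_carrier finite_subset by blast
  then have fin: "finite K" "finite U" by (simp_all add: U_def)
  have "u \<in> U \<union> (\<lambda>u. s \<otimes> u) ` U" if "u \<in> K" for u
  proof (cases "l u < l (s \<otimes> u)")
    case False
    then have "l (s \<otimes> u) < l u" using not_down_iff assms that by blast
    then have "s \<otimes> u \<in> U" using assms that by (auto simp: U_def)
    moreover have "u = s \<otimes> (s \<otimes> u)" using assms that by auto
    ultimately show ?thesis by blast
  qed (use that in \<open>simp add: U_def\<close>)
  moreover have "s \<otimes> u \<in> U \<union> (\<lambda>u. s \<otimes> u) ` U" if "u \<in> K" for u
  proof (cases "l u < l (s \<otimes> u)")
    case False
    then have "l (s \<otimes> u) < l u" using not_down_iff assms that by blast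
    then show ?thesis using assms that by (auto simp: U_def)
  qed (use that in \<open>auto simp: U_def\<close>)
  ultimately have eq: "K \<union> (\<lambda>u. s \<otimes> u) ` K = U \<union> (\<lambda>u. s \<otimes> u) ` U" by (auto simp: U_def)
  have disj: "U \<inter> (\<lambda>u. s \<otimes> u) ` U = {}" using assms by (force simp: U_def)
  have inj: "inj_on (\<lambda>u. s \<otimes> u) U" using assms by (auto simp: inj_on_def U_def subset_iff)
  have "hop 0 s (\<lambda>x. \<Sum>u\<in>K. cw u f x) x = (\<Sum>u\<in>K. hop 0 s (cw u f) x)"
    by (simp add: linop_sum[OF hop_linop])
  also have "\<dots> = (\<Sum>u\<in>K. hbar 0 s (cw u f) x + cw u f x)" by (simp add: hbar_def)
  also have "\<dots> = (\<Sum>u\<in>K. if l u < l (s \<otimes> u) then cw (s \<otimes> u) f x + cw u f x else 0)"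
    using assms by (intro sum.cong) (auto simp: hbar_cw)
  also have "\<dots> = (\<Sum>u\<in>U. cw (s \<otimes> u) f x + cw u f x)"
    using fin by (simp add: U_def sum.inter_filter)
  also have "\<dots> = (\<Sum>u\<in>U \<union> (\<lambda>u. s \<otimes> u) ` U. cw u f x)"
    using fin disj by (simp add: sum.union_disjoint sum.distrib sum.reindex[OF inj] comp_def)
  finally show "hop 0 s (\<lambda>x. \<Sum>u\<in>K. cw u f x) x = (\<Sum>u\<in>K \<union> (\<lambda>u. s \<otimes> u) ` K. cw u f x)"
    unfolding eq .
qed

text \<open>If s is an ascent at \<open>x w\<close>, the ideal below \<open>s x w\<close> grows as
  in \<open>bruhat_le_up_iff\<close>. If it is not, the factor s has to be absorbed by a smaller
  element of K; this is where K must be a lower set.\<close>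

lemma lower_mult_step:
  assumes s: "s \<in> S" and x: "x \<in> carrier W" and up: "l x < l (s \<otimes> x)"
    and K: "K \<subseteq> carrier W" "\<And>u w. w \<in> K \<Longrightarrow> u \<preceq> w \<Longrightarrow> u \<in> K"
  shows "{u. \<exists>w\<in>K. u \<preceq> s \<otimes> x \<otimes> w} =
    {u. \<exists>w\<in>K. u \<preceq> x \<otimes> w} \<union> (\<lambda>u. s \<otimes> u) ` {u. \<exists>w\<in>K. u \<preceq> x \<otimes> w}" (is "?L = ?R \<union> _ ` ?R")
proof
  show "?L \<subseteq> ?R \<union> (\<lambda>u. s \<otimes> u) ` ?R"
  proof
    fix u assume "u \<in> ?L"
    then obtain w where w: "w \<in> K" "u \<preceq> s \<otimes> x \<otimes> w" by blast
    have c: "w \<in> carrier W" using w K by auto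
    have u: "u \<in> carrier W" using w bruhat_closed s x c by (metis S_closed m_closed)
    have le: "u \<preceq> s \<otimes> (x \<otimes> w)" using w s x c by (simp add: m_assoc)
    have "u \<preceq> x \<otimes> w \<or> s \<otimes> u \<preceq> x \<otimes> w"
    proof (cases "l (x \<otimes> w) < l (s \<otimes> (x \<otimes> w))")
      case True
      then show ?thesis using bruhat_le_up_iff(1)[of s "x \<otimes> w" u] le s x c u by simp
    next
      case False
      then have "s \<otimes> (x \<otimes> w) \<preceq> x \<otimes> w" using down_left[of s "x \<otimes> w"] not_down_iff[of s "x \<otimes> w"] s x c by auto
      then show ?thesis using le bruhat_trans by blast
    qed
    moreover have "u = s \<otimes> (s \<otimes> u)" using s u by simp
    ultimately show "u \<in> ?R \<union> (\<lambda>u. s \<otimes> u) ` ?R" using w by blast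
  qed
  have "u \<in> ?L \<and> s \<otimes> u \<in> ?L" if "w \<in> K" "u \<preceq> x \<otimes> w" for u w
  proof -
    have c: "w \<in> carrier W" "x \<otimes> w \<in> carrier W" using that K x by auto
    have u: "u \<in> carrier W" using that bruhat_closed c by blast
    show ?thesis
    proof (cases "l (x \<otimes> w) < l (s \<otimes> (x \<otimes> w))")
      case True
      then have "u \<preceq> s \<otimes> (x \<otimes> w)" "s \<otimes> u \<preceq> s \<otimes> (x \<otimes> w)"
        using bruhat_le_up_iff(1)[of s "x \<otimes> w" u] bruhat_le_up_iff(1)[of s "x \<otimes> w" "s \<otimes> u"] that s x c u
        by auto
      moreover have "s \<otimes> (x \<otimes> w) = s \<otimes> x \<otimes> w" using s x c by (simp add: m_assoc)
      ultimately show ?thesis using that(1) by auto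
    next
      case False
      \<comment> \<open>s is an ascent at x but not at \<open>x w\<close>, so the word of w crosses
        the wall of s: w = a r b with \<open>s x a = x a r\<close>. Dropping r gives
        \<open>a b\<close> below w, hence in K, and \<open>s x (a b) = x w\<close>.\<close>
      obtain us r vs where uv: "rw w = us @ r # vs" "s \<otimes> (x \<otimes> wp us) = x \<otimes> wp us \<otimes> r"
        using crossing[of s x "rw w"] s x up False reduced_word[OF c(1)] by metis
      have sub: "set us \<subseteq> S" "r \<in> S" "set vs \<subseteq> S" using uv reduced_word[OF c(1)] by auto
      define a b where "a = wp us" and "b = wp vs"
      have ab: "a \<in> carrier W" "b \<in> carrier W" "s \<otimes> (x \<otimes> a) = x \<otimes> a \<otimes> r" using sub uv by (auto simp: a_def b_def)
      have w: "w = a \<otimes> (r \<otimes> b)"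
        using reduced_word(2)[OF c(1)] sub uv(1) by (simp add: wp_append a_def b_def)
      have t: "a \<otimes> r \<otimes> inv a \<in> reflections W S" using reflection_conj S_reflection sub ab by blast
      have tw: "(a \<otimes> r \<otimes> inv a) \<otimes> (a \<otimes> b) = w" using ab sub by (simp add: w m_assoc)
      have "l (a \<otimes> b) < l w"
        using len_wp_le[of "us @ vs"] sub uv reduced_word(3)[OF c(1)] by (simp add: a_def b_def wp_append)
      then have K': "a \<otimes> b \<in> K" using bruhat_step[OF t, of "a \<otimes> b"] tw ab K(2)[OF that(1)] by simp
      have "s \<otimes> x \<otimes> (a \<otimes> b) = s \<otimes> (x \<otimes> a) \<otimes> b" using ab(1,2) s x by (simp add: m_assoc)
      then have eq: "s \<otimes> x \<otimes> (a \<otimes> b) = x \<otimes> w" using ab(1,2) s x sub unfolding ab(3) w by (simp add: m_assoc)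
      have "s \<otimes> u \<preceq> x \<otimes> w"
        using lift_left1[OF that(2) u s] down_left[of s "x \<otimes> w"] not_down_iff[of s "x \<otimes> w"] False c s bruhat_trans
        by blast
      then have "u \<preceq> s \<otimes> x \<otimes> (a \<otimes> b) \<and> s \<otimes> u \<preceq> s \<otimes> x \<otimes> (a \<otimes> b)" unfolding eq using that by simp
      then show ?thesis using K' by blast
    qed
  qed
  then show "?R \<union> (\<lambda>u. s \<otimes> u) ` ?R \<subseteq> ?L" by blast
qed

text \<open>The index set is built up along a reduced word of x, by \<open>lower_mult_step\<close>
  on sets and \<open>hop_sum_cw\<close> on sums. It is the shape that the Bruhat-Chevalley order
  requires, with K later chosen as the w such that y w is below v.\<close>

lemma aw_lower_sum:
  assumes K: "K \<subseteq> carrier W" "\<And>u w. w \<in> K \<Longrightarrow> u \<preceq> w \<Longrightarrow> u \<in> K" and "supp f" "x \<in> carrier W"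
  shows "aw x (\<lambda>y. \<Sum>w\<in>K. cw w f y) = (\<lambda>y. \<Sum>u\<in>{u. \<exists>w\<in>K. u \<preceq> x \<otimes> w}. cw u f y)"
  using assms(4)
proof (induction x rule: len_induct)
  case one
  have "{u. \<exists>w\<in>K. u \<preceq> \<one> \<otimes> w} = K" using K by (auto intro!: bexI[of _ "x" for x])
  then show ?case by simp
next
  case (mult s x)
  let ?R = "{u. \<exists>w\<in>K. u \<preceq> x \<otimes> w}"
  have sK: "supp (\<lambda>y. \<Sum>w\<in>K. cw w f y)"
    using cw_supp[OF _ assms(3)] K by (auto simp: supported_def intro!: sum.neutral)
  have R: "?R \<subseteq> carrier W" using bruhat_closed mult K by blast
  have low: "s \<otimes> u \<in> ?R" if "u \<in> ?R" "l (s \<otimes> u) < l u" for u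
    using that down_left[OF mult(1)] R bruhat_trans by blast
  have "aw (s \<otimes> x) (\<lambda>y. \<Sum>w\<in>K. cw w f y) = hop 0 s (aw x (\<lambda>y. \<Sum>w\<in>K. cw w f y))"
    using aw_mult[of s x] aw_S[of s] aw_supp[OF mult(2) sK] mult sK by simp
  also have "\<dots> = (\<lambda>y. \<Sum>u\<in>?R \<union> (\<lambda>u. s \<otimes> u) ` ?R. cw u f y)"
    unfolding mult(4) using hop_sum_cw[OF mult(1) R assms(3) low] .
  also have "?R \<union> (\<lambda>u. s \<otimes> u) ` ?R = {u. \<exists>w\<in>K. u \<preceq> s \<otimes> x \<otimes> w}"
    using lower_mult_step[OF mult(1,2) _ K] mult by simp
  finally show ?case .
qed

lemma aw_sum:
  assumes "w \<in> carrier W" "supp f"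
  shows "aw w f = (\<lambda>x. \<Sum>u\<in>{u. u \<preceq> w}. cw u f x)"
  using aw_lower_sum[of "{\<one>}" f w] assms by (simp add: bruhat_one_iff)

text \<open>Triangularity: C_w has coefficient 1 at w and lives below w. At an index of maximal
  length among those with nonzero coefficient, only its own term survives.\<close>

lemma cw_unit_independent:
  assumes "finite I" "inj_on g I" "g ` I \<subseteq> carrier W"
    and zero: "\<And>x. x \<in> carrier W \<Longrightarrow> (\<Sum>i\<in>I. a i * cw (g i) (unit_vec \<one>) x) = 0"
    and "i \<in> I"
  shows "a i = 0"
proof (rule ccontr)
  assume "a i \<noteq> 0"
  define P where "P = {i \<in> I. a i \<noteq> 0}"
  have "finite P" "P \<noteq> {}" using assms(1,5) \<open>a i \<noteq> 0\<close> by (auto simp: P_def)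
  then have "Max ((\<lambda>i. l (g i)) ` P) \<in> (\<lambda>i. l (g i)) ` P" by (intro Max_in) auto
  then obtain j where j: "j \<in> P" "l (g j) = Max ((\<lambda>i. l (g i)) ` P)" by auto
  have max: "l (g k) \<le> l (g j)" if "k \<in> P" for k using j that \<open>finite P\<close> by auto
  have c: "g k \<in> carrier W" if "k \<in> I" for k using assms(3) that by auto
  have jI: "j \<in> I" "a j \<noteq> 0" using j by (auto simp: P_def)
  have "a k * cw (g k) (unit_vec \<one>) (g j) = (if k = j then a j else 0)" if "k \<in> I" for k
  proof (cases "k = j")
    case True
    then show ?thesis using cw_unit[OF c[OF jI(1)]] by simp
  next
    case False
    have "a k = 0" if "g j \<preceq> g k"
    proof (rule ccontr)
      assume "a k \<noteq> 0"
      then have "l (g k) \<le> l (g j)" using max \<open>k \<in> I\<close> by (simp add: P_def)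
      then have "g j = g k" using bruhat_len[OF that c[OF jI(1)]] by simp
      then show False using False assms(2) \<open>k \<in> I\<close> jI by (auto simp: inj_on_def)
    qed
    then show ?thesis using cw_unit[OF c[OF that]] False by simp
  qed
  then have "(\<Sum>k\<in>I. a k * cw (g k) (unit_vec \<one>) (g j)) = a j"
    using assms(1) jI by simp
  then show False using zero[OF c[OF jI(1)]] jI by simp
qed

text \<open>A_z is the sum of the C_u over u below z, and all these u remain in the lower set
  H.\<close>

lemma cw_unit_span:
  assumes H: "H \<subseteq> carrier W" "\<And>u w. w \<in> H \<Longrightarrow> u \<preceq> w \<Longrightarrow> u \<in> H" and f: "supported H f"
  obtains a where "f = (\<lambda>x. \<Sum>u\<in>H. a u * cw u (unit_vec \<one>) x)"
proof
  have fin: "finite H" using H finite_carrier finite_subset by blast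
  have one: "supp (unit_vec \<one> :: 'a \<Rightarrow> int)" by (simp add: unit_vec_supported)
  have u: "unit_vec z x = (\<Sum>u\<in>H. if u \<preceq> z then cw u (unit_vec \<one>) x else 0)" if "z \<in> H" for z x
  proof -
    have "unit_vec z = aw z (unit_vec \<one>)" using aw_unit[of z \<one>] that H by auto
    then have "unit_vec z x = (\<Sum>u\<in>{u. u \<preceq> z}. cw u (unit_vec \<one>) x)"
      using aw_sum[of z, OF _ one] that H by auto
    also have "{u. u \<preceq> z} = {u \<in> H. u \<preceq> z}" using H(2) that by blast
    finally show ?thesis using fin by (simp add: sum.inter_filter)
  qed
  show "f = (\<lambda>x. \<Sum>u\<in>H. (\<Sum>z\<in>H. if u \<preceq> z then f z else 0) * cw u (unit_vec \<one>) x)"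
  proof
    fix x
    have "f x = (\<Sum>z\<in>H. f z * unit_vec z x)" using supported_expand[OF f fin] by meson
    also have "\<dots> = (\<Sum>z\<in>H. \<Sum>u\<in>H. (if u \<preceq> z then f z else 0) * cw u (unit_vec \<one>) x)"
      using u by (intro sum.cong refl) (auto simp: sum_distrib_left intro!: sum.cong)
    also have "\<dots> = (\<Sum>u\<in>H. \<Sum>z\<in>H. (if u \<preceq> z then f z else 0) * cw u (unit_vec \<one>) x)"
      by (rule sum.swap)
    finally show "f x = (\<Sum>u\<in>H. (\<Sum>z\<in>H. if u \<preceq> z then f z else 0) * cw u (unit_vec \<one>) x)"
      by (simp add: sum_distrib_right)
  qed
qed

end

section \<open>The module on the cosets\<close>

text \<open>The combinatorics of the orbit detached from the monoid: H is W(e), E is W_e and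
  \<open>elt x y\<close> is x e y^-1. With a = x^-1 x' and b = y^-1 y', the equality criterion says
  that a lies in W(e) and b in the coset a W_e.\<close>

locale orbit_cosets = coxeter_group W S for W :: "('w, 'c) monoid_scheme" (structure) and S +
  fixes J K H E :: "'w set" and elt :: "'w \<Rightarrow> 'w \<Rightarrow> 'o"
  assumes J: "J \<subseteq> S" "H = generate W J" and K: "K \<subseteq> S" "E = generate W K"
    and E_subset: "E \<subseteq> H"
    and E_normal: "\<And>h k. h \<in> H \<Longrightarrow> k \<in> E \<Longrightarrow> inv h \<otimes> k \<otimes> h \<in> E"
    and elt_eq: "\<And>x y x' y'. x \<in> carrier W \<Longrightarrow> y \<in> carrier W \<Longrightarrow> x' \<in> carrier W \<Longrightarrow> y' \<in> carrier W \<Longrightarrow>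
      elt x y = elt x' y' \<longleftrightarrow> inv x \<otimes> x' \<in> H \<and> inv (inv x \<otimes> x') \<otimes> (inv y \<otimes> y') \<in> E"
begin

abbreviation "D \<equiv> min_reps W S H"
abbreviation "DE \<equiv> min_reps W S E"

lemmas H_closed [simp] = parabolic_closed[OF J] and E_closed [simp] = parabolic_closed[OF K]
lemmas D_closed [simp] = min_reps_closed[OF J] and DE_closed [simp] = min_reps_closed[OF K]
lemmas H_group = parabolic_mult[OF J] parabolic_one[OF J] parabolic_inv[OF J]
lemmas E_group = parabolic_mult[OF K] parabolic_one[OF K] parabolic_inv[OF K]

definition Orb :: "'o set" where "Orb = (\<lambda>(x, y). elt x y) ` (carrier W \<times> carrier W)"

lemma Orb_finite [simp]: "finite Orb"
  unfolding Orb_def using finite_carrier by simp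

lemma finite_D [simp]: "finite D" "finite DE" "finite H"
  using finite_carrier by (auto intro: finite_subset[of _ "carrier W"])

lemma elt_Orb [simp, intro]: "x \<in> carrier W \<Longrightarrow> y \<in> carrier W \<Longrightarrow> elt x y \<in> Orb"
  by (auto simp: Orb_def)

lemma E_inv_iff: "x \<in> carrier W \<Longrightarrow> inv x \<in> E \<longleftrightarrow> x \<in> E"
  using E_group(3)[of x] E_group(3)[of "inv x"] by auto

lemma elt_mult_E: "x \<in> carrier W \<Longrightarrow> y \<in> carrier W \<Longrightarrow> k \<in> E \<Longrightarrow> elt (x \<otimes> k) y = elt x y"
  using elt_eq[of x y "x \<otimes> k" y] E_subset E_group(3)[of k] by auto

lemma elt_D_eq:
  assumes "x \<in> carrier W" "x' \<in> carrier W" "d \<in> D" "d' \<in> D"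
  shows "elt x d = elt x' d' \<longleftrightarrow> d = d' \<and> inv x \<otimes> x' \<in> E"
proof
  assume "elt x d = elt x' d'"
  then have *: "inv x \<otimes> x' \<in> H" "inv (inv x \<otimes> x') \<otimes> (inv d \<otimes> d') \<in> E" using elt_eq assms by auto
  define a b where "a = inv x \<otimes> x'" and "b = inv d \<otimes> d'"
  have ab: "a \<in> H" "inv a \<otimes> b \<in> E" "b \<in> carrier W" using * assms by (auto simp: a_def b_def)
  then have "a \<otimes> (inv a \<otimes> b) \<in> H" using H_group(1)[of a "inv a \<otimes> b"] E_subset by blast
  then have "b \<in> H" using ab by simp
  moreover have "d' = d \<otimes> b" using assms by (simp add: b_def)
  ultimately have "d = d'" using min_reps_unique(1)[OF J assms(3,4), of b \<one>] assms H_group(2) by simp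
  then have "b = \<one>" using assms by (simp add: b_def)
  then have "inv a \<in> E" using ab by simp
  then show "d = d' \<and> inv x \<otimes> x' \<in> E" using \<open>d = d'\<close> E_inv_iff[of a] ab by (simp add: a_def)
next
  assume "d = d' \<and> inv x \<otimes> x' \<in> E"
  then show "elt x d = elt x' d'" using elt_mult_E[of x d "inv x \<otimes> x'"] assms by simp
qed

lemma elt_std_eq:
  assumes "x \<in> DE" "x' \<in> DE" "d \<in> D" "d' \<in> D"
  shows "elt x d = elt x' d' \<longleftrightarrow> x = x' \<and> d = d'"
proof -
  have "x = x'" if "inv x \<otimes> x' \<in> E"
    using min_reps_unique(1)[OF K assms(1,2) that E_group(2)] assms by simp
  then show ?thesis using elt_D_eq[of x x' d d'] assms E_group(2) by auto
qed

lemma elt_std_exists: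
  assumes "\<sigma> \<in> Orb"
  obtains x d where "x \<in> DE" "d \<in> D" "\<sigma> = elt x d"
proof -
  obtain a b where ab: "a \<in> carrier W" "b \<in> carrier W" "\<sigma> = elt a b" using assms by (auto simp: Orb_def)
  obtain d h where d: "d \<in> D" "h \<in> H" "b = d \<otimes> h" using min_reps_exists[OF J ab(2)] by blast
  have "a \<otimes> inv h \<in> carrier W" using ab d by simp
  then obtain x k where x: "x \<in> DE" "k \<in> E" "a \<otimes> inv h = x \<otimes> k" using min_reps_exists[OF K] by blast
  \<comment> \<open>The factor h commutes with e and moves to the left: a e (d h)^-1 = a h^-1 e
    d^-1. After that only E remains to be divided out.\<close>
  have "elt a b = elt (a \<otimes> inv h) d"
    using elt_eq[of a b "a \<otimes> inv h" d] ab d H_group E_group(2) by (simp add: inv_mult_group)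
  also have "\<dots> = elt x d" using x elt_mult_E d by simp
  finally show ?thesis using that x d ab by blast
qed

end

locale orbit_module = orbit_cosets W S J K H E elt
  for W :: "('w, 'c) monoid_scheme" (structure) and S J K H E and elt :: "'w \<Rightarrow> 'w \<Rightarrow> 'o" +
  fixes act :: "'w \<Rightarrow> 'o \<Rightarrow> 'o" and olen :: "'o \<Rightarrow> int" and c :: int
  assumes act_elt: "\<And>s x y. s \<in> S \<Longrightarrow> x \<in> carrier W \<Longrightarrow> y \<in> carrier W \<Longrightarrow> act s (elt x y) = elt (s \<otimes> x) y"
    and olen_elt: "\<And>x y. x \<in> DE \<Longrightarrow> y \<in> D \<Longrightarrow> olen (elt x y) = int (l x) + c - int (l y)"
begin

text \<open>For d in D this is the module map from the regular module that multiplies the basis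
  vector of e d^-1; it collapses the cosets of E. Computations in the orbit module are lifted along
  it to the Hecke algebra.\<close>

definition pim :: "'w \<Rightarrow> ('w \<Rightarrow> 'k::comm_ring_1) \<Rightarrow> 'o \<Rightarrow> 'k" where
  "pim d = lext (carrier W) (\<lambda>w. unit_vec (elt w d))"

definition ogen :: "'k::comm_ring_1 \<Rightarrow> 'w \<Rightarrow> 'o \<Rightarrow> 'o \<Rightarrow> 'k" where
  "ogen q s \<sigma> = (if olen (act s \<sigma>) = olen \<sigma> then unit_vec \<sigma>
      else if olen (act s \<sigma>) = olen \<sigma> + 1 then unit_vec (act s \<sigma>)
      else (\<lambda>\<tau>. q * unit_vec (act s \<sigma>) \<tau> + (1 - q) * unit_vec \<sigma> \<tau>))"

definition oop :: "'k::comm_ring_1 \<Rightarrow> 'w \<Rightarrow> ('o \<Rightarrow> 'k) \<Rightarrow> 'o \<Rightarrow> 'k" where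
  "oop q s = lext Orb (ogen q s)"

lemma pim_linop: "linop (pim d)"
  unfolding pim_def by (rule linop_lext)

lemma pim_unit: "w \<in> carrier W \<Longrightarrow> pim d (unit_vec w) = unit_vec (elt w d)"
  unfolding pim_def by (rule lext_unit_vec[OF finite_carrier])

lemma pim_hgen:
  assumes "s \<in> S" "d \<in> D" "w \<in> carrier W"
  shows "pim d (hgen q s w) = ogen q s (elt w d)"
proof -
  obtain x k where x: "x \<in> DE" "k \<in> E" "w = x \<otimes> k" using min_reps_exists[OF K assms(3)] by blast
  have e: "elt w d = elt x d" using x elt_mult_E assms by simp
  have sw: "s \<otimes> w = (s \<otimes> x) \<otimes> k" "s \<otimes> w \<in> carrier W" using x assms by (simp_all add: m_assoc)
  have es: "elt (s \<otimes> w) d = elt (s \<otimes> x) d" using sw x elt_mult_E assms by simp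
  have p: "pim d (hgen q s w) = (if l w < l (s \<otimes> w) then unit_vec (elt (s \<otimes> w) d)
      else (\<lambda>\<tau>. q * unit_vec (elt (s \<otimes> w) d) \<tau> + (1 - q) * unit_vec (elt w d) \<tau>))"
    using sw(2) assms by (simp add: hgen_def linop_add[OF pim_linop] linop_scale[OF pim_linop] pim_unit)
  have a: "act s (elt w d) = elt (s \<otimes> x) d" using act_elt e x assms by simp
  consider "s \<otimes> x \<in> DE" | j where "j \<in> E" "s \<otimes> x = x \<otimes> j" using min_reps_left[OF K x(1) assms(1)] by blast
  then show ?thesis
  proof cases
    case 1
    \<comment> \<open>The factor k adds the same length on both sides, so s is an ascent of w
      exactly if it is one of x, and the latter is what \<open>olen\<close> sees.\<close>
    have len: "l (s \<otimes> w) = l (s \<otimes> x) + l k" "l w = l x + l k"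
      using min_reps_len[OF K 1 x(2)] min_reps_len[OF K x(1,2)] sw x by auto
    have "l (s \<otimes> x) \<noteq> l x" using len_neq assms x by simp
    moreover have "l (s \<otimes> x) \<le> Suc (l x)" using len_mult_S_le assms x by simp
    ultimately show ?thesis
      using olen_elt[OF 1 assms(2)] olen_elt[OF x(1) assms(2)] len
      unfolding p ogen_def a by (auto simp: e es)
  next
    case 2
    \<comment> \<open>Now s fixes the orbit element. Whether A_s A_w is A_{sw} or q A_{sw} + (1 - q)
      A_w, the image collapses to the same single basis vector.\<close>
    then have "elt (s \<otimes> x) d = elt x d" using elt_mult_E x assms by simp
    then show ?thesis unfolding p ogen_def a by (auto simp: e es algebra_simps)
  qed
qed

lemma pim_hop:
  assumes "s \<in> S" "d \<in> D" "supp f"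
  shows "pim d (hop q s f) = oop q s (pim d f)"
proof (rule linop_eqI[where X = "carrier W"])
  show "linop (\<lambda>f. pim d (hop q s f))" "linop (\<lambda>f. oop q s (pim d f))"
    unfolding oop_def by (rule linop_comp[OF pim_linop hop_linop] linop_comp[OF linop_lext pim_linop])+
  fix w assume "w \<in> carrier W"
  then show "pim d (hop q s (unit_vec w)) = oop q s (pim d (unit_vec w))"
    using assms by (simp add: hop_unit pim_hgen pim_unit oop_def lext_unit_vec)
qed (use assms finite_carrier in auto)

lemma pim_hword:
  assumes "set ss \<subseteq> S" "d \<in> D" "supp f"
  shows "pim d (hword q ss f) = foldr (oop q) ss (pim d f)"
  using assms(1) by (induction ss) (use assms in \<open>simp_all add: pim_hop hword_supp\<close>)

text \<open>The block of C_d on the coset t H, shifted into H: C_d is the sum over t in D of A_t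
  times \<open>tail t d\<close>. Its entries are the R_{tz,d}(0), so summing
  \<open>pim d (tail t d)\<close> over d gives the vector Y_t.\<close>

definition tail :: "'w \<Rightarrow> 'w \<Rightarrow> 'w \<Rightarrow> int" where
  "tail t d = (\<lambda>z. if z \<in> H then cw d (unit_vec \<one>) (t \<otimes> z) else 0)"

text \<open>The value at \<open>0\<close> of the \<open>R\<close>-polynomial of \<open>\<theta>\<close> and \<open>elt x t\<close>.\<close>

definition R0 :: "'o \<Rightarrow> 'w \<Rightarrow> 'w \<Rightarrow> int" where
  "R0 \<theta> x t = (\<Sum>d\<in>D. pim d (cw x (tail t d)) \<theta>)"

lemma H_lower: "w \<in> H \<Longrightarrow> u \<preceq> w \<Longrightarrow> u \<in> H"
  using parabolic_lower[OF J] by blast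

text \<open>Lengths add in y H, so each step between elements of H stays upward after multiplication
  by y, with its reflection conjugated by y.\<close>

lemma D_mult_mono:
  assumes "y \<in> D" "u \<preceq> w" "w \<in> H"
  shows "y \<otimes> u \<preceq> y \<otimes> w"
  using assms(2)
proof (induction rule: bruhat_converse_induct)
  case (step t v)
  have v: "t \<otimes> v \<in> H" "v \<in> H"
    using H_lower[OF assms(3) step(1)] H_lower[OF _ bruhat_step[OF step(2-4)]] by auto
  have "(y \<otimes> t \<otimes> inv y) \<otimes> (y \<otimes> v) = y \<otimes> (t \<otimes> v)" using step assms by (simp add: m_assoc)
  moreover have "l (y \<otimes> v) < l (y \<otimes> (t \<otimes> v))" using min_reps_len[OF J assms(1)] v step by simp
  ultimately have "y \<otimes> v \<preceq> y \<otimes> (t \<otimes> v)"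
    using bruhat_step[OF reflection_conj[OF step(2)], of y "y \<otimes> v"] assms step by simp
  then show ?case using step bruhat_trans by blast
qed simp

lemma DH_bij: "bij_betw (\<lambda>(v, z). v \<otimes> z) (D \<times> H) (carrier W)"
  unfolding bij_betw_def inj_on_def
  using min_reps_unique[OF J] min_reps_exists[OF J] by (auto simp: image_iff) metis

lemma tail_supp: "supported H (tail t d)"
  by (simp add: supported_def tail_def)

lemma supp_H: "supported H f \<Longrightarrow> supp f"
  unfolding supported_def using H_closed by blast

lemma hbar_supp_H:
  assumes "s \<in> J" "supported H f" shows "supported H (hbar (0::int) s f)"
  unfolding supported_def
proof (intro allI impI)
  fix x assume x: "x \<notin> H"
  have s: "s \<in> S" "s \<in> H" using assms J parabolic_gen[OF J] by auto
  show "hbar 0 s f x = 0"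
  proof (cases "x \<in> carrier W")
    case True
    have "s \<otimes> x \<notin> H" using x H_group(1)[OF s(2), of "s \<otimes> x"] s True by auto
    then show ?thesis using True x s assms(2) by (simp add: hbar_zero_apply supported_def)
  next
    case False
    then show ?thesis using hbar_supp[OF s(1) supp_H[OF assms(2)], of 0] by (simp add: supported_def)
  qed
qed

lemma cw_supp_H:
  assumes "w \<in> H" "supported H f" shows "supported H (cw w f)"
  using assms
proof (induction arbitrary: f rule: parabolic_induct[OF J, consumes 1, case_names one mult])
  case (mult s u)
  then have s: "s \<in> S" using J by auto
  have "cw (u \<otimes> s) f = cw u (hbar 0 s f)"
    using cw_mult[of u s f] cw_S[OF s] mult s supp_H[OF mult(5)] by simp
  then show ?case using mult hbar_supp_H by simp
qed simp

text \<open>For z in H, \<open>s z = z (z^-1 s z)\<close> with the last factor in E by normality.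
  Hence A_s acts as the identity on images of functions supported in H, and C_s = A_s - 1 kills
  them.\<close>

lemma pim_hbar_E:
  assumes "s \<in> K" "d \<in> D" "supported H f"
  shows "pim d (hbar (0::int) s f) = (\<lambda>\<theta>. 0)"
proof -
  have s: "s \<in> S" "s \<in> E" using assms K parabolic_gen[OF K] by auto
  have "pim d (hop 0 s f) = pim d f"
  proof (rule linop_eqI[where X = H])
    show "linop (\<lambda>f. pim d (hop (0::int) s f))" "linop (pim d)"
      by (rule linop_comp[OF pim_linop hop_linop] pim_linop)+
    fix z assume z: "z \<in> H"
    have "inv z \<otimes> s \<otimes> z \<in> E" using E_normal[OF z s(2)] .
    moreover have "s \<otimes> z = z \<otimes> (inv z \<otimes> s \<otimes> z)" using z s by (simp add: m_assoc)
    ultimately have "elt (s \<otimes> z) d = elt z d" using elt_mult_E[of z d] z assms by (metis D_closed H_closed)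
    then show "pim d (hop 0 s (unit_vec z)) = pim d (unit_vec z)"
      using z s by (simp add: hop_unit hgen_def pim_unit)
  qed (use assms in auto)
  then show ?thesis unfolding hbar_def by (simp add: linop_diff[OF pim_linop])
qed

lemma pim_zero_hbar:
  assumes "s \<in> S" "d \<in> D" "supp f" "pim d f = (\<lambda>\<theta>. 0)"
  shows "pim d (hbar (0::int) s f) = (\<lambda>\<theta>. 0)"
  unfolding hbar_def using assms pim_hop[OF assms(1-3), of 0] linop_zero[of "oop 0 s"]
  by (simp add: linop_diff[OF pim_linop] oop_def linop_lext)

text \<open>Outside \<open>DE\<close>, u has a reduced word ending in a letter of K, and that last
  factor already annihilates. This cuts sums over W down to standard forms.\<close>

lemma pim_cw_zero:
  assumes "u \<in> carrier W" "u \<notin> DE" "d \<in> D" "supported H f"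
  shows "pim d (cw u f) = (\<lambda>\<theta>. 0)"
proof -
  obtain x k where x: "x \<in> DE" "k \<in> E" "u = x \<otimes> k" using min_reps_exists[OF K assms(1)] by blast
  have "k \<noteq> \<one>" using x assms by auto
  obtain k' j where k: "k' \<in> E" "j \<in> K" "k = k' \<otimes> j" "l k = Suc (l k')"
    using x(2) \<open>k \<noteq> \<one>\<close> by (induction rule: parabolic_induct[OF K, consumes 1, case_names one mult]) auto
  have j: "j \<in> S" "j \<in> E" using k K parabolic_gen[OF K] by auto
  define v where "v = x \<otimes> k'"
  have v: "v \<in> carrier W" "u = v \<otimes> j" "l u = l v + l j"
    using x k j min_reps_len[OF K x(1)] by (simp_all add: v_def m_assoc)
  have "cw u f = cw v (hbar 0 j f)"
    using cw_mult[OF v(1), of j f] v j supp_H[OF assms(4)] by (simp add: cw_S)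
  moreover have "pim d (hbword 0 ss g) = (\<lambda>\<theta>. 0)"
    if "set ss \<subseteq> S" "supp g" "pim d g = (\<lambda>\<theta>. 0)" for ss and g :: "'w \<Rightarrow> int"
    using that(1) by (induction ss) (use that assms in \<open>simp_all add: pim_zero_hbar hbword_supp\<close>)
  ultimately show ?thesis
    using pim_hbar_E[OF k(2) assms(3,4)] reduced_word(1)[OF v(1)] hbar_supp[OF j(1) supp_H[OF assms(4)]]
    unfolding cw_def by simp
qed

abbreviation below :: "'w \<Rightarrow> 'w \<Rightarrow> 'w set" where "below y v \<equiv> {w \<in> H. y \<otimes> w \<preceq> v}"

lemma sum_below:
  fixes F :: "'w \<Rightarrow> int"
  assumes "v \<in> carrier W"
  shows "(\<Sum>u\<in>{u. u \<preceq> v}. F u) = (\<Sum>y\<in>D. \<Sum>w\<in>below y v. F (y \<otimes> w))"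
proof -
  have sub: "{u. u \<preceq> v} = {u \<in> carrier W. u \<preceq> v}" using bruhat_closed assms by blast
  have "(\<Sum>u\<in>{u. u \<preceq> v}. F u) = (\<Sum>u\<in>carrier W. if u \<preceq> v then F u else 0)"
    unfolding sub using finite_carrier by (simp add: sum.inter_filter)
  also have "\<dots> = (\<Sum>(y, w)\<in>D \<times> H. if y \<otimes> w \<preceq> v then F (y \<otimes> w) else 0)"
    using sum.reindex_bij_betw[OF DH_bij, of "\<lambda>u. if u \<preceq> v then F u else 0"]
    by (simp add: case_prod_unfold cong: if_cong)
  also have "\<dots> = (\<Sum>y\<in>D. \<Sum>w\<in>H. if y \<otimes> w \<preceq> v then F (y \<otimes> w) else 0)"
    by (simp add: sum.cartesian_product)
  finally show ?thesis by (simp add: sum.inter_filter)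
qed

text \<open>With \<open>A\<^sub>d = \<Sum>\<^sub>v C\<^sub>v F(v, d)\<close> and \<open>C\<^sub>d = \<Sum>\<^sub>y A\<^sub>y G(y, d)\<close> for \<open>d \<in> D\<close>, where \<open>F\<close> and \<open>G\<close> have
  entries in the algebra of \<open>H\<close>, freeness over that algebra forces \<open>F G = 1\<close>.\<close>

lemma tail_inversion:
  assumes "y \<in> D" "d \<in> D"
  shows "(\<lambda>x. \<Sum>v\<in>D. \<Sum>w\<in>below y v. cw w (tail v d) x) = (if y = d then unit_vec \<one> else (\<lambda>x. 0))"
proof -
  define X where "X y = (\<lambda>x. \<Sum>v\<in>D. \<Sum>w\<in>below y v. cw w (tail v d) x)" for y
  have one: "supp (unit_vec \<one> :: 'w \<Rightarrow> int)" by (simp add: unit_vec_supported)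
  have dc: "d \<in> carrier W" using assms by simp
  have tail: "supp (tail v d)" for v using supp_H tail_supp by blast
  let ?c = "cw d (unit_vec \<one>)"
  have c_tail: "?c = (\<lambda>x. \<Sum>v\<in>D. aw v (tail v d) x)"
  proof -
    have "tail v d = (\<lambda>x. \<Sum>z\<in>H. ?c (v \<otimes> z) * unit_vec z x)" for v
      using supported_expand[OF tail_supp finite_D(3), of v d] by (simp add: tail_def)
    then have a: "aw v (tail v d) = (\<lambda>x. \<Sum>z\<in>H. ?c (v \<otimes> z) * unit_vec (v \<otimes> z) x)" if "v \<in> D" for v
      using that by (simp add: linop_sum[OF aw_linop] linop_scale[OF aw_linop] aw_unit min_reps_len[OF J])
    show ?thesis
    proof
      fix x
      have "?c x = (\<Sum>u\<in>carrier W. ?c u * unit_vec u x)"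
        using supported_expand[OF cw_supp[OF dc one] finite_carrier] by meson
      also have "\<dots> = (\<Sum>(v, z)\<in>D \<times> H. ?c (v \<otimes> z) * unit_vec (v \<otimes> z) x)"
        using sum.reindex_bij_betw[OF DH_bij, of "\<lambda>u. ?c u * unit_vec u x"] by (simp add: case_prod_unfold)
      also have "\<dots> = (\<Sum>v\<in>D. aw v (tail v d) x)" by (simp add: a sum.cartesian_product)
      finally show "?c x = (\<Sum>v\<in>D. aw v (tail v d) x)" .
    qed
  qed
  \<comment> \<open>Each A_v is replaced by the sum of the C_u over u below v, and u is factored as
    y w. As C_{yw} = C_y C_w, collecting by y leaves the factor \<open>X y\<close>.\<close>
  have c_X: "?c x = (\<Sum>y\<in>D. cw y (X y) x)" for x
  proof -
    have "aw v (tail v d) x = (\<Sum>y\<in>D. \<Sum>w\<in>below y v. cw y (cw w (tail v d)) x)" if "v \<in> D" for v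
      using that aw_sum[of v "tail v d"] tail[of v] sum_below[of v "\<lambda>u. cw u (tail v d) x"]
      by (simp add: cw_mult min_reps_len[OF J])
    then have "?c x = (\<Sum>v\<in>D. \<Sum>y\<in>D. \<Sum>w\<in>below y v. cw y (cw w (tail v d)) x)"
      unfolding c_tail by simp
    also have "\<dots> = (\<Sum>y\<in>D. \<Sum>v\<in>D. \<Sum>w\<in>below y v. cw y (cw w (tail v d)) x)" by (rule sum.swap)
    finally show ?thesis by (simp add: X_def linop_sum[OF cw_linop])
  qed
  have "\<exists>a. X y = (\<lambda>x. \<Sum>z\<in>H. a z * cw z (unit_vec \<one>) x)" for y
  proof -
    have "supported H (X y)"
      using cw_supp_H[OF _ tail_supp] unfolding X_def supported_def by (auto intro!: sum.neutral)
    then show ?thesis using cw_unit_span[of H "X y"] H_lower by (metis H_closed subsetI)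
  qed
  then obtain a where a: "\<And>y. X y = (\<lambda>x. \<Sum>z\<in>H. a y z * cw z (unit_vec \<one>) x)" by metis
  have cy: "cw y (X y) x = (\<Sum>z\<in>H. a y z * cw (y \<otimes> z) (unit_vec \<one>) x)" if "y \<in> D" for y x
    unfolding a using that one
    by (simp add: linop_sum[OF cw_linop] linop_scale[OF cw_linop] cw_mult min_reps_len[OF J])
  \<comment> \<open>The C_{yz} with y in D and z in H are linearly independent. Comparing the
    expansion just found with C_d itself forces the coefficients of \<open>X\<close> to be a single
    1 at (d, 1).\<close>
  define b where "b = (\<lambda>(y, z). a y z - (if y = d \<and> z = \<one> then 1 else 0))"
  have "b (y, z) = 0" if "y \<in> D" "z \<in> H" for y z
  proof (rule cw_unit_independent[where I = "D \<times> H" and g = "\<lambda>(y, z). y \<otimes> z"])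
    fix x
    have "(\<Sum>i\<in>D \<times> H. b i * cw (case i of (y, z) \<Rightarrow> y \<otimes> z) (unit_vec \<one>) x)
      = (\<Sum>y\<in>D. \<Sum>z\<in>H. b (y, z) * cw (y \<otimes> z) (unit_vec \<one>) x)"
      by (simp add: sum.cartesian_product case_prod_unfold)
    also have "\<dots> = (\<Sum>y\<in>D. \<Sum>z\<in>H. a y z * cw (y \<otimes> z) (unit_vec \<one>) x)
        - (\<Sum>y\<in>D. \<Sum>z\<in>H. if y = d \<and> z = \<one> then cw (y \<otimes> z) (unit_vec \<one>) x else 0)"
      unfolding sum_subtractf[symmetric] by (intro sum.cong refl) (simp add: b_def algebra_simps)
    also have "(\<Sum>y\<in>D. \<Sum>z\<in>H. if y = d \<and> z = \<one> then cw (y \<otimes> z) (unit_vec \<one>) x else 0)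
        = (\<Sum>y\<in>D. if y = d then (\<Sum>z\<in>H. if z = \<one> then cw (y \<otimes> z) (unit_vec \<one>) x else 0) else 0)"
      by (intro sum.cong refl) simp
    also have "\<dots> = ?c x" using assms H_group(2) by simp
    also have "(\<Sum>y\<in>D. \<Sum>z\<in>H. a y z * cw (y \<otimes> z) (unit_vec \<one>) x) = ?c x"
      using cy c_X[of x] by simp
    finally show "(\<Sum>i\<in>D \<times> H. b i * cw (case i of (y, z) \<Rightarrow> y \<otimes> z) (unit_vec \<one>) x) = 0" by simp
  qed (use that DH_bij in \<open>auto simp: bij_betw_def\<close>)
  then have "a y z = (if y = d \<and> z = \<one> then 1 else 0)" if "z \<in> H" for z
    using that assms by (force simp: b_def)
  then have "X y = (\<lambda>x. \<Sum>z\<in>H. if z = \<one> then (if y = d then unit_vec \<one> x else 0) else 0)"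
    unfolding a by (intro ext sum.cong) auto
  also have "\<dots> = (if y = d then unit_vec \<one> else (\<lambda>x. 0))" using H_group(2) by auto
  finally show ?thesis by (simp add: X_def)
qed

definition std_le :: "'w \<times> 'w \<Rightarrow> 'w \<times> 'w \<Rightarrow> bool" where
  "std_le = (\<lambda>(u, v) (x, y). \<exists>w\<in>H. u \<preceq> x \<otimes> w \<and> y \<otimes> w \<preceq> v)"

text \<open>For fixed v, the u in \<open>DE\<close> with (u, v) below (x, y) are the indices in
  \<open>DE\<close> that A_x produces from the sum of the C_w over \<open>below y v\<close>.
  \<open>tail_inversion\<close> then collapses the sum over v and leaves A_x applied to the basis
  vector of e y^-1.\<close>

lemma R0_sum:
  assumes "x \<in> DE" "y \<in> D"
  shows "(\<Sum>(u, v)\<in>{\<tau> \<in> DE \<times> D. std_le \<tau> (x, y)}. R0 \<theta> u v) = (if \<theta> = elt x y then 1 else 0)"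
proof -
  define Kx where "Kx v = {u. \<exists>w\<in>below y v. u \<preceq> x \<otimes> w}" for v
  have tail: "supp (tail v d)" for v d using supp_H tail_supp by blast
  have xc: "x \<in> carrier W" using assms by simp
  have Kx: "Kx v \<subseteq> carrier W" for v using bruhat_closed xc by (auto simp: Kx_def)
  have finK: "finite (Kx v)" for v using Kx finite_carrier finite_subset by blast
  have low: "below y v \<subseteq> carrier W" "\<And>u w. w \<in> below y v \<Longrightarrow> u \<preceq> w \<Longrightarrow> u \<in> below y v" for v
    using H_lower D_mult_mono[OF assms(2)] bruhat_trans by (simp_all add: subset_iff) blast
  have "{\<tau> \<in> DE \<times> D. std_le \<tau> (x, y)} = (\<lambda>(v, u). (u, v)) ` (SIGMA v:D. DE \<inter> Kx v)"
    by (auto simp: std_le_def Kx_def image_iff)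
  then have "(\<Sum>(u, v)\<in>{\<tau> \<in> DE \<times> D. std_le \<tau> (x, y)}. R0 \<theta> u v) = (\<Sum>v\<in>D. \<Sum>u\<in>DE \<inter> Kx v. R0 \<theta> u v)"
    by (simp add: sum.reindex inj_on_def case_prod_unfold sum.Sigma)
  \<comment> \<open>The u outside \<open>DE\<close> contribute 0; including them makes the index set
    the one of \<open>aw_lower_sum\<close>.\<close>
  also have "\<dots> = (\<Sum>v\<in>D. \<Sum>u\<in>Kx v. R0 \<theta> u v)"
  proof (rule sum.cong[OF refl])
    fix v
    have "R0 \<theta> u v = 0" if "u \<in> Kx v - DE \<inter> Kx v" for u
    proof -
      have "u \<notin> DE" "u \<in> carrier W" using that Kx by blast+
      then have "pim d (cw u (tail v d)) \<theta> = 0" if "d \<in> D" for d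
        using pim_cw_zero[OF _ _ that tail_supp, of u v d] by simp
      then show ?thesis by (simp add: R0_def)
    qed
    then show "(\<Sum>u\<in>DE \<inter> Kx v. R0 \<theta> u v) = (\<Sum>u\<in>Kx v. R0 \<theta> u v)"
      by (intro sum.mono_neutral_left finK) auto
  qed
  also have "\<dots> = (\<Sum>v\<in>D. \<Sum>d\<in>D. \<Sum>u\<in>Kx v. pim d (cw u (tail v d)) \<theta>)"
    unfolding R0_def by (intro sum.cong refl sum.swap)
  also have "\<dots> = (\<Sum>d\<in>D. \<Sum>v\<in>D. \<Sum>u\<in>Kx v. pim d (cw u (tail v d)) \<theta>)"
    by (rule sum.swap)
  also have "\<dots> = (\<Sum>d\<in>D. pim d (aw x (\<lambda>z. \<Sum>v\<in>D. \<Sum>w\<in>below y v. cw w (tail v d) z)) \<theta>)"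
  proof (intro sum.cong refl)
    fix d assume "d \<in> D"
    have "aw x (\<lambda>z. \<Sum>w\<in>below y v. cw w (tail v d) z) = (\<lambda>z. \<Sum>u\<in>Kx v. cw u (tail v d) z)" for v
      unfolding Kx_def by (rule aw_lower_sum[OF low tail xc])
    then show "(\<Sum>v\<in>D. \<Sum>u\<in>Kx v. pim d (cw u (tail v d)) \<theta>)
        = pim d (aw x (\<lambda>z. \<Sum>v\<in>D. \<Sum>w\<in>below y v. cw w (tail v d) z)) \<theta>"
      by (subst linop_sum[OF aw_linop]) (simp add: linop_sum[OF pim_linop])
  qed
  also have "\<dots> = (\<Sum>d\<in>D. if d = y then unit_vec (elt x y) \<theta> else 0)"
  proof (intro sum.cong refl)
    fix d assume d: "d \<in> D"
    have "aw x (unit_vec \<one>) = unit_vec x" using aw_unit[of x \<one>] xc by simp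
    then show "pim d (aw x (\<lambda>z. \<Sum>v\<in>D. \<Sum>w\<in>below y v. cw w (tail v d) z)) \<theta> = (if d = y then unit_vec (elt x y) \<theta> else 0)"
      unfolding tail_inversion[OF assms(2) d]
      using xc by (auto simp: linop_zero[OF aw_linop] linop_zero[OF pim_linop] pim_unit)
  qed
  finally show ?thesis using assms by (simp add: unit_vec_def)
qed

section \<open>The Bruhat-Chevalley order is a partial order\<close>

lemma std_le_refl: "std_le (x, y) (x, y)" if "x \<in> DE" "y \<in> D"
  using that H_group(2) by (auto simp: std_le_def intro!: bexI[of _ \<one>])

text \<open>Going around once gives l y + l w \<le> l v and l v + l w' \<le> l y, which squeezes
  both witnesses to length 0.\<close>

lemma std_le_antisym:
  assumes "\<sigma> \<in> DE \<times> D" "\<tau> \<in> DE \<times> D" "std_le \<sigma> \<tau>" "std_le \<tau> \<sigma>"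
  shows "\<sigma> = \<tau>"
proof -
  obtain u v x y where uv: "\<sigma> = (u, v)" "\<tau> = (x, y)" "u \<in> DE" "v \<in> D" "x \<in> DE" "y \<in> D"
    using assms(1,2) by auto
  obtain w w' where w: "w \<in> H" "u \<preceq> x \<otimes> w" "y \<otimes> w \<preceq> v" and w': "w' \<in> H" "x \<preceq> u \<otimes> w'" "v \<otimes> w' \<preceq> y"
    using assms(3,4) uv by (auto simp: std_le_def)
  have "l y + l w \<le> l v" "l v + l w' \<le> l y"
    using bruhat_len_le[OF w(3)] bruhat_len_le[OF w'(3)] min_reps_len[OF J] w w' uv by simp_all
  then have "l w = 0" "l w' = 0" "l y = l v" by auto
  then have "w = \<one>" "w' = \<one>" using len_eq_0 w w' by auto
  then show ?thesis using bruhat_antisym[of u x] bruhat_len[of y v] \<open>l y = l v\<close> w w' uv by simp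
qed

lemma std_le_trans:
  assumes "\<rho> \<in> DE \<times> D" "\<sigma> \<in> DE \<times> D" "\<tau> \<in> DE \<times> D" "std_le \<rho> \<sigma>" "std_le \<sigma> \<tau>"
  shows "std_le \<rho> \<tau>"
proof -
  obtain u v x y x' y' where uv: "\<rho> = (u, v)" "\<sigma> = (x, y)" "\<tau> = (x', y')" "u \<in> DE" "v \<in> D"
      "x \<in> DE" "y \<in> D" "x' \<in> DE" "y' \<in> D"
    using assms(1-3) by auto
  obtain w w' where w: "w \<in> H" "u \<preceq> x \<otimes> w" "y \<otimes> w \<preceq> v" and w': "w' \<in> H" "x \<preceq> x' \<otimes> w'" "y' \<otimes> w' \<preceq> y"
    using assms(4,5) uv by (auto simp: std_le_def)
  \<comment> \<open>The witness w has to be carried through the upper comparison, letter by letter.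
    Each letter s is dropped from or appended to the new witness according to the alternative in
    \<open>lift_right1\<close>; y k s lies above y k because lengths add in y H.\<close>
  have "\<exists>w''\<in>H. x \<otimes> w \<preceq> x' \<otimes> w'' \<and> y' \<otimes> w'' \<preceq> y \<otimes> w"
    using w(1)
  proof (induction rule: parabolic_induct[OF J, consumes 1, case_names one mult])
    case one
    then show ?case using w' uv by auto
  next
    case (mult s k)
    then obtain k' where k': "k' \<in> H" "x \<otimes> k \<preceq> x' \<otimes> k'" "y' \<otimes> k' \<preceq> y \<otimes> k" by blast
    have s: "s \<in> S" "s \<in> H" using mult J parabolic_gen[OF J] by auto
    have up: "y \<otimes> k \<preceq> y \<otimes> k \<otimes> s"
      using up_right[of s "y \<otimes> k"] min_reps_len[OF J, of y] H_group(1)[of k s] mult s uv by (simp add: m_assoc)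
    have "x \<otimes> k \<otimes> s \<preceq> x' \<otimes> k' \<or> x \<otimes> k \<otimes> s \<preceq> x' \<otimes> k' \<otimes> s"
      using lift_right1[OF k'(2) _ s(1)] uv mult by simp
    then show ?case
    proof
      assume "x \<otimes> k \<otimes> s \<preceq> x' \<otimes> k'"
      then show ?thesis using k' up bruhat_trans uv mult s by (intro bexI[of _ k']) (auto simp: m_assoc)
    next
      assume *: "x \<otimes> k \<otimes> s \<preceq> x' \<otimes> k' \<otimes> s"
      have "y' \<otimes> k' \<otimes> s \<preceq> y \<otimes> k \<otimes> s"
        using lift_right1[OF k'(3) _ s(1)] up bruhat_trans uv k' by auto
      then show ?thesis using * k' uv mult s H_group(1)
        by (intro bexI[of _ "k' \<otimes> s"]) (auto simp: m_assoc)
    qed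
  qed
  then show ?thesis using w bruhat_trans uv by (fastforce simp: std_le_def)
qed

end

section \<open>Moebius inversion\<close>

text \<open>\<open>R\<close> is a row of the inverse of the zeta matrix and is determined by
  recursion along the order. Its vanishing at s not above a comes out of the same recursion, as then
  no t below s is above a.\<close>

lemma moebius_unique:
  fixes R :: "'b \<Rightarrow> int"
  assumes "finite X" and refl: "\<And>a. a \<in> X \<Longrightarrow> leq a a"
    and antisym: "\<And>a b. a \<in> X \<Longrightarrow> b \<in> X \<Longrightarrow> leq a b \<Longrightarrow> leq b a \<Longrightarrow> a = b"
    and trans: "\<And>a b c. a \<in> X \<Longrightarrow> b \<in> X \<Longrightarrow> c \<in> X \<Longrightarrow> leq a b \<Longrightarrow> leq b c \<Longrightarrow> leq a c"
    and "a \<in> X"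
    and R: "\<And>s. s \<in> X \<Longrightarrow> (\<Sum>t\<in>{t \<in> X. leq t s}. R t) = (if a = s then 1 else 0)"
    and "s \<in> X"
  shows "moebius X leq a s = R s"
proof -
  define r where "r = {(t, s). t \<in> X \<and> s \<in> X \<and> leq t s \<and> t \<noteq> s}"
  \<comment> \<open>The size of the ideal below s serves as a rank, which makes the recursion in
    \<open>moebius\<close> well founded.\<close>
  have "r \<subseteq> measure (\<lambda>s. card {t \<in> X. leq t s})"
  proof clarify
    fix t s assume "(t, s) \<in> r"
    then have "t \<in> X" "s \<in> X" "leq t s" "t \<noteq> s" by (auto simp: r_def)
    then have "{u \<in> X. leq u t} \<subset> {u \<in> X. leq u s}" using trans antisym refl by blast
    then show "(t, s) \<in> measure (\<lambda>s. card {t \<in> X. leq t s})" using assms(1) by (simp add: psubset_card_mono)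
  qed
  then have wf: "wf r" using wf_subset wf_measure by blast
  have rec: "moebius X leq a s = (if s = a then 1
              else if leq a s then - (\<Sum>t\<in>{t \<in> X. leq a t \<and> leq t s \<and> t \<noteq> s}. moebius X leq a t) else 0)"
    if "s \<in> X" for s
  proof -
    show ?thesis
      unfolding moebius_def r_def[symmetric]
      by (subst wfrec[OF wf]) (use that in \<open>auto simp: cut_def r_def intro!: sum.cong\<close>)
  qed
  from wf \<open>s \<in> X\<close> show ?thesis
  proof (induction s rule: wf_induct_rule)
    case (less s)
    let ?T = "{t \<in> X. leq t s \<and> t \<noteq> s}"
    have IH: "moebius X leq a t = R t" if "t \<in> ?T" for t using less that by (auto simp: r_def)
    have "{t \<in> X. leq t s} = insert s ?T" using refl less by auto
    then have "R s + (\<Sum>t\<in>?T. R t) = (if a = s then 1 else 0)" using R[of s] less assms(1) by simp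
    then have Rs: "R s = (if a = s then 1 else 0) - (\<Sum>t\<in>?T. moebius X leq a t)" using IH by simp
    have z: "moebius X leq a t = 0" if "t \<in> ?T" "\<not> leq a t" for t
      using rec[of t] that refl \<open>a \<in> X\<close> by auto
    show ?case
    proof (cases "leq a s \<and> a \<noteq> s")
      case True
      have "(\<Sum>t\<in>?T. moebius X leq a t) = (\<Sum>t\<in>{t \<in> X. leq a t \<and> leq t s \<and> t \<noteq> s}. moebius X leq a t)"
        using z assms(1) by (intro sum.mono_neutral_right) auto
      then show ?thesis using Rs rec[of s] True less by auto
    next
      case False
      have "\<not> leq a t" if "t \<in> ?T" for t
        using that False trans[of a t s] antisym[of a t] less \<open>a \<in> X\<close> by auto
      then have "(\<Sum>t\<in>?T. moebius X leq a t) = 0" using z by (intro sum.neutral) blast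
      then show ?thesis using Rs rec[of s] False less by auto
    qed
  qed
qed

section \<open>The Weyl group of a BN-pair\<close>

locale finite_BN_pair = BN_pair +
  assumes finite_G: "finite (carrier G)"
begin

abbreviation "T \<equiv> torus B N"
abbreviation "W \<equiv> weyl G B N"

lemmas B_closed [simp] = subgroup.mem_carrier[OF subgroup_B]
  and N_closed [simp] = subgroup.mem_carrier[OF subgroup_N]

lemmas B_group [simp] = subgroup.m_closed[OF subgroup_B] subgroup.m_inv_closed[OF subgroup_B]
  subgroup.one_closed[OF subgroup_B]
lemmas N_group = subgroup.m_closed[OF subgroup_N] subgroup.m_inv_closed[OF subgroup_N]
  subgroup.one_closed[OF subgroup_N]

lemma T_B: "t \<in> T \<Longrightarrow> t \<in> B" and T_N: "t \<in> T \<Longrightarrow> t \<in> N"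
  and T_I: "t \<in> B \<Longrightarrow> t \<in> N \<Longrightarrow> t \<in> T"
  by (auto simp: torus_def)

lemma T_closed [simp]: "t \<in> T \<Longrightarrow> t \<in> carrier G"
  using T_B by simp

lemma T_group: "t \<in> T \<Longrightarrow> t' \<in> T \<Longrightarrow> t \<otimes> t' \<in> T" "t \<in> T \<Longrightarrow> inv t \<in> T" "\<one> \<in> T"
  by (auto simp: torus_def intro: N_group)

lemma T_conj:
  assumes "t \<in> T" "n \<in> N"
  shows "n \<otimes> t \<otimes> inv n \<in> T" "inv n \<otimes> t \<otimes> n \<in> T"
proof -
  interpret N: group "G\<lparr>carrier := N\<rparr>" using subgroup.subgroup_is_group[OF subgroup_N] by blast
  have i: "inv\<^bsub>G\<lparr>carrier := N\<rparr>\<^esub> n = inv n" if "n \<in> N" for n using m_inv_consistent[OF subgroup_N that] .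
  have *: "n \<otimes> t \<otimes> inv n \<in> T" if "n \<in> N" for n
    using normal.inv_op_closed2[OF torus_normal, of n t] that assms i by simp
  show "n \<otimes> t \<otimes> inv n \<in> T" using *[OF assms(2)] .
  show "inv n \<otimes> t \<otimes> n \<in> T" using *[of "inv n"] assms N_group by simp
qed

lemma weyl_group: "group W"
  unfolding weyl_def by (rule normal.factorgroup_is_group[OF torus_normal])

lemma weyl_mult_eq: "x \<otimes>\<^bsub>W\<^esub> y = x <#> y" and weyl_one: "\<one>\<^bsub>W\<^esub> = T"
  by (simp_all add: weyl_def FactGroup_def)

lemma weyl_carrier: "w \<in> carrier W \<longleftrightarrow> (\<exists>n\<in>N. w = T #> n)"
  by (auto simp: weyl_def carrier_FactGroup)

lemma weyl_classI:
  assumes "n \<in> N" shows "T #> n \<in> carrier W" "n \<in> T #> n"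
proof -
  show "T #> n \<in> carrier W" using assms by (auto simp: weyl_carrier)
  have "\<one> \<otimes> n \<in> T #> n" unfolding r_coset_def using T_group(3) by blast
  then show "n \<in> T #> n" using assms by simp
qed

lemma weyl_nonempty: "w \<in> carrier W \<Longrightarrow> \<exists>n. n \<in> w"
  using weyl_classI(2) by (auto simp: weyl_carrier)

lemma weyl_N: "w \<in> carrier W \<Longrightarrow> n \<in> w \<Longrightarrow> n \<in> N"
  by (auto simp: weyl_carrier r_coset_def T_N N_group)

lemma weyl_closed: "w \<in> carrier W \<Longrightarrow> n \<in> w \<Longrightarrow> n \<in> carrier G"
  using weyl_N N_closed by blast

lemma weyl_left: "w \<in> carrier W \<Longrightarrow> n \<in> w \<Longrightarrow> t \<in> T \<Longrightarrow> t \<otimes> n \<in> w"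
proof -
  assume "w \<in> carrier W" "n \<in> w" and t: "t \<in> T"
  then obtain k t' where k: "k \<in> N" "w = T #> k" "t' \<in> T" "n = t' \<otimes> k"
    by (auto simp: weyl_carrier r_coset_def)
  then have "t \<otimes> n = (t \<otimes> t') \<otimes> k" "t \<otimes> t' \<in> T" using t T_group by (simp_all add: m_assoc)
  then show "t \<otimes> n \<in> w" using k by (auto simp: r_coset_def)
qed

lemma weyl_eq_left:
  assumes "w \<in> carrier W" "n \<in> w" "m \<in> w"
  shows "m \<otimes> inv n \<in> T"
proof -
  obtain k t t' where k: "k \<in> N" "t \<in> T" "t' \<in> T" "n = t \<otimes> k" "m = t' \<otimes> k"
    using assms by (auto simp: weyl_carrier r_coset_def)
  then have "m \<otimes> inv n = t' \<otimes> inv t" by (simp add: inv_mult_group m_assoc)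
  then show ?thesis using k T_group by simp
qed

lemma weyl_eq_right:
  assumes "w \<in> carrier W" "n \<in> w" "m \<in> w"
  shows "inv n \<otimes> m \<in> T"
proof -
  have c: "n \<in> N" "m \<in> carrier G" using assms weyl_N weyl_closed by auto
  have "inv n \<otimes> (m \<otimes> inv n) \<otimes> n \<in> T" using T_conj(2)[OF weyl_eq_left[OF assms] c(1)] .
  then show ?thesis using c by (simp add: m_assoc)
qed

lemma weyl_right:
  assumes "w \<in> carrier W" "n \<in> w" "t \<in> T"
  shows "n \<otimes> t \<in> w"
proof -
  have "n \<otimes> t \<otimes> inv n \<in> T" using T_conj(1) assms weyl_N by blast
  then have "n \<otimes> t \<otimes> inv n \<otimes> n \<in> w" using weyl_left assms by blast
  then show ?thesis using assms weyl_closed by simp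
qed

lemma weyl_inter:
  assumes "w \<in> carrier W" "w' \<in> carrier W" "n \<in> w" "n \<in> w'"
  shows "w = w'"
proof -
  have "w \<subseteq> w'" if "w \<in> carrier W" "w' \<in> carrier W" "n \<in> w" "n \<in> w'" for w w'
  proof
    fix m assume m: "m \<in> w"
    have "(m \<otimes> inv n) \<otimes> n \<in> w'" using weyl_left weyl_eq_left[OF that(1,3) m] that by blast
    then show "m \<in> w'" using weyl_closed that m by simp
  qed
  then show ?thesis using assms by blast
qed

lemma weyl_mult: "n \<in> x \<Longrightarrow> m \<in> y \<Longrightarrow> n \<otimes> m \<in> x \<otimes>\<^bsub>W\<^esub> y"
  by (auto simp: weyl_mult_eq set_mult_def)

lemma weyl_inv:
  assumes "w \<in> carrier W" "n \<in> w"
  shows "inv n \<in> inv\<^bsub>W\<^esub> w"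
proof -
  interpret W: group W by (rule weyl_group)
  obtain m where m: "m \<in> inv\<^bsub>W\<^esub> w" using weyl_nonempty assms by blast
  have "n \<otimes> m \<in> T" using weyl_mult[OF assms(2) m] assms by (simp add: weyl_one)
  then have "m \<otimes> inv (n \<otimes> m) \<in> inv\<^bsub>W\<^esub> w" using weyl_right[OF _ m] assms T_group by simp
  moreover have "m \<in> carrier G" "n \<in> carrier G" using weyl_closed m assms by auto
  ultimately show ?thesis by (simp add: inv_mult_group)
qed

section \<open>Double cosets of B and the exchange condition\<close>

definition cell :: "'a set \<Rightarrow> 'a set" where "cell w = B <#> w <#> B"

lemma cellI: "b \<in> B \<Longrightarrow> n \<in> w \<Longrightarrow> b' \<in> B \<Longrightarrow> b \<otimes> n \<otimes> b' \<in> cell w"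
  by (auto simp: cell_def set_mult_def)

lemma cellE:
  assumes "g \<in> cell w" obtains b n b' where "b \<in> B" "n \<in> w" "b' \<in> B" "g = b \<otimes> n \<otimes> b'"
  using assms by (auto simp: cell_def set_mult_def)

text \<open>Elements of the coset w differ by elements of T, which B absorbs; so one representative
  serves the whole double coset.\<close>

lemma cell_rep:
  assumes "w \<in> carrier W" "n \<in> w" "g \<in> cell w"
  obtains b b' where "b \<in> B" "b' \<in> B" "g = b \<otimes> n \<otimes> b'"
proof -
  obtain b m b' where *: "b \<in> B" "m \<in> w" "b' \<in> B" "g = b \<otimes> m \<otimes> b'" using assms cellE by blast
  have c: "m \<in> carrier G" "n \<in> carrier G" using * assms weyl_closed by auto
  have "g = (b \<otimes> (m \<otimes> inv n)) \<otimes> n \<otimes> b'" using * c by (simp add: m_assoc)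
  moreover have "b \<otimes> (m \<otimes> inv n) \<in> B" using * T_B weyl_eq_left[OF assms(1,2) *(2)] by simp
  ultimately show ?thesis using that * by blast
qed

lemma cell_closed: "w \<in> carrier W \<Longrightarrow> g \<in> cell w \<Longrightarrow> g \<in> carrier G"
  by (auto elim!: cellE dest: weyl_closed)

lemma cell_contains: "w \<in> carrier W \<Longrightarrow> n \<in> w \<Longrightarrow> n \<in> cell w"
  using cellI[of \<one> n w \<one>] weyl_closed by simp

lemma cell_B:
  assumes "w \<in> carrier W" "b \<in> B" "g \<in> cell w"
  shows "b \<otimes> g \<in> cell w" "g \<otimes> b \<in> cell w"
proof -
  obtain c n c' where g: "c \<in> B" "n \<in> w" "c' \<in> B" "g = c \<otimes> n \<otimes> c'" using assms cellE by blast
  have "n \<in> carrier G" using weyl_closed assms g by blast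
  then have "b \<otimes> g = (b \<otimes> c) \<otimes> n \<otimes> c'" "g \<otimes> b = c \<otimes> n \<otimes> (c' \<otimes> b)"
    using g assms by (simp_all add: m_assoc)
  then show "b \<otimes> g \<in> cell w" "g \<otimes> b \<in> cell w" using cellI g assms by simp_all
qed

lemma cell_inter:
  assumes "w \<in> carrier W" "w' \<in> carrier W" "g \<in> cell w" "g \<in> cell w'"
  shows "cell w = cell w'"
proof -
  have "cell w \<subseteq> cell w'" if w: "w \<in> carrier W" "w' \<in> carrier W" "g \<in> cell w" "g \<in> cell w'" for w w'
  proof
    fix h assume "h \<in> cell w"
    then obtain b n b' where h: "b \<in> B" "n \<in> w" "b' \<in> B" "h = b \<otimes> n \<otimes> b'" using cellE by blast
    obtain c c' where g: "c \<in> B" "c' \<in> B" "g = c \<otimes> n \<otimes> c'" using cell_rep w h by blast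
    have "n \<in> carrier G" using weyl_closed w h by blast
    then have "h = (b \<otimes> inv c) \<otimes> (g \<otimes> (inv c' \<otimes> b'))" using g h by (simp add: m_assoc)
    then show "h \<in> cell w'" using cell_B w g h by simp
  qed
  then show ?thesis using assms by blast
qed

lemma cell_one: "cell \<one>\<^bsub>W\<^esub> = B"
proof
  show "cell \<one>\<^bsub>W\<^esub> \<subseteq> B" by (auto elim!: cellE simp: weyl_one T_B)
  show "B \<subseteq> cell \<one>\<^bsub>W\<^esub>" using cellI[of _ \<one> "\<one>\<^bsub>W\<^esub>" \<one>] T_group(3) by (fastforce simp: weyl_one)
qed

lemma S_weyl: "s \<in> S \<Longrightarrow> s \<in> carrier W"
  using S_subset by blast

lemma cell_mult:
  assumes "s \<in> S" "w \<in> carrier W" "g \<in> cell s" "h \<in> cell w"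
  shows "g \<otimes> h \<in> cell w \<union> cell (s \<otimes>\<^bsub>W\<^esub> w)"
proof -
  interpret W: group W by (rule weyl_group)
  obtain b n b' where g: "b \<in> B" "n \<in> s" "b' \<in> B" "g = b \<otimes> n \<otimes> b'" using assms cellE by blast
  obtain c m c' where h: "c \<in> B" "m \<in> w" "c' \<in> B" "h = c \<otimes> m \<otimes> c'" using assms cellE by blast
  have cl: "n \<in> carrier G" "m \<in> carrier G" using g h assms weyl_closed S_weyl by auto
  have "n \<otimes> (b' \<otimes> c) \<otimes> m \<in> s <#> B <#> w"
    using g h B_group(1)[of b' c] unfolding set_mult_def by blast
  then have "n \<otimes> (b' \<otimes> c) \<otimes> m \<in> cell w \<union> cell (s \<otimes>\<^bsub>W\<^esub> w)"
    using BN_product[OF assms(1,2)] unfolding cell_def by blast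
  moreover have "g \<otimes> h = b \<otimes> (n \<otimes> (b' \<otimes> c) \<otimes> m \<otimes> c')" using g h cl by (simp add: m_assoc)
  ultimately show ?thesis using cell_B g h assms S_weyl by auto
qed

lemma cell_inv:
  assumes "w \<in> carrier W" "g \<in> cell w"
  shows "inv g \<in> cell (inv\<^bsub>W\<^esub> w)"
proof -
  obtain b n b' where g: "b \<in> B" "n \<in> w" "b' \<in> B" "g = b \<otimes> n \<otimes> b'" using assms cellE by blast
  then have "inv g = inv b' \<otimes> inv n \<otimes> inv b" using weyl_closed assms by (simp add: inv_mult_group m_assoc)
  then show ?thesis using cellI weyl_inv g assms by simp
qed

sublocale weyl: involution_group W S
proof (intro involution_group.intro weyl_group involution_group_axioms.intro)
  have "carrier W \<subseteq> Pow (carrier G)" using weyl_closed by auto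
  then show "finite (carrier W)" using finite_G finite_subset by blast
qed (use S_subset generate_S S_involution in auto)

lemma cell_mult_right:
  assumes "s \<in> S" "w \<in> carrier W" "g \<in> cell w" "h \<in> cell s"
  shows "g \<otimes> h \<in> cell w \<union> cell (w \<otimes>\<^bsub>W\<^esub> s)"
proof -
  have c: "g \<in> carrier G" "h \<in> carrier G"
    using cell_closed[of w g] cell_closed[of s h] assms S_weyl by auto
  have "inv h \<otimes> inv g \<in> cell (inv\<^bsub>W\<^esub> w) \<union> cell (s \<otimes>\<^bsub>W\<^esub> inv\<^bsub>W\<^esub> w)"
    using cell_mult[OF assms(1), of "inv\<^bsub>W\<^esub> w"] cell_inv[of s h] cell_inv[of w g] assms S_weyl by simp
  moreover have "inv (inv h \<otimes> inv g) = g \<otimes> h" using c by (simp add: inv_mult_group)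
  moreover have "inv\<^bsub>W\<^esub> (s \<otimes>\<^bsub>W\<^esub> inv\<^bsub>W\<^esub> w) = w \<otimes>\<^bsub>W\<^esub> s" using assms S_weyl by (simp add: weyl.inv_mult_group)
  ultimately show ?thesis
    using cell_inv[of "inv\<^bsub>W\<^esub> w" "inv h \<otimes> inv g"] cell_inv[of "s \<otimes>\<^bsub>W\<^esub> inv\<^bsub>W\<^esub> w" "inv h \<otimes> inv g"] assms S_weyl
    by auto
qed

text \<open>Disjointness in the Bruhat decomposition, by induction on the smaller length. With w = s
  u, a representative of u lies in the cell of w' or of s w'; by induction u = w' or u = s w', and
  length excludes the former.\<close>

lemma cell_inj:
  assumes "w \<in> carrier W" "w' \<in> carrier W" "cell w = cell w'"
  shows "w = w'"
proof -
  have "w = w'" if "weyl.l w = n" "n \<le> weyl.l w'" "w \<in> carrier W" "w' \<in> carrier W" "cell w = cell w'" for n w w'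
    using that
  proof (induction n arbitrary: w w')
    case 0
    then have "w = \<one>\<^bsub>W\<^esub>" using weyl.len_eq_0 by simp
    moreover obtain n where n: "n \<in> w'" using weyl_nonempty 0 by blast
    moreover have "n \<in> cell w'" "n \<in> N" using cell_contains[of w' n] weyl_N[of w' n] n 0 by auto
    ultimately have "n \<in> T" using 0 cell_one T_I by simp
    then show ?case using weyl_inter[of w w' n] n 0 \<open>w = \<one>\<^bsub>W\<^esub>\<close> by (simp add: weyl_one)
  next
    case (Suc n)
    obtain s u where su: "s \<in> S" "u \<in> carrier W" "w = s \<otimes>\<^bsub>W\<^esub> u" "weyl.l u = n"
      using weyl.len_step[OF Suc.prems(3,1)] by blast
    obtain a m where a: "a \<in> s" "m \<in> u" using weyl_nonempty su S_weyl by blast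
    have c: "a \<in> carrier G" "m \<in> carrier G"
      using weyl_closed[of s a] weyl_closed[of u m] a su S_weyl by auto
    have "a \<otimes> m \<in> cell w'" using weyl_mult[OF a] cell_contains[of w] su Suc.prems by simp
    moreover have "inv a \<in> cell s" using weyl_inv[of s a] cell_contains[of s "inv a"] a su S_weyl by simp
    ultimately have "inv a \<otimes> (a \<otimes> m) \<in> cell w' \<union> cell (s \<otimes>\<^bsub>W\<^esub> w')" using cell_mult su Suc.prems by blast
    then have "m \<in> cell w' \<union> cell (s \<otimes>\<^bsub>W\<^esub> w')" using c by simp
    then have "cell u = cell w' \<or> cell u = cell (s \<otimes>\<^bsub>W\<^esub> w')"
      using cell_inter[of u w' m] cell_inter[of u "s \<otimes>\<^bsub>W\<^esub> w'" m] cell_contains[of u m] a su Suc.prems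
      by auto
    moreover have "n \<le> weyl.l (s \<otimes>\<^bsub>W\<^esub> w')" using weyl.len_mult_S_le[of s w'] su Suc.prems by simp
    ultimately have "u = w' \<or> u = s \<otimes>\<^bsub>W\<^esub> w'" using Suc.IH[of u w'] Suc.IH[of u "s \<otimes>\<^bsub>W\<^esub> w'"] su Suc.prems by auto
    then show ?case using su Suc.prems by auto
  qed
  from this[of w "weyl.l w" w'] this[of w' "weyl.l w'" w] show ?thesis
    using assms nat_le_linear[of "weyl.l w" "weyl.l w'"] by auto
qed

text \<open>This relation turns out to mean \<open>l (s w) < l w\<close>.\<close>

definition descent :: "'a set \<Rightarrow> 'a set \<Rightarrow> bool" where
  "descent s w \<longleftrightarrow> (\<exists>g\<in>cell s. \<exists>h\<in>cell w. g \<otimes> h \<in> cell w)"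

lemma not_descent_one:
  assumes "s \<in> S" shows "\<not> descent s \<one>\<^bsub>W\<^esub>"
proof
  assume "descent s \<one>\<^bsub>W\<^esub>"
  then obtain g h where gh: "g \<in> cell s" "h \<in> B" "g \<otimes> h \<in> B" by (auto simp: descent_def cell_one)
  then have "g \<in> carrier G" using cell_closed S_weyl assms by blast
  then have "g = (g \<otimes> h) \<otimes> inv h" using gh by simp
  then have "g \<in> B" using gh B_group by metis
  then have "cell s = cell \<one>\<^bsub>W\<^esub>" using cell_inter[of s "\<one>\<^bsub>W\<^esub>" g] gh assms S_weyl by (simp add: cell_one)
  then show False using cell_inj[of s "\<one>\<^bsub>W\<^esub>"] S_involution assms S_weyl by simp
qed

text \<open>Since \<open>s B s\<close> is not inside B, some n b n' lies in the cell of s. It sends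
  a representative m of w into the cell of s w, as s is no descent of w. Already n' sends m there,
  so n b maps one element of that cell to another.\<close>

lemma descent_or:
  assumes "s \<in> S" "w \<in> carrier W" "\<not> descent s w"
  shows "descent s (s \<otimes>\<^bsub>W\<^esub> w)"
proof -
  obtain n b n' where n: "n \<in> s" "b \<in> B" "n' \<in> s" "n \<otimes> b \<otimes> n' \<notin> B"
    using BN_not_normalize[OF assms(1)] by (auto simp: set_mult_def)
  obtain m where m: "m \<in> w" using weyl_nonempty assms by blast
  have c: "n \<in> carrier G" "n' \<in> carrier G" "m \<in> carrier G" using n m assms weyl_closed[of s] weyl_closed[of w] by auto
  have nb: "n \<otimes> b \<in> cell s" and n': "n' \<in> cell s"
    using cell_contains[of s] cell_B(2)[of s b n] n assms S_weyl by auto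
  have "n \<otimes> b \<otimes> n' \<in> cell s"
    using cell_mult[OF assms(1) _ nb n'] n(4) assms S_weyl S_involution[OF assms(1)] cell_one by auto
  then have "n \<otimes> b \<otimes> n' \<otimes> m \<in> cell (s \<otimes>\<^bsub>W\<^esub> w)"
    using cell_mult[OF assms(1,2), of _ m] cell_contains[OF assms(2) m] assms(3) unfolding descent_def by blast
  moreover have "n' \<otimes> m \<in> cell (s \<otimes>\<^bsub>W\<^esub> w)"
    using weyl_mult[OF n(3) m] cell_contains assms S_weyl by simp
  moreover have "n \<otimes> b \<otimes> n' \<otimes> m = (n \<otimes> b) \<otimes> (n' \<otimes> m)" using c n by (simp add: m_assoc)
  ultimately show ?thesis using nb unfolding descent_def by metis
qed

text \<open>The element z is located twice. From the left it lies in the cell of s w and not in that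
  of w, as s is no descent of w; from the right, after undoing r, it lies in the cell of w r or of
  w. Cells that meet are equal.\<close>

lemma descent_fold:
  assumes "s \<in> S" "r \<in> S" "w \<in> carrier W" "\<not> descent s w" "descent s (w \<otimes>\<^bsub>W\<^esub> r)"
  shows "s \<otimes>\<^bsub>W\<^esub> w = w \<otimes>\<^bsub>W\<^esub> r"
proof -
  obtain g h where gh: "g \<in> cell s" "h \<in> cell (w \<otimes>\<^bsub>W\<^esub> r)" "g \<otimes> h \<in> cell (w \<otimes>\<^bsub>W\<^esub> r)"
    using assms(5) by (auto simp: descent_def)
  obtain n k where n: "n \<in> w" "k \<in> r" using weyl_nonempty assms S_weyl by blast
  have wr: "w \<otimes>\<^bsub>W\<^esub> r \<in> carrier W" "s \<otimes>\<^bsub>W\<^esub> w \<in> carrier W" using assms S_weyl by auto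
  obtain b b' where h: "b \<in> B" "b' \<in> B" "h = b \<otimes> (n \<otimes> k) \<otimes> b'"
    using cell_rep[OF wr(1) weyl_mult[OF n] gh(2)] by blast
  have c: "n \<in> carrier G" "k \<in> carrier G" "g \<in> carrier G"
    using n gh assms weyl_closed[of w] weyl_closed[of r] cell_closed[of s] by auto
  define z where "z = g \<otimes> b \<otimes> n"
  have "g \<otimes> h \<otimes> inv b' \<in> cell (w \<otimes>\<^bsub>W\<^esub> r)" using cell_B(2)[OF wr(1)] gh h by simp
  moreover have "inv k \<in> cell r" using weyl_inv[of r k] cell_contains[of r "inv k"] n assms S_weyl by simp
  ultimately have "g \<otimes> h \<otimes> inv b' \<otimes> inv k \<in> cell (w \<otimes>\<^bsub>W\<^esub> r) \<union> cell (w \<otimes>\<^bsub>W\<^esub> r \<otimes>\<^bsub>W\<^esub> r)"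
    using cell_mult_right assms wr by blast
  moreover have "g \<otimes> h \<otimes> inv b' \<otimes> inv k = z" using h c by (simp add: z_def m_assoc)
  ultimately have z1: "z \<in> cell (w \<otimes>\<^bsub>W\<^esub> r) \<union> cell w" using assms by simp
  have gb: "g \<otimes> b \<in> cell s" using cell_B(2) gh h assms S_weyl by blast
  then have z2: "z \<in> cell (s \<otimes>\<^bsub>W\<^esub> w)" "z \<notin> cell w"
    using cell_mult[OF assms(1,3) gb cell_contains[OF assms(3) n(1)]] assms(4) cell_contains[OF assms(3) n(1)]
    unfolding z_def descent_def by blast+
  then show ?thesis using z1 cell_inter[OF wr(2,1)] cell_inj[OF wr(2,1)] by blast
qed

text \<open>Along a reduced word of w the relation is false at the identity and true at w. Where it
  changes, \<open>descent_fold\<close> gives s u = u r, so this letter can be deleted in s w. The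
  converse applies the same argument to s w, using \<open>descent_or\<close>.\<close>

lemma descent_len:
  assumes "s \<in> S" "w \<in> carrier W"
  shows "descent s w \<longleftrightarrow> weyl.l (s \<otimes>\<^bsub>W\<^esub> w) < weyl.l w"
proof -
  have less: "weyl.l (s \<otimes>\<^bsub>W\<^esub> w) < weyl.l w" if w: "w \<in> carrier W" "descent s w" for w
  proof -
    note rw = weyl.reduced_word[OF w(1)]
    have "descent s (weyl.wp []) \<noteq> descent s (weyl.wp (weyl.rw w))"
      using not_descent_one assms(1) w rw by simp
    from chain_break[of "\<lambda>us. descent s (weyl.wp us)", OF this]
    obtain us r vs where uv: "weyl.rw w = us @ r # vs"
      "descent s (weyl.wp us) \<noteq> descent s (weyl.wp (us @ [r]))" by metis
    have sub: "set us \<subseteq> S" "r \<in> S" "set vs \<subseteq> S" using uv rw by auto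
    have us: "weyl.wp us \<in> carrier W" using sub by simp
    define u where "u = weyl.wp us"
    have u: "u \<in> carrier W" "descent s u \<noteq> descent s (u \<otimes>\<^bsub>W\<^esub> r)" 
      using uv sub by (auto simp: u_def weyl.wp_append)
    have "s \<otimes>\<^bsub>W\<^esub> u = u \<otimes>\<^bsub>W\<^esub> r"
    proof (cases "descent s u")
      case False
      then show ?thesis using descent_fold[of s r u] u assms(1) sub by simp
    next
      case True
      then have "s \<otimes>\<^bsub>W\<^esub> (u \<otimes>\<^bsub>W\<^esub> r) = u"
        using descent_fold[of s r "u \<otimes>\<^bsub>W\<^esub> r"] u assms(1) sub by simp
      then show ?thesis using u sub assms(1) weyl.S_cancel[of s "u \<otimes>\<^bsub>W\<^esub> r"] by simp
    qed
    moreover have "w = u \<otimes>\<^bsub>W\<^esub> (r \<otimes>\<^bsub>W\<^esub> weyl.wp vs)"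
      using rw(2) uv(1) sub by (simp add: u_def weyl.wp_append)
    then have "s \<otimes>\<^bsub>W\<^esub> w = s \<otimes>\<^bsub>W\<^esub> u \<otimes>\<^bsub>W\<^esub> (r \<otimes>\<^bsub>W\<^esub> weyl.wp vs)"
      using u(1) sub assms(1) by (simp add: weyl.m_assoc)
    ultimately have "s \<otimes>\<^bsub>W\<^esub> w = weyl.wp (us @ vs)"
      using u(1) sub by (simp add: weyl.m_assoc weyl.wp_append u_def)
    then show ?thesis using weyl.len_wp_le[of "us @ vs"] sub uv(1) rw(3) by simp
  qed
  have "weyl.l w < weyl.l (s \<otimes>\<^bsub>W\<^esub> w)" if "\<not> descent s w"
    using less[of "s \<otimes>\<^bsub>W\<^esub> w"] descent_or[OF assms that] assms by simp
  then show ?thesis using less[OF assms(2)] by fastforce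
qed

sublocale weyl: coxeter_group W S
proof (intro coxeter_group.intro weyl.involution_group_axioms coxeter_group_axioms.intro)
  show "weyl.l (s \<otimes>\<^bsub>W\<^esub> w) \<noteq> weyl.l w" if "s \<in> S" "w \<in> carrier W" for s w
    using descent_len[OF that] descent_len[of s "s \<otimes>\<^bsub>W\<^esub> w"] descent_or[OF that] that by auto
  show "s \<otimes>\<^bsub>W\<^esub> w = w \<otimes>\<^bsub>W\<^esub> r"
    if "s \<in> S" "r \<in> S" "w \<in> carrier W" "weyl.l w < weyl.l (s \<otimes>\<^bsub>W\<^esub> w)"
      "weyl.l (s \<otimes>\<^bsub>W\<^esub> w \<otimes>\<^bsub>W\<^esub> r) < weyl.l (w \<otimes>\<^bsub>W\<^esub> r)" for s r w
    using descent_fold[OF that(1-3)] descent_len[of s w] descent_len[of s "w \<otimes>\<^bsub>W\<^esub> r"] that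
    by (auto simp: weyl.m_assoc)
qed

section \<open>Parabolic subgroups of a BN-pair\<close>

text \<open>The classical reason why subgroups containing B are standard: a descent s of w yields a
  representative a of s inside P, and induction continues with u = s w and the representative a^-1
  n.\<close>

lemma subgroup_contains_conj:
  assumes P: "subgroup P G" "B \<subseteq> P" and "w \<in> carrier W" "n \<in> w"
    and "\<And>b. b \<in> B \<Longrightarrow> n \<otimes> b \<otimes> inv n \<in> P"
  shows "w \<subseteq> P"
  using assms(3-5)
proof (induction arbitrary: n rule: weyl.len_induct)
  case one
  then show ?case using P T_B by (auto simp: weyl_one)
next
  case (mult s u)
  note Pg = subgroup.m_closed[OF P(1)] subgroup.m_inv_closed[OF P(1)]
  have c: "n \<in> carrier G" and su: "s \<otimes>\<^bsub>W\<^esub> u \<in> carrier W" using mult weyl_closed[of "s \<otimes>\<^bsub>W\<^esub> u" n] by auto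
  have "descent s (s \<otimes>\<^bsub>W\<^esub> u)" using descent_len[OF mult(1) su] mult by simp
  then obtain g h where gh: "g \<in> cell s" "h \<in> cell (s \<otimes>\<^bsub>W\<^esub> u)" "g \<otimes> h \<in> cell (s \<otimes>\<^bsub>W\<^esub> u)"
    by (auto simp: descent_def)
  obtain b1 a b2 where g: "b1 \<in> B" "a \<in> s" "b2 \<in> B" "g = b1 \<otimes> a \<otimes> b2" using gh cellE by blast
  obtain b3 b4 where h: "b3 \<in> B" "b4 \<in> B" "h = b3 \<otimes> n \<otimes> b4" using cell_rep[OF su mult(5) gh(2)] by blast
  obtain b5 b6 where gh': "b5 \<in> B" "b6 \<in> B" "g \<otimes> h = b5 \<otimes> n \<otimes> b6" using cell_rep[OF su mult(5) gh(3)] by blast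
  have ac: "a \<in> carrier G" using g mult S_weyl weyl_closed by blast
  \<comment> \<open>Both h and g h lie in B n B, so g, and with it a, is a product of elements of B
    and one element of n B n^-1.\<close>
  have "a = inv b1 \<otimes> (g \<otimes> h) \<otimes> inv b4 \<otimes> inv n \<otimes> inv b3 \<otimes> inv b2"
    using g h ac c by (simp add: m_assoc)
  also have "\<dots> = inv b1 \<otimes> b5 \<otimes> (n \<otimes> (b6 \<otimes> inv b4) \<otimes> inv n) \<otimes> inv b3 \<otimes> inv b2"
    using g h gh' c by (simp add: m_assoc)
  also have "\<dots> \<in> P"
  proof -
    have "x \<in> P" if "x \<in> {inv b1, b5, inv b3, inv b2}" for x using that P(2) g h gh' B_group by blast
    moreover have "n \<otimes> (b6 \<otimes> inv b4) \<otimes> inv n \<in> P" using mult(6) gh' h by simp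
    ultimately show ?thesis using Pg(1) by simp
  qed
  finally have aP: "a \<in> P" .
  have am: "inv a \<otimes> m \<in> u" if "m \<in> s \<otimes>\<^bsub>W\<^esub> u" for m
    using weyl_mult[OF weyl_inv[OF S_weyl[OF mult(1)] g(2)] that] mult(1,2) S_weyl by simp
  have "u \<subseteq> P"
  proof (rule mult(4)[OF am[OF mult(5)]])
    fix b assume b: "b \<in> B"
    have "inv a \<otimes> n \<otimes> b \<otimes> inv (inv a \<otimes> n) = inv a \<otimes> (n \<otimes> b \<otimes> inv n) \<otimes> a"
      using ac c b by (simp add: m_assoc inv_mult_group)
    then show "inv a \<otimes> n \<otimes> b \<otimes> inv (inv a \<otimes> n) \<in> P" using Pg aP mult(6)[OF b] by simp
  qed
  show ?case
  proof
    fix m assume m: "m \<in> s \<otimes>\<^bsub>W\<^esub> u"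
    then have "a \<otimes> (inv a \<otimes> m) \<in> P" using am \<open>u \<subseteq> P\<close> Pg(1)[OF aP] by blast
    then show "m \<in> P" using ac weyl_closed[OF su m] by simp
  qed
qed

text \<open>\<open>Q g\<close> says that left multiplication by g preserves the union of all cells.
  It is inherited by products, so it need only be checked on B and N.\<close>

lemma cell_exists:
  assumes "g \<in> carrier G" obtains w where "w \<in> carrier W" "g \<in> cell w"
proof -
  define Q where "Q g \<longleftrightarrow> (\<forall>w\<in>carrier W. \<forall>h\<in>cell w. \<exists>w'\<in>carrier W. g \<otimes> h \<in> cell w')" for g
  have Q_B: "Q b" if "b \<in> B" for b using that cell_B by (auto simp: Q_def)
  have Q_mult: "Q (x \<otimes> y)" if xy: "Q x" "Q y" "x \<in> carrier G" "y \<in> carrier G" for x y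
    unfolding Q_def
  proof (intro ballI)
    fix w h assume w: "w \<in> carrier W" "h \<in> cell w"
    then obtain w1 where w1: "w1 \<in> carrier W" "y \<otimes> h \<in> cell w1" using xy unfolding Q_def by blast
    then obtain w2 where "w2 \<in> carrier W" "x \<otimes> (y \<otimes> h) \<in> cell w2" using xy unfolding Q_def by blast
    then show "\<exists>w'\<in>carrier W. x \<otimes> y \<otimes> h \<in> cell w'"
      using xy cell_closed[OF w] by (auto simp: m_assoc)
  qed
  have "\<forall>n\<in>w. Q n" if "w \<in> carrier W" for w
    using that
  proof (induction rule: weyl.len_induct)
    case one
    then show ?case using Q_B T_B by (simp add: weyl_one)
  next
    case (mult s u)
    obtain a where a: "a \<in> s" using weyl_nonempty S_weyl mult by blast
    have "Q a"
      unfolding Q_def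
    proof (intro ballI)
      fix w h assume w: "w \<in> carrier W" "h \<in> cell w"
      then have "a \<otimes> h \<in> cell w \<union> cell (s \<otimes>\<^bsub>W\<^esub> w)"
        using cell_mult[OF mult(1) w(1) cell_contains[OF S_weyl a]] mult by blast
      then show "\<exists>w'\<in>carrier W. a \<otimes> h \<in> cell w'" using w mult(1) by auto
    qed
    show ?case
    proof
      fix n assume n: "n \<in> s \<otimes>\<^bsub>W\<^esub> u"
      have "inv a \<otimes> n \<in> u"
        using weyl_mult[OF weyl_inv[OF S_weyl[OF mult(1)] a] n] mult(1,2) S_weyl by simp
      then have "Q (a \<otimes> (inv a \<otimes> n))"
        using Q_mult[OF \<open>Q a\<close>, of "inv a \<otimes> n"] mult weyl_closed[OF S_weyl a] weyl_closed[of u] by blast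
      then show "Q n" using weyl_closed[OF S_weyl[OF mult(1)] a] weyl_closed[of "s \<otimes>\<^bsub>W\<^esub> u" n] mult n S_weyl by simp
    qed
  qed
  then have Q_N: "Q n" if "n \<in> N" for n using weyl_classI[OF that] by blast
  have "Q g \<and> g \<in> carrier G" if "g \<in> generate G (B \<union> N)" for g
    using that
  proof induction
    case one
    then show ?case using Q_B by simp
  next
    case (incl h)
    then show ?case using Q_B Q_N by auto
  next
    case (inv h)
    then show ?case using Q_B[of "inv h"] Q_N[of "inv h"] N_group(2)[of h] by auto
  next
    case (eng h1 h2)
    then show ?case using Q_mult by simp
  qed
  then have "Q g" using assms generate_BN by simp
  then obtain w where "w \<in> carrier W" "g \<otimes> \<one> \<in> cell w"
    unfolding Q_def using cell_one B_group by (metis weyl.one_closed)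
  then show ?thesis using that assms by simp
qed

text \<open>As B lies both in P and in the union of cells that g conjugates to P,
  \<open>subgroup_contains_conj\<close> puts g itself into P. So the conjugation changes nothing, P
  is that union, and disjointness of cells reads off its cosets.\<close>

lemma conj_cells:
  assumes P: "subgroup P G" "B \<subseteq> P" and X: "X \<subseteq> carrier W" "\<one>\<^bsub>W\<^esub> \<in> X" and "g \<in> carrier G"
    and P_iff: "\<And>y. y \<in> carrier G \<Longrightarrow> g \<otimes> y \<otimes> inv g \<in> P \<longleftrightarrow> (\<exists>w\<in>X. y \<in> cell w)"
    and w: "w \<in> carrier W"
  shows "w \<subseteq> P \<longleftrightarrow> w \<in> X"
proof -
  note Pg = subgroup.m_closed[OF P(1)] subgroup.m_inv_closed[OF P(1)]
  obtain v where v: "v \<in> carrier W" "g \<in> cell v" using cell_exists assms by blast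
  obtain b1 n b2 where g: "b1 \<in> B" "n \<in> v" "b2 \<in> B" "g = b1 \<otimes> n \<otimes> b2" using v cellE by blast
  have nc: "n \<in> carrier G" using weyl_closed g v by blast
  have "v \<subseteq> P"
  proof (rule subgroup_contains_conj[OF P v(1) g(2)])
    fix b assume b: "b \<in> B"
    have "inv b2 \<otimes> b \<otimes> b2 \<in> B" using b g by simp
    then have "g \<otimes> (inv b2 \<otimes> b \<otimes> b2) \<otimes> inv g \<in> P"
      using P_iff[of "inv b2 \<otimes> b \<otimes> b2"] X(2) cell_one by (metis B_closed)
    moreover have "inv b1 \<in> P" "b1 \<in> P" using P(2) g B_group by blast+
    ultimately have "inv b1 \<otimes> (g \<otimes> (inv b2 \<otimes> b \<otimes> b2) \<otimes> inv g) \<otimes> b1 \<in> P"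
      by (simp only: Pg(1))
    then show "n \<otimes> b \<otimes> inv n \<in> P" using g b nc by (simp add: m_assoc inv_mult_group)
  qed
  moreover have "b1 \<in> P" "b2 \<in> P" using g P(2) by auto
  ultimately have gP: "g \<in> P" using g Pg(1) by blast
  have PX: "y \<in> P \<longleftrightarrow> (\<exists>w\<in>X. y \<in> cell w)" if "y \<in> carrier G" for y
  proof -
    have "y \<in> P" if gy: "g \<otimes> y \<otimes> inv g \<in> P"
    proof -
      have "inv g \<otimes> (g \<otimes> y \<otimes> inv g) \<otimes> g \<in> P" using Pg(1)[OF Pg(1)[OF Pg(2)[OF gP] gy] gP] .
      then show ?thesis using \<open>y \<in> carrier G\<close> assms(5) by (simp add: m_assoc)
    qed
    moreover have "g \<otimes> y \<otimes> inv g \<in> P" if "y \<in> P" using Pg(1)[OF Pg(1)[OF gP that] Pg(2)[OF gP]] .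
    ultimately show ?thesis using P_iff[OF that] by blast
  qed
  obtain m where m: "m \<in> w" using weyl_nonempty w by blast
  show ?thesis
  proof
    assume "w \<subseteq> P"
    then obtain w' where "w' \<in> X" "m \<in> cell w'" using PX m weyl_closed w by blast
    then show "w \<in> X" using cell_inj[of w w'] cell_inter[of w w' m] cell_contains[of w m] m w X by auto
  next
    assume "w \<in> X"
    then show "w \<subseteq> P" using PX cell_contains[OF w] weyl_closed[OF w] by blast
  qed
qed

end

section \<open>Integer polynomials in \<open>q\<^sup>-\<^sup>1\<close>\<close>

text \<open>Evaluation at q^-1, since R-polynomials enter their definitions barred. Exponents appear
  doubled because index k of \<open>laurent\<close> stands for q to the power k/2.\<close>

definition ev :: "int poly \<Rightarrow> laurent" where "ev p = lbar (at_q p)"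

lemma qpow_add: "qpow a * qpow b = qpow (a + b)"
  by (simp add: qpow_def mult_single distrib_left)

lemma qpow_0: "qpow 0 = 1"
  by (simp add: qpow_def)

lemma qpow_power: "qpow k ^ n = qpow (int n * k)"
  by (induction n) (simp_all add: qpow_0 qpow_add algebra_simps)

lemma lbar_single: "lbar (Poly_Mapping.single k c) = Poly_Mapping.single (- k) c"
  unfolding lbar_def using Poly_Mapping.map_key_single[of uminus "- k" c] by simp

lemma lbar_add: "lbar (f + g) = lbar f + lbar g"
  unfolding lbar_def by (rule Poly_Mapping.map_key_plus) simp

lemma lbar_zero [simp]: "lbar 0 = 0"
  unfolding lbar_def by (rule Poly_Mapping.map_key_zero) simp

lemma lbar_one [simp]: "lbar 1 = 1"
  using lbar_single[of 0 1] by simp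

lemma lbar_sum: "lbar (sum f I) = (\<Sum>i\<in>I. lbar (f i))"
  by (induction I rule: infinite_finite_induct) (simp_all add: lbar_add)

lemma of_int_qpow: "of_int c * qpow k = Poly_Mapping.single (2 * k) c"
  using mult_single[of 0 c "2 * k" "1::int"] single_of_int[of c, where 'b = int and 'a = int] by (simp add: qpow_def)

lemma poly_map_of_int:
  fixes x :: "'k::{comm_ring_1, ring_char_0}"
  shows "poly (map_poly of_int p) x = (\<Sum>i\<le>degree p. of_int (coeff p i) * x ^ i)"
  by (simp add: poly_altdef coeff_map_poly degree_map_poly)

lemma at_q_sum: "at_q p = (\<Sum>i\<le>degree p. Poly_Mapping.single (2 * int i) (coeff p i))"
  unfolding at_q_def poly_map_of_int by (simp add: qpow_power of_int_qpow)

lemma ev_sum: "ev p = (\<Sum>i\<le>degree p. Poly_Mapping.single (- 2 * int i) (coeff p i))"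
  by (simp add: ev_def at_q_sum lbar_sum lbar_single)

lemma ev_poly: "ev p = poly (map_poly of_int p) (qpow (- 1))"
  unfolding ev_sum poly_map_of_int by (simp add: qpow_power of_int_qpow)

lemma lookup_ev: "Poly_Mapping.lookup (ev p) (- 2 * int n) = coeff p n"
proof -
  have "Poly_Mapping.lookup (ev p) (- 2 * int n) = (\<Sum>i\<le>degree p. if i = n then coeff p i else 0)"
    unfolding ev_sum lookup_sum by (intro sum.cong) (auto simp: lookup_single when_def)
  also have "\<dots> = coeff p n" by (simp add: coeff_eq_0)
  finally show ?thesis .
qed

lemma ev_inj: "ev p = ev r \<Longrightarrow> p = r"
  by (metis lookup_ev poly_eqI)

lemma ev_ring_map: "ring_map ev"
proof -
  have pc: "ev (pCons a p) = of_int a + qpow (- 1) * ev p" for a p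
    unfolding ev_poly by (simp add: map_poly_pCons)
  have zero: "ev 0 = 0" by (simp add: ev_poly)
  have add: "ev (p + r) = ev p + ev r" for p r
    by (induction p r rule: poly_induct2) (simp_all add: pc zero algebra_simps)
  have smult: "ev (smult a p) = of_int a * ev p" for a p
    by (induction p) (simp_all add: pc zero algebra_simps)
  have mult: "ev (p * r) = ev p * ev r" for p r
    by (induction p) (simp_all add: pc zero add smult algebra_simps)
  have "ev 1 = 1" using pc[of 1 0] by (simp add: zero one_pCons)
  then show ?thesis using add mult by (simp add: ring_map_def)
qed

lemma ev_X: "ev [:0, 1:] = qpow (- 1)"
  unfolding ev_poly by (simp add: map_poly_pCons)

lemma poly_zero_ring_map: "ring_map (\<lambda>p::int poly. poly p 0)"
  by (simp add: ring_map_def)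

section \<open>The bar involution and the Kazhdan-Lusztig polynomials\<close>

lemma basis_unit_vec: "basis = unit_vec"
  by (intro ext) (simp add: basis_def unit_vec_def)

lemma lin_ext_lext: "lin_ext = lext"
  by (intro ext) (simp add: lin_ext_def lext_def)

context coxeter_group
begin

lemma hecke_mult_hact: "hecke_mult W S = hact (qpow (- 1))"
proof (intro ext)
  fix f g x
  have "hecke_gen W S = hgen (qpow (- 1))"
    by (intro ext) (simp add: hecke_gen_def hgen_def basis_unit_vec)
  then have "(\<lambda>s. lin_ext (carrier W) (hecke_gen W S s)) = hop (qpow (- 1))"
    by (intro ext) (simp add: hop_def lin_ext_lext)
  then show "hecke_mult W S f g x = hact (qpow (- 1)) f g x"
    by (simp add: hecke_mult_def hecke_act_def hact_def)
qed

lemma qpow_inverse: "qpow 1 * qpow (- 1) = 1"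
  by (simp add: qpow_add qpow_0)

lemma hecke_inv_eq:
  assumes "w \<in> carrier W"
  shows "hecke_inv W S (basis (inv w)) = hinv (qpow 1) (qpow (- 1)) w"
  unfolding hecke_inv_def hecke_mult_hact basis_unit_vec
proof (rule the_equality)
  show "(\<forall>x. x \<notin> carrier W \<longrightarrow> hinv (qpow 1) (qpow (- 1)) w x = 0) \<and>
    hact (qpow (- 1)) (unit_vec (inv w)) (hinv (qpow 1) (qpow (- 1)) w) = unit_vec \<one> \<and>
    hact (qpow (- 1)) (hinv (qpow 1) (qpow (- 1)) w) (unit_vec (inv w)) = unit_vec \<one>"
    using hinv_supp[OF qpow_inverse assms] hact_hinv_inverse[OF qpow_inverse assms]
    by (simp add: supported_def)
  show "g = hinv (qpow 1) (qpow (- 1)) w"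
    if "(\<forall>x. x \<notin> carrier W \<longrightarrow> g x = 0) \<and> hact (qpow (- 1)) (unit_vec (inv w)) g = unit_vec \<one> \<and>
      hact (qpow (- 1)) g (unit_vec (inv w)) = unit_vec \<one>" for g
    using hact_inv_unique[OF qpow_inverse assms, of g] that by (simp add: supported_def)
qed

lemma hecke_bar_basis:
  assumes "w \<in> carrier W"
  shows "hecke_bar W S (basis w) = hinv (qpow 1) (qpow (- 1)) w"
proof
  fix x
  have "hecke_bar W S (basis w) x =
    (\<Sum>v\<in>carrier W. if v = w then hecke_inv W S (basis (inv v)) x else 0)"
    unfolding hecke_bar_def by (intro sum.cong) (auto simp: basis_def)
  then show "hecke_bar W S (basis w) x = hinv (qpow 1) (qpow (- 1)) w x"
    using assms finite_carrier by (simp add: hecke_inv_eq)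
qed

text \<open>Over \<open>int poly\<close> the parameter is the variable: \<open>ev\<close> sends it
  to q^-1, and evaluation at 0 sends it to the parameter of the 0-Hecke algebra.\<close>

lemma hbword_ev:
  "hbword (qpow (- 1)) ss (\<lambda>x. ev (f x)) = (\<lambda>x. ev (hbword [:0, 1:] ss f x))"
  using hbword_ring_map[OF ev_ring_map, of "[:0, 1:]" ss f] by (simp add: ev_X)

lemma qpow_cancel: "qpow k * f = qpow k * g \<longleftrightarrow> f = g"
proof
  assume "qpow k * f = qpow k * g"
  then have "qpow (- k) * (qpow k * f) = qpow (- k) * (qpow k * g)" by simp
  then show "f = g" by (simp add: mult.assoc[symmetric] qpow_add qpow_0)
qed simp

lemma the_ev_eq: "v = qpow k * ev p \<Longrightarrow> (THE p. v = qpow k * lbar (at_q p)) = p"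
  unfolding ev_def[symmetric] by (rule the_equality) (simp, metis qpow_cancel ev_inj)

text \<open>Supplies the polynomial that the definite description asks for: the bar of A_w is q^l(w)
  times \<open>hbword\<close>, whose coordinates come from \<open>int poly\<close>, and
  \<open>ev\<close> is injective.\<close>

lemma KL_R_eq:
  assumes "w \<in> carrier W"
  shows "KL_R W S x w = hbword [:0, 1:] (rw w) (unit_vec \<one>) x"
proof -
  have "(\<lambda>x. ev (unit_vec \<one> x)) = (unit_vec \<one> :: 'a \<Rightarrow> laurent)"
    by (intro ext ring_map_unit_vec ev_ring_map)
  then have "hecke_bar W S (basis w) x = qpow (int (l w)) * ev (hbword [:0, 1:] (rw w) (unit_vec \<one>) x)"
    using hbword_ev[of "rw w" "unit_vec \<one>"]
    by (simp add: hecke_bar_basis[OF assms] hinv_def[OF qpow_inverse] qpow_power)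
  then show ?thesis unfolding KL_R_def by (rule the_ev_eq)
qed

end

section \<open>R-polynomials of the orbit\<close>

context orbit_module
begin

text \<open>\<open>Q_tail\<close> and \<open>Q_R\<close> lift \<open>tail\<close> and
  \<open>R0\<close> from values at 0 to polynomials.\<close>

definition Q_tail :: "'w \<Rightarrow> 'w \<Rightarrow> 'w \<Rightarrow> int poly" where
  "Q_tail t y = (\<lambda>z. if z \<in> H then KL_R W S (t \<otimes> z) y else 0)"

definition Q_R :: "'o \<Rightarrow> 'w \<Rightarrow> 'w \<Rightarrow> int poly" where
  "Q_R \<theta> x t = (\<Sum>y\<in>D. pim y (hbword [:0, 1:] (rw x) (Q_tail t y)) \<theta>)"

lemma pim_ring_map: "ring_map h \<Longrightarrow> pim y (\<lambda>w. h (f w)) \<theta> = h (pim y f \<theta>)"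
  by (simp add: pim_def lext_def ring_map_sum ring_map_simps ring_map_unit_vec)

lemma Q_R_zero:
  assumes "x \<in> carrier W" "t \<in> carrier W"
  shows "poly (Q_R \<theta> x t) 0 = R0 \<theta> x t"
proof -
  note h = poly_zero_ring_map
  have hb: "(\<lambda>x. poly (hbword [:0, 1:] ss f x) 0) = hbword 0 ss (\<lambda>x. poly (f x) 0)" for ss and f :: "'w \<Rightarrow> int poly"
    using hbword_ring_map[OF h, of "[:0, 1:]" ss f] by simp
  have "poly (KL_R W S u y) 0 = cw y (unit_vec \<one>) u" if "y \<in> D" for u y
  proof -
    have "(\<lambda>x. poly (unit_vec \<one> x) 0) = (unit_vec \<one> :: 'w \<Rightarrow> int)"
      by (intro ext) (rule ring_map_unit_vec[OF h])
    then show ?thesis using fun_cong[OF hb[of "rw y" "unit_vec \<one>"], of u] that by (simp add: KL_R_eq cw_def)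
  qed
  then have "(\<lambda>z. poly (Q_tail t y z) 0) = tail t y" if "y \<in> D" for y
    using that by (auto simp: Q_tail_def tail_def)
  then have "pim y (cw x (tail t y)) \<theta> = poly (pim y (hbword [:0, 1:] (rw x) (Q_tail t y)) \<theta>) 0" if "y \<in> D" for y
    using that hb[of "rw x" "Q_tail t y"] pim_ring_map[OF h, of y "hbword [:0, 1:] (rw x) (Q_tail t y)" \<theta>]
    by (simp add: cw_def)
  then show ?thesis by (simp add: Q_R_def R0_def poly_sum)
qed

text \<open>The double sum is a sum of images under the maps \<open>pim y\<close>. Hence the bar of
  A_x can act in the regular module, where \<open>hact_hinv\<close> turns it into q^l(x) times
  \<open>hbword\<close>.\<close>

lemma bar_basis_eq:
  assumes "x \<in> DE" "t \<in> D"
  shows "qpow (- int (l t)) * hecke_act W S Orb (ogen (qpow (- 1))) (hecke_bar W S (basis x))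
      (\<lambda>\<rho>. \<Sum>z\<in>H. \<Sum>y\<in>D. lbar (at_q (KL_R W S (t \<otimes> z) y)) * basis (elt z y) \<rho>) \<theta>
    = qpow (int (l x) - int (l t)) * ev (Q_R \<theta> x t)"
proof -
  let ?q = "qpow (- 1)"
  let ?g = "hinv (qpow 1) ?q x"
  let ?F = "\<lambda>y z. ev (Q_tail t y z)"
  have x: "x \<in> carrier W" using assms by simp
  have ev0: "ev 0 = 0" by (rule ring_map_simps(2)[OF ev_ring_map])
  have sF: "supp (?F y)" for y by (auto simp: supported_def Q_tail_def ev0)
  have h: "(\<lambda>\<rho>. \<Sum>z\<in>H. \<Sum>y\<in>D. lbar (at_q (KL_R W S (t \<otimes> z) y)) * basis (elt z y) \<rho>)
      = (\<lambda>\<rho>. \<Sum>y\<in>D. pim y (?F y) \<rho>)"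
  proof
    fix \<rho>
    have "pim y (?F y) \<rho> = (\<Sum>z\<in>H. lbar (at_q (KL_R W S (t \<otimes> z) y)) * basis (elt z y) \<rho>)" for y
      unfolding pim_def lext_def ev_def[symmetric] basis_unit_vec
      by (rule sum.mono_neutral_cong_right) (auto simp: finite_carrier Q_tail_def ev0)
    then show "(\<Sum>z\<in>H. \<Sum>y\<in>D. lbar (at_q (KL_R W S (t \<otimes> z) y)) * basis (elt z y) \<rho>)
      = (\<Sum>y\<in>D. pim y (?F y) \<rho>)" by (simp add: sum.swap[of _ H])
  qed
  have oop: "(\<lambda>s. lin_ext Orb (ogen ?q s)) = oop ?q"
    by (intro ext) (simp add: oop_def lin_ext_lext)
  have lin: "linop (foldr (oop ?q) ss)" for ss
    by (rule linop_foldr) (simp add: oop_def linop_lext)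
  have word: "foldr (oop ?q) (rw w) (\<lambda>\<rho>. \<Sum>y\<in>D. pim y (?F y) \<rho>) \<theta> = (\<Sum>y\<in>D. pim y (hword ?q (rw w) (?F y)) \<theta>)"
    if "w \<in> carrier W" for w
    using sF reduced_word(1)[OF that] by (simp add: linop_sum[OF lin] pim_hword)
  have "hecke_act W S Orb (ogen ?q) ?g (\<lambda>\<rho>. \<Sum>y\<in>D. pim y (?F y) \<rho>) \<theta>
      = (\<Sum>w\<in>carrier W. \<Sum>y\<in>D. ?g w * pim y (hword ?q (rw w) (?F y)) \<theta>)"
    unfolding hecke_act_def oop by (intro sum.cong refl) (simp add: word sum_distrib_left)
  also have "\<dots> = (\<Sum>y\<in>D. \<Sum>w\<in>carrier W. ?g w * pim y (hword ?q (rw w) (?F y)) \<theta>)"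
    by (rule sum.swap)
  also have "\<dots> = (\<Sum>y\<in>D. pim y (hact ?q ?g (?F y)) \<theta>)"
    by (simp add: hact_def linop_sum[OF pim_linop] linop_scale[OF pim_linop])
  also have "\<dots> = (\<Sum>y\<in>D. qpow (int (l x)) * ev (pim y (hbword [:0, 1:] (rw x) (Q_tail t y)) \<theta>))"
    by (simp add: hact_hinv[OF qpow_inverse x sF] hbword_ev qpow_power linop_scale[OF pim_linop]
        pim_ring_map[OF ev_ring_map])
  also have "\<dots> = qpow (int (l x)) * ev (Q_R \<theta> x t)"
    by (simp add: Q_R_def ring_map_sum[OF ev_ring_map] sum_distrib_left)
  finally show ?thesis
    unfolding h hecke_bar_basis[OF x] by (simp add: mult.assoc[symmetric] qpow_add)
qed

end

section \<open>The Weyl group orbit of an idempotent\<close>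

lemma (in group) finite_submonoid_subgroup:
  assumes "finite (carrier G)" "H \<subseteq> carrier G" "\<one> \<in> H" "\<And>x y. x \<in> H \<Longrightarrow> y \<in> H \<Longrightarrow> x \<otimes> y \<in> H"
  shows "subgroup H G"
proof
  fix x assume x: "x \<in> H"
  have "inj_on (\<lambda>y. x \<otimes> y) H" using assms(2) x by (auto simp: inj_on_def subset_iff)
  moreover have "finite H" "(\<lambda>y. x \<otimes> y) ` H \<subseteq> H" using assms x finite_subset by auto
  ultimately have "(\<lambda>y. x \<otimes> y) ` H = H" by (intro endo_inj_surj)
  then obtain y where "y \<in> H" "x \<otimes> y = \<one>" using assms(3) by (metis imageE)
  then have "inv x = y" using x assms(2) by (metis inv_equality inv_inv subsetD)
  then show "inv x \<in> H" using \<open>y \<in> H\<close> by simp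
qed (use assms in auto)

locale lie_type_orbit = finite_monoid_of_Lie_type M B N S p
  for M :: "('a, 'b) monoid_scheme" (structure) and B N S p +
  fixes e :: 'a
  assumes e_cross_section: "e \<in> cross_section M B N S"
    and W_fix_parabolic: "standard_parabolic (weyl (units_of M) B N) S (orbit_data.W_fix M B N S e)"
begin

abbreviation "G \<equiv> units_of M"
abbreviation "iv x \<equiv> inv\<^bsub>G\<^esub> x"

lemmas units_simps [simp] = units_of_carrier[of M] units_of_mult[of M] units_of_one[of M]

sublocale units: finite_BN_pair G B N S
proof -
  interpret finite_group_of_Lie_type G B N S p by (rule unit_group)
  show "finite_BN_pair G B N S" by unfold_locales (rule finite_carrier)
qed

sublocale orbit_data M B N S e .

abbreviation "P \<equiv> P_right M e"
abbreviation "P' \<equiv> P_left M e"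
abbreviation "B' \<equiv> opp_borel G B N S"
abbreviation "w\<^sub>0 \<equiv> longest W S (carrier W)"

lemma units_closed [simp]: "x \<in> Units M \<Longrightarrow> x \<in> carrier M"
  by (rule Units_closed)

lemma iv_closed [simp]: "x \<in> Units M \<Longrightarrow> iv x \<in> Units M"
  using units.inv_closed[of x] by simp

lemma iv_inv [simp]: "x \<in> Units M \<Longrightarrow> iv x \<otimes> x = \<one>" "x \<in> Units M \<Longrightarrow> x \<otimes> iv x = \<one>"
  using units.l_inv[of x] units.r_inv[of x] by auto

lemma iv_cancel [simp]:
  assumes "x \<in> Units M" "y \<in> carrier M"
  shows "iv x \<otimes> (x \<otimes> y) = y" "x \<otimes> (iv x \<otimes> y) = y"
    "y \<otimes> x \<otimes> iv x = y" "y \<otimes> iv x \<otimes> x = y"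
  using assms by (simp_all add: m_assoc[symmetric]) (simp_all add: m_assoc)

lemma iv_mult: "x \<in> Units M \<Longrightarrow> y \<in> Units M \<Longrightarrow> iv (x \<otimes> y) = iv y \<otimes> iv x"
  using units.inv_mult_group[of x y] by simp

lemma iv_iv [simp]: "x \<in> Units M \<Longrightarrow> iv (iv x) = x"
  using units.inv_inv[of x] by simp

lemma B_units [simp]: "b \<in> B \<Longrightarrow> b \<in> Units M"
  using units.B_closed by simp

lemma W_units: "w \<in> carrier W \<Longrightarrow> n \<in> w \<Longrightarrow> n \<in> Units M"
  using units.weyl_closed by simp

lemma e_closed [simp]: "e \<in> carrier M" and e_idem [simp]: "e \<otimes> e = e"
  and B_P: "B \<subseteq> P" and B'_P': "B' \<subseteq> P'" and e_idempotent: "e \<in> idempotents M"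
  using e_cross_section by (auto simp: cross_section_def idempotents_def)

lemma e_idem_left [simp]: "x \<in> carrier M \<Longrightarrow> e \<otimes> (e \<otimes> x) = e \<otimes> x"
  by (simp add: m_assoc[symmetric])

lemma P_iff: "x \<in> P \<longleftrightarrow> x \<in> Units M \<and> x \<otimes> e = e \<otimes> x \<otimes> e"
  and P'_iff: "x \<in> P' \<longleftrightarrow> x \<in> Units M \<and> e \<otimes> x = e \<otimes> x \<otimes> e"
  by (auto simp: P_right_def P_left_def)

lemma P_subgroup: "subgroup P G" and P'_subgroup: "subgroup P' G"
proof -
  have fin: "finite (carrier G)" using units.finite_G .
  show "subgroup P G"
  proof (rule units.finite_submonoid_subgroup[OF fin])
    fix x y assume "x \<in> P" "y \<in> P"
    then have c: "x \<in> Units M" "y \<in> Units M" "x \<otimes> e = e \<otimes> x \<otimes> e" "y \<otimes> e = e \<otimes> y \<otimes> e" by (auto simp: P_iff)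
    then have "x \<otimes> y \<otimes> e = (x \<otimes> e) \<otimes> (y \<otimes> e)" by (simp add: m_assoc)
    also have "\<dots> = e \<otimes> ((x \<otimes> e) \<otimes> (y \<otimes> e))" unfolding c(3) using c(1,2) by (simp add: m_assoc)
    also have "(x \<otimes> e) \<otimes> (y \<otimes> e) = x \<otimes> y \<otimes> e" using \<open>x \<otimes> y \<otimes> e = (x \<otimes> e) \<otimes> (y \<otimes> e)\<close> by simp
    finally show "x \<otimes>\<^bsub>G\<^esub> y \<in> P" using c(1,2) by (simp add: P_iff m_assoc)
  qed (auto simp: P_iff)
  show "subgroup P' G"
  proof (rule units.finite_submonoid_subgroup[OF fin])
    fix x y assume "x \<in> P'" "y \<in> P'"
    then have c: "x \<in> Units M" "y \<in> Units M" "e \<otimes> x = e \<otimes> x \<otimes> e" "e \<otimes> y = e \<otimes> y \<otimes> e" by (auto simp: P'_iff)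
    have 1: "(e \<otimes> x) \<otimes> (e \<otimes> y) = e \<otimes> x \<otimes> y" using c(1,2) by (subst (2) c(3)) (simp add: m_assoc)
    have "(e \<otimes> x) \<otimes> (e \<otimes> y) \<otimes> e = (e \<otimes> x) \<otimes> (e \<otimes> y)" using c(1,2) by (subst (2) c(4)) (simp add: m_assoc)
    then show "x \<otimes>\<^bsub>G\<^esub> y \<in> P'" using c(1,2) unfolding 1 by (simp add: P'_iff m_assoc)
  qed (auto simp: P'_iff)
qed

lemma w0_closed: "w\<^sub>0 \<in> carrier W"
  by (rule units.weyl.longest_closed)

lemma opp_borel_iff:
  assumes "n \<in> w\<^sub>0" "y \<in> Units M"
  shows "y \<in> B' \<longleftrightarrow> iv n \<otimes> y \<otimes> n \<in> B"
proof
  have n: "n \<in> Units M" using assms w0_closed W_units by blast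
  have B': "B' = w\<^sub>0 <#>\<^bsub>G\<^esub> B <#>\<^bsub>G\<^esub> inv\<^bsub>W\<^esub> w\<^sub>0" by (simp add: opp_borel_def Let_def)
  show "iv n \<otimes> y \<otimes> n \<in> B" if yB: "y \<in> B'"
  proof -
    obtain a b c where y: "a \<in> w\<^sub>0" "b \<in> B" "c \<in> inv\<^bsub>W\<^esub> w\<^sub>0" "y = a \<otimes> b \<otimes> c"
      using yB unfolding B' by (auto simp: set_mult_def)
    have u: "a \<in> Units M" "c \<in> Units M" using y w0_closed W_units by (blast, meson units.weyl.inv_closed W_units w0_closed)
    have "iv n \<otimes> a \<in> B" using units.weyl_eq_right[OF w0_closed assms(1) y(1)] units.T_B by simp
    moreover have "c \<otimes> n \<in> \<one>\<^bsub>W\<^esub>" using units.weyl_mult[OF y(3) assms(1)] w0_closed by simp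
    then have "c \<otimes> n \<in> B" using units.T_B by (simp add: units.weyl_one)
    ultimately have "(iv n \<otimes> a) \<otimes> b \<otimes> (c \<otimes> n) \<in> B" using y units.B_group(1) by simp
    then show ?thesis using u n y by (simp add: m_assoc)
  qed
  show "y \<in> B'" if "iv n \<otimes> y \<otimes> n \<in> B"
  proof -
    have "n \<otimes> (iv n \<otimes> y \<otimes> n) \<otimes> iv n \<in> B'"
      unfolding B' set_mult_def using that assms(1) units.weyl_inv[OF w0_closed assms(1)] by (simp, blast)
    then show ?thesis using n assms(2) by (simp add: m_assoc)
  qed
qed

text \<open>T is normalised by the longest element, so it lies in B and in the opposite Borel
  subgroup, hence in P(e) and P^-(e): t e = e t e = e t.\<close>

lemma T_commute:
  assumes "t \<in> torus B N"
  shows "t \<otimes> e = e \<otimes> t"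
proof -
  obtain n where n: "n \<in> w\<^sub>0" using units.weyl_nonempty w0_closed by blast
  have t: "t \<in> B" "t \<in> Units M" using units.T_B assms by auto
  have "iv n \<otimes> t \<otimes> n \<in> torus B N" using units.T_conj(2)[OF assms] units.weyl_N[OF w0_closed n] by simp
  then have "t \<in> B'" using opp_borel_iff[OF n t(2)] units.T_B by blast
  then show ?thesis using t B_P B'_P' P_iff P'_iff by (metis subsetD)
qed

text \<open>After conjugation by \<open>w\<^sub>0\<close> the opposite of a standard parabolic subgroup contains \<open>B\<close>, so
  \<open>conj_cells\<close> applies to both members of an opposite pair and yields the same subset of \<open>W\<close>.\<close>

lemma parabolic_pair:
  obtains I where "I \<subseteq> S"
    "\<And>w. w \<in> carrier W \<Longrightarrow> w \<subseteq> P \<longleftrightarrow> w \<in> generate W I"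
    "\<And>w. w \<in> carrier W \<Longrightarrow> w \<subseteq> P' \<longleftrightarrow> w \<in> generate W I"
proof -
  obtain g I where g: "g \<in> Units M" and I: "I \<subseteq> S"
    and P: "P = g <#\<^bsub>G\<^esub> P_plus G B N I #>\<^bsub>G\<^esub> iv g"
    and P': "P' = g <#\<^bsub>G\<^esub> P_minus G B N S I #>\<^bsub>G\<^esub> iv g"
    using opposite[OF e_idempotent] by (auto simp: opposite_parabolics_def)
  define X where "X = generate W I"
  have X: "X \<subseteq> carrier W" "\<one>\<^bsub>W\<^esub> \<in> X"
    using units.weyl.generate_in_carrier[of I] units.weyl.S_subset I unfolding X_def
    by (auto intro: generate.one)
  have conj: "g \<otimes> y \<otimes> iv g \<in> g <#\<^bsub>G\<^esub> A #>\<^bsub>G\<^esub> iv g \<longleftrightarrow> y \<in> A" if "y \<in> Units M" "A \<subseteq> Units M" for y A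
  proof
    assume "g \<otimes> y \<otimes> iv g \<in> g <#\<^bsub>G\<^esub> A #>\<^bsub>G\<^esub> iv g"
    then obtain a where a: "a \<in> A" "g \<otimes> y \<otimes> iv g = g \<otimes> a \<otimes> iv g"
      by (auto simp: l_coset_def r_coset_def)
    have "y = iv g \<otimes> (g \<otimes> y \<otimes> iv g) \<otimes> g" using that g by (simp add: m_assoc)
    also have "\<dots> = a" unfolding a(2) using a(1) that g by (simp add: m_assoc subset_iff)
    finally show "y \<in> A" using a by simp
  qed (auto simp: l_coset_def r_coset_def)
  have plus: "P_plus G B N I \<subseteq> Units M" "y \<in> P_plus G B N I \<longleftrightarrow> (\<exists>w\<in>X. y \<in> units.cell w)" for y
    using units.cell_closed X by (auto simp: P_plus_def units.cell_def X_def)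
  obtain n where n: "n \<in> w\<^sub>0" using units.weyl_nonempty w0_closed by blast
  have nu: "n \<in> Units M" using n w0_closed W_units by blast
  \<comment> \<open>Conjugation in W, unrelated to the operators C_w; it translates double cosets of
    the opposite Borel subgroup into cells of B.\<close>
  define cw where "cw w = inv\<^bsub>W\<^esub> w\<^sub>0 \<otimes>\<^bsub>W\<^esub> w \<otimes>\<^bsub>W\<^esub> w\<^sub>0" for w
  have cw: "cw w \<in> carrier W" if "w \<in> carrier W" for w using that w0_closed by (simp add: cw_def)
  have cw_inv: "w\<^sub>0 \<otimes>\<^bsub>W\<^esub> cw w \<otimes>\<^bsub>W\<^esub> inv\<^bsub>W\<^esub> w\<^sub>0 = w" if "w \<in> carrier W" for w
    using that w0_closed by (simp add: cw_def units.weyl.m_assoc)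
  have in_cw: "iv n \<otimes> m \<otimes> n \<in> cw w" if "w \<in> carrier W" "m \<in> w" for w m
    using units.weyl_mult[OF units.weyl_mult[OF units.weyl_inv[OF w0_closed n] that(2)] n] by (simp add: cw_def)
  have of_cw: "n \<otimes> k \<otimes> iv n \<in> w" if "w \<in> carrier W" "k \<in> cw w" for w k
    using units.weyl_mult[OF units.weyl_mult[OF n that(2)] units.weyl_inv[OF w0_closed n]] cw_inv[OF that(1)] by simp
  have B'_u: "b \<in> Units M" if bB: "b \<in> B'" for b
  proof -
    obtain a b' c where y: "a \<in> w\<^sub>0" "b' \<in> B" "c \<in> inv\<^bsub>W\<^esub> w\<^sub>0" "b = a \<otimes> b' \<otimes> c"
      using bB by (auto simp: opp_borel_def Let_def set_mult_def)
    then show ?thesis using W_units[OF w0_closed] W_units[OF units.weyl.inv_closed[OF w0_closed]] by simp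
  qed
  have minus: "n \<otimes> y \<otimes> iv n \<in> B' <#>\<^bsub>G\<^esub> w <#>\<^bsub>G\<^esub> B' \<longleftrightarrow> y \<in> units.cell (cw w)"
    if y: "y \<in> Units M" and w: "w \<in> carrier W" for y w
  proof
    assume "n \<otimes> y \<otimes> iv n \<in> B' <#>\<^bsub>G\<^esub> w <#>\<^bsub>G\<^esub> B'"
    then obtain a m b where m: "a \<in> B'" "m \<in> w" "b \<in> B'" "n \<otimes> y \<otimes> iv n = a \<otimes> m \<otimes> b"
      by (auto simp: set_mult_def)
    have u: "a \<in> Units M" "b \<in> Units M" "m \<in> Units M" using m w W_units B'_u by auto
    have "y = iv n \<otimes> (n \<otimes> y \<otimes> iv n) \<otimes> n" using nu y by (simp add: m_assoc)
    also have "\<dots> = (iv n \<otimes> a \<otimes> n) \<otimes> (iv n \<otimes> m \<otimes> n) \<otimes> (iv n \<otimes> b \<otimes> n)"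
      unfolding m(4) using nu u by (simp add: m_assoc)
    finally show "y \<in> units.cell (cw w)"
      using units.cellI[of "iv n \<otimes> a \<otimes> n" "iv n \<otimes> m \<otimes> n" "cw w" "iv n \<otimes> b \<otimes> n"] opp_borel_iff[OF n] u m in_cw[OF w]
      by simp
  next
    assume "y \<in> units.cell (cw w)"
    then obtain b k b' where k: "b \<in> B" "k \<in> cw w" "b' \<in> B" "y = b \<otimes> k \<otimes> b'"
      by (auto elim: units.cellE)
    have ku: "k \<in> Units M" using k cw[OF w] W_units by blast
    have "n \<otimes> y \<otimes> iv n = (n \<otimes> b \<otimes> iv n) \<otimes> (n \<otimes> k \<otimes> iv n) \<otimes> (n \<otimes> b' \<otimes> iv n)"
      using k ku nu by (simp add: m_assoc)
    moreover have "n \<otimes> b \<otimes> iv n \<in> B'" if "b \<in> B" for b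
      using opp_borel_iff[OF n, of "n \<otimes> b \<otimes> iv n"] that nu by (simp add: m_assoc)
    ultimately show "n \<otimes> y \<otimes> iv n \<in> B' <#>\<^bsub>G\<^esub> w <#>\<^bsub>G\<^esub> B'"
      using k of_cw[OF w k(2)] by (auto simp: set_mult_def)
  qed
  have minus_sub: "P_minus G B N S I \<subseteq> Units M"
    using B'_u W_units X by (auto simp: P_minus_def set_mult_def X_def[symmetric] subset_iff)
  \<comment> \<open>\<open>P'\<close> conjugated back by n, so that it contains B in place of the
    opposite Borel subgroup.\<close>
  define Q where "Q = {y \<in> Units M. n \<otimes> y \<otimes> iv n \<in> P'}"
  note P'g = subgroup.m_closed[OF P'_subgroup, simplified]
  have Q: "subgroup Q G"
  proof (rule units.finite_submonoid_subgroup[OF units.finite_G])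
    show "\<one>\<^bsub>G\<^esub> \<in> Q" using nu by (simp add: Q_def P'_iff)
    fix x y assume xy: "x \<in> Q" "y \<in> Q"
    then have "(n \<otimes> x \<otimes> iv n) \<otimes> (n \<otimes> y \<otimes> iv n) \<in> P'" using P'g by (simp add: Q_def)
    then show "x \<otimes>\<^bsub>G\<^esub> y \<in> Q" using xy nu by (simp add: Q_def m_assoc)
  qed (auto simp: Q_def)
  have BQ: "B \<subseteq> Q"
  proof
    fix b assume b: "b \<in> B"
    then have "n \<otimes> b \<otimes> iv n \<in> B'" using opp_borel_iff[OF n, of "n \<otimes> b \<otimes> iv n"] nu by (simp add: m_assoc)
    then show "b \<in> Q" using b B'_P' by (auto simp: Q_def)
  qed
  have "w \<subseteq> P \<longleftrightarrow> w \<in> X" if "w \<in> carrier W" for w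
  proof (rule units.conj_cells[OF P_subgroup B_P X, of g])
    show "g \<otimes>\<^bsub>G\<^esub> y \<otimes>\<^bsub>G\<^esub> iv g \<in> P \<longleftrightarrow> (\<exists>w\<in>X. y \<in> units.cell w)" if "y \<in> carrier G" for y
      using conj[of y "P_plus G B N I"] plus that unfolding P by simp
  qed (use g that in auto)
  moreover have "w \<subseteq> P' \<longleftrightarrow> w \<in> X" if w: "w \<in> carrier W" for w
  proof -
    have "cw w \<subseteq> Q \<longleftrightarrow> cw w \<in> cw ` X"
    proof (rule units.conj_cells[OF Q BQ, of "cw ` X" "iv n \<otimes> g \<otimes> n"])
      have "cw \<one>\<^bsub>W\<^esub> = \<one>\<^bsub>W\<^esub>" using w0_closed by (simp add: cw_def)
      then show "\<one>\<^bsub>W\<^esub> \<in> cw ` X" using X(2) by (metis imageI)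
      show "iv n \<otimes> g \<otimes> n \<otimes>\<^bsub>G\<^esub> y \<otimes>\<^bsub>G\<^esub> iv (iv n \<otimes> g \<otimes> n) \<in> Q \<longleftrightarrow> (\<exists>v\<in>cw ` X. y \<in> units.cell v)"
        if "y \<in> carrier G" for y
      proof -
        have y: "y \<in> Units M" using that by simp
        let ?z = "iv n \<otimes> g \<otimes> n \<otimes> y \<otimes> iv (iv n \<otimes> g \<otimes> n)"
        have "n \<otimes> ?z \<otimes> iv n = g \<otimes> (n \<otimes> y \<otimes> iv n) \<otimes> iv g"
          using y g nu by (simp add: iv_mult m_assoc)
        then have "?z \<in> Q \<longleftrightarrow> g \<otimes> (n \<otimes> y \<otimes> iv n) \<otimes> iv g \<in> P'" using y g nu by (simp add: Q_def)
        also have "\<dots> \<longleftrightarrow> n \<otimes> y \<otimes> iv n \<in> P_minus G B N S I"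
          unfolding P' using conj[OF _ minus_sub] y nu by simp
        also have "\<dots> \<longleftrightarrow> (\<exists>w\<in>X. y \<in> units.cell (cw w))"
          using minus[OF y] X by (auto simp: P_minus_def X_def[symmetric])
        finally show ?thesis by simp
      qed
    qed (use cw X w g nu in auto)
    also have "cw w \<subseteq> Q \<longleftrightarrow> w \<subseteq> P'"
    proof
      assume sub: "cw w \<subseteq> Q"
      show "w \<subseteq> P'"
      proof
        fix m assume m: "m \<in> w"
        then have "n \<otimes> (iv n \<otimes> m \<otimes> n) \<otimes> iv n \<in> P'" using in_cw[OF w m] sub by (auto simp: Q_def)
        then show "m \<in> P'" using nu W_units[OF w m] by (simp add: m_assoc)
      qed
    next
      assume "w \<subseteq> P'"
      then show "cw w \<subseteq> Q" using of_cw[OF w] W_units[OF cw[OF w]] by (auto simp: Q_def)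
    qed
    also have "cw w \<in> cw ` X \<longleftrightarrow> w \<in> X"
    proof
      assume "cw w \<in> cw ` X"
      then obtain v where v: "v \<in> X" "cw w = cw v" by blast
      then have "w = v" using cw_inv[OF w] cw_inv[of v] X(1) by auto
      then show "w \<in> X" using v by simp
    qed simp
    finally show ?thesis .
  qed
  ultimately show ?thesis using that I unfolding X_def by blast
qed

text \<open>A fixed choice, because the interpretation of \<open>orbit_cosets\<close> needs a term
  for the type of W(e); likewise \<open>K\<close> for W_e.\<close>

definition I :: "'a set set" where
  "I = (SOME I. I \<subseteq> S \<and> (\<forall>w\<in>carrier W. (w \<subseteq> P \<longleftrightarrow> w \<in> generate W I) \<and> (w \<subseteq> P' \<longleftrightarrow> w \<in> generate W I)))"

abbreviation "X \<equiv> generate W I"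

lemma I: "I \<subseteq> S" "w \<in> carrier W \<Longrightarrow> w \<subseteq> P \<longleftrightarrow> w \<in> X" "w \<in> carrier W \<Longrightarrow> w \<subseteq> P' \<longleftrightarrow> w \<in> X"
proof -
  have "\<exists>I. I \<subseteq> S \<and> (\<forall>w\<in>carrier W. (w \<subseteq> P \<longleftrightarrow> w \<in> generate W I) \<and> (w \<subseteq> P' \<longleftrightarrow> w \<in> generate W I))"
    using parabolic_pair by metis
  from someI_ex[OF this, folded I_def] show "I \<subseteq> S" "w \<in> carrier W \<Longrightarrow> w \<subseteq> P \<longleftrightarrow> w \<in> X"
    "w \<in> carrier W \<Longrightarrow> w \<subseteq> P' \<longleftrightarrow> w \<in> X" by blast+
qed

lemma X_carrier: "X \<subseteq> carrier W"
  using units.weyl.generate_in_carrier I(1) units.weyl.S_subset by blast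

lemma X_commute:
  assumes "w \<in> X" "n \<in> w" shows "n \<otimes> e = e \<otimes> n"
proof -
  have "n \<in> P" "n \<in> P'" using I(2,3)[of w] assms X_carrier by auto
  then show ?thesis by (simp add: P_iff P'_iff)
qed

text \<open>The equation n e = e m puts n into P(e) and m into P^-(e). Both contain the same classes
  of W, so either membership alone leads into \<open>X\<close>; \<open>commute_X'\<close> is the
  mirror image.\<close>

lemma commute_X:
  assumes "w \<in> carrier W" "n \<in> w" "m \<in> Units M" "n \<otimes> e = e \<otimes> m"
  shows "w \<in> X"
proof -
  have n: "n \<in> Units M" using W_units assms by blast
  have "e \<otimes> n \<otimes> e = e \<otimes> (n \<otimes> e)" using n by (simp add: m_assoc)
  also have "\<dots> = n \<otimes> e" unfolding assms(4) using assms(3) by simp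
  finally have nP: "n \<in> P" using n by (simp add: P_iff)
  have "w \<subseteq> P"
  proof
    fix k assume k: "k \<in> w"
    have "k \<otimes> iv n \<in> P" using units.weyl_eq_left[OF assms(1,2) k] units.T_B B_P by auto
    then have "k \<otimes> iv n \<otimes> n \<in> P" using subgroup.m_closed[OF P_subgroup _ nP] by simp
    then show "k \<in> P" using W_units[OF assms(1) k] n by simp
  qed
  then show ?thesis using I(2)[OF assms(1)] by blast
qed

lemma commute_X':
  assumes "w \<in> carrier W" "m \<in> w" "n \<in> Units M" "n \<otimes> e = e \<otimes> m"
  shows "w \<in> X"
proof -
  have m: "m \<in> Units M" using W_units assms by blast
  have "e \<otimes> m \<otimes> e = e \<otimes> m" unfolding assms(4)[symmetric] using assms(3) by (simp add: m_assoc)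
  then have mP: "m \<in> P'" using m by (simp add: P'_iff)
  have T: "t \<in> P'" if "t \<in> torus B N" for t
    using that T_commute[OF that] units.T_B[OF that] by (simp add: P'_iff m_assoc)
  have "w \<subseteq> P'"
  proof
    fix k assume k: "k \<in> w"
    have "k \<otimes> iv m \<in> P'" using T units.weyl_eq_left[OF assms(1,2) k] by auto
    then have "k \<otimes> iv m \<otimes> m \<in> P'" using subgroup.m_closed[OF P'_subgroup _ mP] by simp
    then show "k \<in> P'" using W_units[OF assms(1) k] m by simp
  qed
  then show ?thesis using I(3)[OF assms(1)] by blast
qed

lemma R_mult: "x \<otimes>\<^bsub>R\<^esub> y = x <#> y"
  by (simp add: renner_def Let_def)

lemma e_class_iff: "z \<in> e_class \<longleftrightarrow> (\<exists>t\<in>torus B N. z = t \<otimes> e)"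
  by (auto simp: e_class_def r_coset_def)

lemma mult_e_class_iff:
  assumes "w \<in> carrier W"
  shows "z \<in> w \<otimes>\<^bsub>R\<^esub> e_class \<longleftrightarrow> (\<exists>n\<in>w. z = n \<otimes> e)" "z \<in> e_class \<otimes>\<^bsub>R\<^esub> w \<longleftrightarrow> (\<exists>n\<in>w. z = e \<otimes> n)"
proof -
  have T: "t \<in> Units M" if "t \<in> torus B N" for t using that units.T_B by simp
  have u: "n \<in> Units M" if "n \<in> w" for n using W_units[OF assms that] .
  have "\<exists>n\<in>w. n' \<otimes> (t \<otimes> e) = n \<otimes> e" if "n' \<in> w" "t \<in> torus B N" for n' t
    using units.weyl_right[OF assms that] that T u by (auto intro!: bexI[of _ "n' \<otimes> t"] simp: m_assoc)
  moreover have "\<exists>t\<in>torus B N. n \<otimes> e = n \<otimes> (t \<otimes> e)" for n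
    using units.T_group(3) by (intro bexI[of _ "\<one>"]) auto
  ultimately show "z \<in> w \<otimes>\<^bsub>R\<^esub> e_class \<longleftrightarrow> (\<exists>n\<in>w. z = n \<otimes> e)"
    by (fastforce simp: R_mult set_mult_def e_class_iff)
  have "\<exists>n\<in>w. t \<otimes> e \<otimes> n' = e \<otimes> n" if "n' \<in> w" "t \<in> torus B N" for n' t
    using units.weyl_left[OF assms that] that T u T_commute[OF that(2)]
    by (auto intro!: bexI[of _ "t \<otimes> n'"] simp: m_assoc)
  moreover have "\<exists>t\<in>torus B N. e \<otimes> n = t \<otimes> e \<otimes> n" for n
    using units.T_group(3) by (intro bexI[of _ "\<one>"]) auto
  ultimately show "z \<in> e_class \<otimes>\<^bsub>R\<^esub> w \<longleftrightarrow> (\<exists>n\<in>w. z = e \<otimes> n)"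
    by (fastforce simp: R_mult set_mult_def e_class_iff)
qed

lemma elt_iff:
  assumes "x \<in> carrier W" "y \<in> carrier W"
  shows "z \<in> elt x y \<longleftrightarrow> (\<exists>m\<in>x. \<exists>k\<in>y. z = m \<otimes> e \<otimes> iv k)"
proof -
  have "z \<in> elt x y \<longleftrightarrow> (\<exists>a\<in>x \<otimes>\<^bsub>R\<^esub> e_class. \<exists>k\<in>inv\<^bsub>W\<^esub> y. z = a \<otimes> k)"
    unfolding elt_def R_mult[of "x \<otimes>\<^bsub>R\<^esub> e_class"] by (auto simp: set_mult_def)
  also have "\<dots> \<longleftrightarrow> (\<exists>m\<in>x. \<exists>k\<in>inv\<^bsub>W\<^esub> y. z = m \<otimes> e \<otimes> k)"
  proof -
    have "x \<otimes>\<^bsub>R\<^esub> e_class = (\<lambda>n. n \<otimes> e) ` x" using mult_e_class_iff(1)[OF assms(1)] by auto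
    then show ?thesis by simp
  qed
  also have "\<dots> \<longleftrightarrow> (\<exists>m\<in>x. \<exists>k\<in>y. z = m \<otimes> e \<otimes> iv k)"
    using units.weyl_inv[OF assms(2)] units.weyl_inv[OF units.weyl.inv_closed[OF assms(2)]]
      W_units[OF assms(2)] W_units[OF units.weyl.inv_closed[OF assms(2)]] assms(2)
    by (metis iv_iv units.weyl.inv_inv)
  finally show ?thesis .
qed

text \<open>Elements of T pass through representatives by normality in N and through e by
  \<open>T_commute\<close>. So each orbit element is one coset of T, and two of them agree as soon
  as they share a member.\<close>

lemma elt_eq_coset:
  assumes xy: "x \<in> carrier W" "y \<in> carrier W" and nk: "n \<in> x" "k \<in> y"
  shows "elt x y = (\<lambda>t. t \<otimes> (n \<otimes> e \<otimes> iv k)) ` torus B N"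
proof (rule Set.set_eqI)
  fix v
  let ?z = "n \<otimes> e \<otimes> iv k"
  have u: "n \<in> Units M" "k \<in> Units M" using W_units xy nk by auto
  show "v \<in> elt x y \<longleftrightarrow> v \<in> (\<lambda>t. t \<otimes> ?z) ` torus B N"
  proof
    assume "v \<in> elt x y"
    then obtain m j where m: "m \<in> x" "j \<in> y" "v = m \<otimes> e \<otimes> iv j" using elt_iff[OF xy] by blast
    have mu: "m \<in> Units M" "j \<in> Units M" using W_units m xy by auto
    define t where "t = iv j \<otimes> k"
    have t: "t \<in> torus B N" "t \<in> Units M"
      using units.weyl_eq_right[OF xy(2) m(2) nk(2)] mu u by (simp_all add: t_def)
    have mt: "m \<otimes> t \<in> x" using units.weyl_right[OF xy(1) m(1) t(1)] by simp
    define r where "r = m \<otimes> t \<otimes> iv n"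
    have r: "r \<in> torus B N" "r \<in> Units M"
      using units.weyl_eq_left[OF xy(1) nk(1) mt] u mu t by (simp_all add: r_def)
    have "r \<otimes> ?z = m \<otimes> (t \<otimes> e) \<otimes> iv k" using u mu t by (simp add: r_def m_assoc)
    also have "\<dots> = m \<otimes> e \<otimes> (t \<otimes> iv k)" unfolding T_commute[OF t(1)] using u mu t by (simp add: m_assoc)
    also have "t \<otimes> iv k = iv j" using u mu by (simp add: t_def m_assoc)
    finally show "v \<in> (\<lambda>t. t \<otimes> ?z) ` torus B N" using m(3) r(1) by (metis imageI)
  next
    assume "v \<in> (\<lambda>t. t \<otimes> ?z) ` torus B N"
    then obtain t where t: "t \<in> torus B N" "v = t \<otimes> ?z" by blast
    have "t \<in> Units M" using t units.T_B by simp
    then have "v = (t \<otimes> n) \<otimes> e \<otimes> iv k" using t u by (simp add: m_assoc)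
    moreover have "t \<otimes> n \<in> x" using units.weyl_left[OF xy(1) nk(1) t(1)] by simp
    ultimately show "v \<in> elt x y" using elt_iff[OF xy] nk(2) by blast
  qed
qed

lemma W_comm_eq: "W_comm = X"
proof
  show "W_comm \<subseteq> X"
  proof
    fix w assume "w \<in> W_comm"
    then have w: "w \<in> carrier W" "w \<otimes>\<^bsub>R\<^esub> e_class = e_class \<otimes>\<^bsub>R\<^esub> w" by (auto simp: W_comm_def)
    obtain n where n: "n \<in> w" using units.weyl_nonempty w by blast
    then obtain m where "m \<in> w" "n \<otimes> e = e \<otimes> m" using mult_e_class_iff[OF w(1), of "n \<otimes> e"] w(2) by auto
    then show "w \<in> X" using commute_X[OF w(1) n] W_units[OF w(1)] by blast
  qed
  show "X \<subseteq> W_comm"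
  proof
    fix w assume w: "w \<in> X"
    then have wc: "w \<in> carrier W" using X_carrier by blast
    have "w \<otimes>\<^bsub>R\<^esub> e_class = e_class \<otimes>\<^bsub>R\<^esub> w"
      by (rule Set.set_eqI) (simp add: mult_e_class_iff[OF wc] X_commute[OF w])
    then show "w \<in> W_comm" using wc by (simp add: W_comm_def)
  qed
qed

lemma W_fix_iff: "w \<in> W_fix \<longleftrightarrow> w \<in> carrier W \<and> (\<exists>n\<in>w. n \<otimes> e = e)"
proof (cases "w \<in> carrier W")
  case w: True
  have T: "t \<in> Units M" if "t \<in> torus B N" for t using that units.T_B by simp
  have "w \<otimes>\<^bsub>R\<^esub> e_class = e_class" if n: "n \<in> w" "n \<otimes> e = e" for n
  proof -
    have nu: "n \<in> Units M" using W_units w n by blast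
    have eq: "(\<exists>m\<in>w. z = m \<otimes> e) \<longleftrightarrow> (\<exists>t\<in>torus B N. z = t \<otimes> e)" for z
    proof
      assume "\<exists>m\<in>w. z = m \<otimes> e"
      then obtain m where m: "m \<in> w" "z = m \<otimes> e" by blast
      have "m \<otimes> iv n \<otimes> e = m \<otimes> iv n \<otimes> (n \<otimes> e)" using n by simp
      also have "\<dots> = z" using m nu W_units[OF w m(1)] by (simp add: m_assoc)
      finally show "\<exists>t\<in>torus B N. z = t \<otimes> e" using units.weyl_eq_left[OF w n(1) m(1)] by auto
    next
      assume "\<exists>t\<in>torus B N. z = t \<otimes> e"
      then obtain t where t: "t \<in> torus B N" "z = t \<otimes> e" by blast
      then have "z = t \<otimes> n \<otimes> e" using n nu T by (simp add: m_assoc)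
      then show "\<exists>m\<in>w. z = m \<otimes> e" using units.weyl_left[OF w n(1) t(1)] by auto
    qed
    show ?thesis by (rule Set.set_eqI) (simp only: mult_e_class_iff(1)[OF w] e_class_iff eq)
  qed
  moreover have "\<exists>n\<in>w. n \<otimes> e = e" if "w \<otimes>\<^bsub>R\<^esub> e_class = e_class"
  proof -
    have "\<one> \<otimes> e \<in> e_class" unfolding e_class_iff
      using units.T_group(3) by (intro bexI[of _ \<one>]) simp_all
    then have "\<one> \<otimes> e \<in> w \<otimes>\<^bsub>R\<^esub> e_class" using that by simp
    then obtain n where "n \<in> w" "\<one> \<otimes> e = n \<otimes> e" using mult_e_class_iff(1)[OF w] by blast
    then show ?thesis by (intro bexI[of _ n]) simp_all
  qed
  ultimately show ?thesis using w by (auto simp: W_fix_def)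
qed (simp add: W_fix_def)

definition K :: "'a set set" where "K = (SOME K. K \<subseteq> S \<and> W_fix = generate W K)"

lemma K: "K \<subseteq> S" "W_fix = generate W K"
proof -
  have "\<exists>K. K \<subseteq> S \<and> W_fix = generate W K" using W_fix_parabolic by (auto simp: standard_parabolic_def)
  from someI_ex[OF this, folded K_def] show "K \<subseteq> S" "W_fix = generate W K" by blast+
qed

sublocale orb: orbit_cosets W S I K W_comm W_fix elt
proof
  show "I \<subseteq> S" "W_comm = X" "K \<subseteq> S" "W_fix = generate W K" using I(1) W_comm_eq K by auto
  show sub: "W_fix \<subseteq> W_comm"
  proof
    fix w assume "w \<in> W_fix"
    then obtain n where n: "w \<in> carrier W" "n \<in> w" "n \<otimes> e = e" by (auto simp: W_fix_iff)
    then show "w \<in> W_comm" using commute_X[of w n "\<one>"] by (simp add: W_comm_eq)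
  qed
  show "inv\<^bsub>W\<^esub> h \<otimes>\<^bsub>W\<^esub> k \<otimes>\<^bsub>W\<^esub> h \<in> W_fix" if h: "h \<in> W_comm" and k: "k \<in> W_fix" for h k
  proof -
    have hc: "h \<in> carrier W" "h \<in> X" using h X_carrier by (auto simp: W_comm_eq)
    obtain n where n: "k \<in> carrier W" "n \<in> k" "n \<otimes> e = e" using k by (auto simp: W_fix_iff)
    obtain m where m: "m \<in> h" using units.weyl_nonempty hc by blast
    have u: "m \<in> Units M" "n \<in> Units M" using W_units m n hc by auto
    have me: "m \<otimes> e = e \<otimes> m" using X_commute hc m by blast
    have "iv m \<otimes> n \<otimes> m \<otimes> e = iv m \<otimes> (n \<otimes> e) \<otimes> m" using u me by (simp add: m_assoc)
    also have "\<dots> = iv m \<otimes> (m \<otimes> e)" unfolding n(3) me using u by (simp add: m_assoc)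
    finally have "iv m \<otimes> n \<otimes> m \<otimes> e = e" using u by simp
    moreover have "iv m \<otimes> n \<otimes> m \<in> inv\<^bsub>W\<^esub> h \<otimes>\<^bsub>W\<^esub> k \<otimes>\<^bsub>W\<^esub> h"
      using units.weyl_mult[OF units.weyl_mult[OF units.weyl_inv[OF hc(1) m] n(2)] m] by simp
    ultimately show ?thesis using hc n by (auto simp: W_fix_iff)
  qed
  show "elt x y = elt x' y' \<longleftrightarrow> inv\<^bsub>W\<^esub> x \<otimes>\<^bsub>W\<^esub> x' \<in> W_comm \<and>
      inv\<^bsub>W\<^esub> (inv\<^bsub>W\<^esub> x \<otimes>\<^bsub>W\<^esub> x') \<otimes>\<^bsub>W\<^esub> (inv\<^bsub>W\<^esub> y \<otimes>\<^bsub>W\<^esub> y') \<in> W_fix" (is "_ \<longleftrightarrow> ?a \<in> _ \<and> inv\<^bsub>W\<^esub> ?a \<otimes>\<^bsub>W\<^esub> ?b \<in> _")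
    if x: "x \<in> carrier W" and y: "y \<in> carrier W" and x': "x' \<in> carrier W" and y': "y' \<in> carrier W" for x y x' y'
  proof
    assume eq: "elt x y = elt x' y'"
    obtain n k where n: "n \<in> x" "k \<in> y" using units.weyl_nonempty x y by blast
    then have "n \<otimes> e \<otimes> iv k \<in> elt x' y'" using elt_iff[OF x y] eq by blast
    then obtain n' k' where n': "n' \<in> x'" "k' \<in> y'" "n \<otimes> e \<otimes> iv k = n' \<otimes> e \<otimes> iv k'"
      using elt_iff[OF x' y'] by blast
    have u: "n \<in> Units M" "k \<in> Units M" "n' \<in> Units M" "k' \<in> Units M"
      using W_units n n' x y x' y' by auto
    \<comment> \<open>Cancelling in n e k^-1 = n' e k'^-1 gives a e = e b. This places the class of
      a and the class of b in W(e); then a e = b e, so a^-1 b fixes e.\<close>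
    define a b where "a = iv n \<otimes> n'" and "b = iv k \<otimes> k'"
    have ab: "a \<in> Units M" "b \<in> Units M" "a \<in> ?a" "b \<in> ?b"
      using u units.weyl_mult[OF units.weyl_inv[OF x n(1)] n'(1)] units.weyl_mult[OF units.weyl_inv[OF y n(2)] n'(2)]
      by (simp_all add: a_def b_def)
    have "a \<otimes> e = iv n \<otimes> (n' \<otimes> e \<otimes> iv k') \<otimes> k'" using u by (simp add: a_def m_assoc)
    also have "\<dots> = e \<otimes> b" unfolding n'(3)[symmetric] using u by (simp add: b_def m_assoc)
    finally have e: "a \<otimes> e = e \<otimes> b" .
    have aX: "?a \<in> X" using commute_X[OF _ ab(3,2) e] x x' by simp
    have bX: "?b \<in> X" using commute_X'[OF _ ab(4,1) e] y y' by simp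
    have "a \<otimes> e = b \<otimes> e" using X_commute[OF bX ab(4)] e by simp
    then have "iv a \<otimes> b \<otimes> e = e" using ab by (simp add: m_assoc flip: \<open>a \<otimes> e = b \<otimes> e\<close>)
    moreover have "iv a \<otimes> b \<in> inv\<^bsub>W\<^esub> ?a \<otimes>\<^bsub>W\<^esub> ?b"
      using units.weyl_mult[OF units.weyl_inv[OF _ ab(3)] ab(4)] x x' by simp
    ultimately have "inv\<^bsub>W\<^esub> ?a \<otimes>\<^bsub>W\<^esub> ?b \<in> W_fix" using x y x' y' by (auto simp: W_fix_iff)
    then show "?a \<in> W_comm \<and> inv\<^bsub>W\<^esub> ?a \<otimes>\<^bsub>W\<^esub> ?b \<in> W_fix" using aX W_comm_eq by simp
  next
    assume ab: "?a \<in> W_comm \<and> inv\<^bsub>W\<^esub> ?a \<otimes>\<^bsub>W\<^esub> ?b \<in> W_fix"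
    then have aX: "?a \<in> X" using W_comm_eq by simp
    obtain f where f: "f \<in> inv\<^bsub>W\<^esub> ?a \<otimes>\<^bsub>W\<^esub> ?b" "f \<otimes> e = e" using ab by (auto simp: W_fix_iff)
    have fX: "inv\<^bsub>W\<^esub> ?a \<otimes>\<^bsub>W\<^esub> ?b \<in> X" using ab sub W_comm_eq by auto
    have fu: "f \<in> Units M" using W_units[OF _ f(1)] x y x' y' by simp
    have fe: "e \<otimes> iv f = e"
    proof -
      have "e \<otimes> f = e" using X_commute[OF fX f(1)] f(2) by simp
      then have "e \<otimes> f \<otimes> iv f = e \<otimes> iv f" by simp
      then show ?thesis using fu by simp
    qed
    obtain n k where n: "n \<in> x" "k \<in> y" using units.weyl_nonempty x y by blast
    obtain a where a: "a \<in> ?a" using units.weyl_nonempty[of ?a] x x' by auto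
    have au: "a \<in> Units M" using W_units[OF _ a] x x' by simp
    have u: "n \<in> Units M" "k \<in> Units M" using W_units n x y by auto
    have ae: "a \<otimes> e = e \<otimes> a" using X_commute[OF aX a] .
    have na: "n \<otimes> a \<in> x'" using units.weyl_mult[OF n(1) a] x x' by simp
    have "k \<otimes> (a \<otimes> f) \<in> y \<otimes>\<^bsub>W\<^esub> (?a \<otimes>\<^bsub>W\<^esub> (inv\<^bsub>W\<^esub> ?a \<otimes>\<^bsub>W\<^esub> ?b))"
      using units.weyl_mult[OF n(2) units.weyl_mult[OF a f(1)]] by simp
    then have kaf: "k \<otimes> (a \<otimes> f) \<in> y'" using x y x' y' by simp
    \<comment> \<open>\<open>n a\<close> represents x' and \<open>k a f\<close> represents y'; the
      two orbit elements are shown to share this member.\<close>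
    have "(n \<otimes> a) \<otimes> e \<otimes> iv (k \<otimes> (a \<otimes> f)) = n \<otimes> (a \<otimes> (e \<otimes> iv f)) \<otimes> (iv a \<otimes> iv k)"
      using u au fu by (simp add: iv_mult m_assoc)
    also have "\<dots> = n \<otimes> e \<otimes> iv k" unfolding fe ae using u au by (simp add: m_assoc)
    finally have common: "n \<otimes> e \<otimes> iv k = (n \<otimes> a) \<otimes> e \<otimes> iv (k \<otimes> (a \<otimes> f))" by simp
    show "elt x y = elt x' y'"
      using elt_eq_coset[OF x y n] elt_eq_coset[OF x' y' na kaf] common by simp
  qed
qed

section \<open>Transfer to the orbit Hecke algebra and conclusion\<close>

lemma orbit_eq: "orbit = orb.Orb"
proof
  show "orbit \<subseteq> orb.Orb"
  proof
    fix \<sigma> assume "\<sigma> \<in> orbit"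
    then obtain x y where "x \<in> carrier W" "y \<in> carrier W" "\<sigma> = x \<otimes>\<^bsub>R\<^esub> e_class \<otimes>\<^bsub>R\<^esub> y"
      by (auto simp: orbit_def)
    then show "\<sigma> \<in> orb.Orb" using orb.elt_Orb[of x "inv\<^bsub>W\<^esub> y"] by (simp add: elt_def)
  qed
  show "orb.Orb \<subseteq> orbit" by (auto simp: orb.Orb_def orbit_def elt_def)
qed

lemma std_form_elt:
  assumes "x \<in> orb.DE" "y \<in> orb.D"
  shows "std_form (elt x y) = (x, y)"
  unfolding std_form_def D_fix_def D_comm_def
  by (rule the_equality) (use assms orb.elt_std_eq in auto)

lemma orbit_len_elt:
  assumes "x \<in> orb.DE" "y \<in> orb.D"
  shows "orbit_len (elt x y) = int (\<l> x) + e_len - int (\<l> y)"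
  by (simp add: orbit_len_def std_form_elt[OF assms])

lemma mult_elt:
  assumes "s \<in> carrier W" "x \<in> carrier W" "y \<in> carrier W"
  shows "s \<otimes>\<^bsub>R\<^esub> elt x y = elt (s \<otimes>\<^bsub>W\<^esub> x) y"
proof (rule Set.set_eqI)
  fix z
  have sx: "m \<in> s \<otimes>\<^bsub>W\<^esub> x \<longleftrightarrow> (\<exists>a\<in>s. \<exists>m'\<in>x. m = a \<otimes> m')" for m
    by (auto simp: units.weyl_mult_eq set_mult_def)
  have "z \<in> s \<otimes>\<^bsub>R\<^esub> elt x y \<longleftrightarrow> (\<exists>a\<in>s. \<exists>v\<in>elt x y. z = a \<otimes> v)"
    by (auto simp: R_mult set_mult_def)
  also have "\<dots> \<longleftrightarrow> (\<exists>a\<in>s. \<exists>m\<in>x. \<exists>k\<in>y. z = a \<otimes> (m \<otimes> e \<otimes> iv k))"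
    using elt_iff[OF assms(2,3)] by (simp add: Bex_def) blast
  also have "\<dots> \<longleftrightarrow> (\<exists>a\<in>s. \<exists>m\<in>x. \<exists>k\<in>y. z = a \<otimes> m \<otimes> e \<otimes> iv k)"
    using W_units[OF assms(1)] W_units[OF assms(2)] W_units[OF assms(3)]
    by (intro bex_cong refl) (simp add: m_assoc)
  also have "\<dots> \<longleftrightarrow> z \<in> elt (s \<otimes>\<^bsub>W\<^esub> x) y"
    unfolding elt_iff[OF units.weyl.m_closed[OF assms(1,2)] assms(3)] using sx by (simp add: Bex_def) blast
  finally show "z \<in> s \<otimes>\<^bsub>R\<^esub> elt x y \<longleftrightarrow> z \<in> elt (s \<otimes>\<^bsub>W\<^esub> x) y" .
qed

sublocale mod: orbit_module W S I K W_comm W_fix elt "\<lambda>s \<sigma>. s \<otimes>\<^bsub>R\<^esub> \<sigma>" orbit_len e_len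
  by unfold_locales (simp_all add: mult_elt orbit_len_elt)

lemma orbit_gen_eq: "orbit_gen = mod.ogen (qpow (- 1))"
  by (intro ext) (simp add: orbit_gen_def mod.ogen_def basis_unit_vec)

lemma orbit_R_eq:
  assumes "x \<in> orb.DE" "t \<in> orb.D"
  shows "orbit_R \<theta> (elt x t) = mod.Q_R \<theta> x t"
proof -
  have o: "elt x t \<in> orbit" using assms orb.elt_Orb by (simp add: orbit_eq)
  have fin: "finite orbit" by (simp add: orbit_eq)
  have "orbit_bar (basis (elt x t)) \<theta> = (\<Sum>\<sigma>\<in>orbit. if \<sigma> = elt x t then orbit_bar_basis \<sigma> \<theta> else 0)"
    unfolding orbit_bar_def by (intro sum.cong) (auto simp: basis_def)
  also have "\<dots> = orbit_bar_basis (elt x t) \<theta>" using o fin by simp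
  also have "\<dots> = qpow (int (\<l> x) - int (\<l> t)) * ev (mod.Q_R \<theta> x t)"
    using mod.bar_basis_eq[OF assms, of \<theta>]
    by (simp add: orbit_bar_basis_def std_form_elt[OF assms] orbit_act_def orbit_gen_eq orbit_eq D_comm_def)
  also have "int (\<l> x) - int (\<l> t) = orbit_len (elt x t) - e_len"
    by (simp add: orbit_len_elt[OF assms])
  finally show ?thesis unfolding orbit_R_def by (rule units.weyl.the_ev_eq)
qed

lemma orbit_le_elt:
  assumes "u \<in> orb.DE" "v \<in> orb.D" "x \<in> orb.DE" "y \<in> orb.D"
  shows "orbit_le (elt u v) (elt x y) \<longleftrightarrow> mod.std_le (u, v) (x, y)"
  by (simp add: orbit_le_def std_form_elt assms mod.std_le_def)

lemma orbit_moebius_eq: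
  assumes "\<theta> \<in> orbit" "\<sigma> \<in> orbit"
  shows "orbit_moebius \<theta> \<sigma> = poly (orbit_R \<theta> \<sigma>) 0"
  unfolding orbit_moebius_def
proof (rule moebius_unique[where R = "\<lambda>\<sigma>. poly (orbit_R \<theta> \<sigma>) 0"])
  have std: "\<exists>x\<in>orb.DE. \<exists>y\<in>orb.D. \<sigma> = elt x y" if "\<sigma> \<in> orbit" for \<sigma>
    using that orb.elt_std_exists unfolding orbit_eq by metis
  show "finite orbit" by (simp add: orbit_eq)
  show "orbit_le a a" if "a \<in> orbit" for a
    using std[OF that] orbit_le_elt mod.std_le_refl by auto
  show "a = b" if "a \<in> orbit" "b \<in> orbit" "orbit_le a b" "orbit_le b a" for a b
  proof -
    obtain x y where a: "x \<in> orb.DE" "y \<in> orb.D" "a = elt x y" using std \<open>a \<in> orbit\<close> by blast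
    obtain u v where b: "u \<in> orb.DE" "v \<in> orb.D" "b = elt u v" using std \<open>b \<in> orbit\<close> by blast
    show ?thesis using mod.std_le_antisym[of "(x, y)" "(u, v)"] that a b orbit_le_elt by auto
  qed
  show "orbit_le a c" if "a \<in> orbit" "b \<in> orbit" "c \<in> orbit" "orbit_le a b" "orbit_le b c" for a b c
  proof -
    obtain x y where a: "x \<in> orb.DE" "y \<in> orb.D" "a = elt x y" using std \<open>a \<in> orbit\<close> by blast
    obtain u v where b: "u \<in> orb.DE" "v \<in> orb.D" "b = elt u v" using std \<open>b \<in> orbit\<close> by blast
    obtain f g where c: "f \<in> orb.DE" "g \<in> orb.D" "c = elt f g" using std \<open>c \<in> orbit\<close> by blast
    show ?thesis using mod.std_le_trans[of "(x, y)" "(u, v)" "(f, g)"] that a b c orbit_le_elt by auto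
  qed
  show "(\<Sum>\<tau>\<in>{\<tau> \<in> orbit. orbit_le \<tau> \<sigma>}. poly (orbit_R \<theta> \<tau>) 0) = (if \<theta> = \<sigma> then 1 else 0)"
    if "\<sigma> \<in> orbit" for \<sigma>
  proof -
    obtain x y where \<sigma>: "x \<in> orb.DE" "y \<in> orb.D" "\<sigma> = elt x y" using std \<open>\<sigma> \<in> orbit\<close> by blast
    let ?A = "{\<tau> \<in> orb.DE \<times> orb.D. mod.std_le \<tau> (x, y)}"
    \<comment> \<open>Uniqueness of standard forms turns the ideal below \<open>\<sigma>\<close>
      into a set of pairs, to which \<open>R0_sum\<close> applies.\<close>
    have img: "{\<tau> \<in> orbit. orbit_le \<tau> \<sigma>} = (\<lambda>(u, v). elt u v) ` ?A"
    proof
      show "{\<tau> \<in> orbit. orbit_le \<tau> \<sigma>} \<subseteq> (\<lambda>(u, v). elt u v) ` ?A"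
      proof
        fix \<tau> assume \<tau>: "\<tau> \<in> {\<tau> \<in> orbit. orbit_le \<tau> \<sigma>}"
        then obtain u v where uv: "u \<in> orb.DE" "v \<in> orb.D" "\<tau> = elt u v" using std by blast
        then have "(u, v) \<in> ?A" using \<tau> \<sigma> orbit_le_elt by auto
        then show "\<tau> \<in> (\<lambda>(u, v). elt u v) ` ?A" using uv by force
      qed
      show "(\<lambda>(u, v). elt u v) ` ?A \<subseteq> {\<tau> \<in> orbit. orbit_le \<tau> \<sigma>}"
        using orbit_le_elt \<sigma> by (auto simp: orbit_eq)
    qed
    have inj: "inj_on (\<lambda>(u, v). elt u v) ?A"
      using orb.elt_std_eq by (auto simp: inj_on_def)
    have "(\<Sum>\<tau>\<in>{\<tau> \<in> orbit. orbit_le \<tau> \<sigma>}. poly (orbit_R \<theta> \<tau>) 0) = (\<Sum>(u, v)\<in>?A. poly (orbit_R \<theta> (elt u v)) 0)"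
      unfolding img sum.reindex[OF inj] by (simp add: case_prod_unfold)
    also have "\<dots> = (\<Sum>(u, v)\<in>?A. mod.R0 \<theta> u v)"
      by (intro sum.cong refl) (auto simp: orbit_R_eq mod.Q_R_zero)
    also have "\<dots> = (if \<theta> = \<sigma> then 1 else 0)" using mod.R0_sum \<sigma> by simp
    finally show ?thesis .
  qed
qed (use assms in auto)

end

text \<open>The third assumption records that W_e is a standard parabolic subgroup, as the notions
  state; uniqueness of standard forms rests on it. That W(e) is standard parabolic is derived, in
  \<open>parabolic_pair\<close> and \<open>W_comm_eq\<close>.\<close>

theorem corollary5p7:
  fixes M :: "('a, 'b) monoid_scheme"
    and B N :: "'a set" and S :: "'a set set" and p :: nat
    and e :: 'a and \<theta> \<sigma> :: "'a set"
  assumes "finite_monoid_of_Lie_type M B N S p"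
    and "e \<in> cross_section M B N S"
    and "standard_parabolic (weyl (units_of M) B N) S (orbit_data.W_fix M B N S e)"
    and "\<theta> \<in> orbit_data.orbit M B N S e"
    and "\<sigma> \<in> orbit_data.orbit M B N S e"
  shows "orbit_data.orbit_moebius M B N S e \<theta> \<sigma> = poly (orbit_data.orbit_R M B N S e \<theta> \<sigma>) 0"
proof -
  interpret finite_monoid_of_Lie_type M B N S p by (rule assms(1))
  interpret lie_type_orbit M B N S p e by unfold_locales (rule assms(2,3))+
  show ?thesis using orbit_moebius_eq assms(4,5) .
qed

end
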